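(* Let $G$ be a second-countable unimodular amenable locally compact group with Haar measure $\mu_G$, and let $(\pi, \mathcal{H}_\pi)$ be an integrable irreducible projective unitary representation of $G$ of formal degree $d_\pi > 0$. Let $\Lambda \subseteq G$ be discrete. Suppose that $\pi(\Lambda) g = (\pi(\lambda) g)_{\lambda \in \Lambda}$ is a frame for $\mathcal{H}_\pi$ with $g \in \mathcal{B}^1_\pi$, and that $D^-(\Lambda) > d_\pi$. Then there exists $\Gamma \subseteq \Lambda$ with $D^-(\Gamma) > 0$ such that $(\pi(\lambda) g)_{\lambda \in \Lambda \setminus \Gamma}$ is a frame for $\mathcal{H}_\pi$.
   Context: Fix a compact symmetric neighborhood $Q \subseteq G$ of the identity. Projective representations: A projective unitary representation $(\pi,\mathcal{H}_\pi)$ of $G$ on a Hilbert space $\mathcal{H}_\pi$ is a strongly measurable map $\pi : G \to \mathcal{U}(\mathcal{H}_\pi)$ with $\pi(xy) = \sigma(x,y)\pi(x)\pi(y)$ for all $x,y\in G$, for some function $\sigma : G\times G \to \mathbb{T}$. It is irreducible if $\{0\}$ and $\mathcal{H}_\pi$ are the only closed subspaces invariant under all $\pi(x)$, $x\in G$. For $f,g\in\mathcal{H}_\pi$ put $V_g f(x) = \langle f,\pi(x)g\rangle$, $x \in G$. The irreducible representation $\pi$ is square-integrable (a discrete series representation) if $\int_G |V_g g|^2\,d\mu_G<\infty$ for some $g\neq 0$; it is integrable if $\int_G |V_g g|\,d\mu_G<\infty$ for some $g\ne 0$ (this implies square-integrability). The formal degree of a square-integrable $\pi$ is the number $d_\pi>0$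 such that $\int_G \langle f_1,\pi(x)g_1\rangle\langle\pi(x)g_2,f_2\rangle\,d\mu_G(x) = d_\pi^{-1}\langle f_1,f_2\rangle\overline{\langle g_1,g_2\rangle}$ for all $f_1,f_2,g_1,g_2\in\mathcal{H}_\pi$. Localized vectors: For $F \in L^\infty_{\mathrm{loc}}(G)$ let $M^L F(x) = \operatorname{ess\,sup}_{z\in Q}|F(xz)|$, and $W^L(L^1) = \{F\in L^\infty_{\mathrm{loc}}(G) : M^LF\in L^1(G)\}$. Then $\mathcal{B}^1_\pi = \{g\in\mathcal{H}_\pi : V_g g\in W^L(L^1)\}$. Frames: A family $(g_i)_{i\in I}$ in $\mathcal{H}_\pi$ is a frame for $\mathcal{H}_\pi$ if there are constants $0<A\le B<\infty$ with $A\|f\|^2\le\sum_{i\in I}|\langle f,g_i\rangle|^2\le B\|f\|^2$ for all $f\in\mathcal{H}_\pi$. Beurling density: A (right) strong Følner sequence is a sequence $(K_n)_{n\in\mathbb{N}}$ of compact sets $K_n \subseteq G$ of positive measure such that, for every compact $K\subseteq G$, $\mu_G(K_nK\,\Delta\,K_n)/\mu_G(K_n)\to 0$ and $\mu_G(K_nK\cap K_n^cK)/\mu_G(K_n)\to0$ as $n\to\infty$. Such sequences exist since $G$ is amenable. The lower Beurling density of a discrete set $\Lambda\subseteq G$ is $D^-(\Lambda) = \lim_{n\to\infty}\inf_{x\in G}\frac{\#(\Lambda\cap xK_n)}{\mu_G(K_n)}$, where $(K_n)_{n \in \mathbb{N}}$ is any strong Følner sequence (the value does not depend on this choice). *)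

theory Defs
  imports "HOL-Analysis.Analysis" "HOL-Probability.Essential_Supremum"
begin

(* Groups are written additively, because the library's class of topological groups is
   topological_group_add.  It extends group_add, so commutativity is NOT assumed:
   x + y, - x, 0 stand for the product, inverse and identity of an arbitrary group, and
   A + B (for sets), x +o A for the product set and the left translate. *)

subsection \<open>Complex Hilbert spaces\<close>

(* The inner product is linear in the first argument, which is the convention under which
   the orthogonality relations below have the right-hand side <f1,f2> * cnj <g1,g2> / d. *)

class complex_hilbert_space = banach +
  fixes scaleC :: "complex \<Rightarrow> 'a \<Rightarrow> 'a" (infixr \<open>*\<^sub>C\<close> 75)
    and cinner :: "'a \<Rightarrow> 'a \<Rightarrow> complex"
  assumes scaleC_add_right: "a *\<^sub>C (x + y) = a *\<^sub>C x + a *\<^sub>C y"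
    and scaleC_add_left: "(a + b) *\<^sub>C x = a *\<^sub>C x + b *\<^sub>C x"
    and scaleC_scaleC: "a *\<^sub>C b *\<^sub>C x = (a * b) *\<^sub>C x"
    and scaleC_of_real: "complex_of_real r *\<^sub>C x = r *\<^sub>R x"
    and cinner_commute: "cinner x y = cnj (cinner y x)"
    and cinner_add_left: "cinner (x + y) z = cinner x z + cinner y z"
    and cinner_scaleC_left: "cinner (a *\<^sub>C x) y = a * cinner x y"
    and cinner_self: "cinner x x = complex_of_real ((norm x)\<^sup>2)"

interpretation complex_vector:
  vector_space "scaleC :: complex \<Rightarrow> 'a \<Rightarrow> 'a::complex_hilbert_space"
proof
  fix a b :: complex and x y :: 'a
  show "a *\<^sub>C (x + y) = a *\<^sub>C x + a *\<^sub>C y" by (rule scaleC_add_right)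
  show "(a + b) *\<^sub>C x = a *\<^sub>C x + b *\<^sub>C x" by (rule scaleC_add_left)
  show "a *\<^sub>C b *\<^sub>C x = (a * b) *\<^sub>C x" by (rule scaleC_scaleC)
  show "1 *\<^sub>C x = x" using scaleC_of_real[of 1 x] by simp
qed

definition unitary :: "('h::complex_hilbert_space \<Rightarrow> 'h) \<Rightarrow> bool" where
  "unitary U \<longleftrightarrow> Vector_Spaces.linear scaleC scaleC U \<and> surj U
     \<and> (\<forall>x y. cinner (U x) (U y) = cinner x y)"

definition is_frame :: "('i \<Rightarrow> 'h::complex_hilbert_space) \<Rightarrow> 'i set \<Rightarrow> bool" where
  "is_frame v I \<longleftrightarrow> (\<exists>A B::real. 0 < A \<and> A \<le> B \<and>
     (\<forall>f. (\<lambda>i. (cmod (cinner f (v i)))\<^sup>2) summable_on I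
        \<and> A * (norm f)\<^sup>2 \<le> (\<Sum>\<^sub>\<infinity>i\<in>I. (cmod (cinner f (v i)))\<^sup>2)
        \<and> (\<Sum>\<^sub>\<infinity>i\<in>I. (cmod (cinner f (v i)))\<^sup>2) \<le> B * (norm f)\<^sup>2))"

subsection \<open>Haar measure and amenability\<close>

(* A left Haar measure.  Regularity need not be required: on a second-countable locally
   compact Hausdorff space every Borel measure that is finite on compact sets is regular. *)
definition haar_measure :: "'g::topological_group_add measure \<Rightarrow> bool" where
  "haar_measure mu \<longleftrightarrow> sets mu = sets borel \<and> emeasure mu UNIV \<noteq> 0
     \<and> (\<forall>K. compact K \<longrightarrow> emeasure mu K < \<infinity>)
     \<and> (\<forall>x. \<forall>A\<in>sets borel. emeasure mu ((\<lambda>y. x + y) ` A) = emeasure mu A)"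

(* The group is unimodular iff its left Haar measure is also right invariant. *)
definition unimodular :: "'g::topological_group_add measure \<Rightarrow> bool" where
  "unimodular mu \<longleftrightarrow>
     (\<forall>x. \<forall>A\<in>sets borel. emeasure mu ((\<lambda>y. y + x) ` A) = emeasure mu A)"

definition Linfty :: "'g measure \<Rightarrow> ('g \<Rightarrow> real) set" where
  "Linfty mu = {F \<in> borel_measurable mu. \<exists>C. AE x in mu. \<bar>F x\<bar> \<le> C}"

(* Existence of a left-invariant mean on L^infinity.  The mean acts on representatives;
   linearity and positivity force it to depend only on the almost-everywhere class. *)
definition amenable :: "'g::topological_group_add measure \<Rightarrow> bool" where
  "amenable mu \<longleftrightarrow> (\<exists>m :: ('g \<Rightarrow> real) \<Rightarrow> real.
     (\<forall>F\<in>Linfty mu. \<forall>H\<in>Linfty mu. m (\<lambda>x. F x + H x) = m F + m H)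
   \<and> (\<forall>F\<in>Linfty mu. \<forall>c. m (\<lambda>x. c * F x) = c * m F)
   \<and> (\<forall>F\<in>Linfty mu. (AE x in mu. 0 \<le> F x) \<longrightarrow> 0 \<le> m F)
   \<and> m (\<lambda>x. 1) = 1
   \<and> (\<forall>F\<in>Linfty mu. \<forall>y. m (\<lambda>x. F (y + x)) = m F))"

subsection \<open>Projective representations\<close>

definition projective_unitary_rep ::
    "('g::topological_group_add \<Rightarrow> 'h::complex_hilbert_space \<Rightarrow> 'h) \<Rightarrow> bool" where
  "projective_unitary_rep \<pi> \<longleftrightarrow>
     (\<forall>x. unitary (\<pi> x))
   \<and> (\<forall>f. (\<lambda>x. \<pi> x f) \<in> borel_measurable borel)
   \<and> (\<exists>\<sigma> :: 'g \<Rightarrow> 'g \<Rightarrow> complex. (\<forall>x y. cmod (\<sigma> x y) = 1)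
        \<and> (\<forall>x y f. \<pi> (x + y) f = \<sigma> x y *\<^sub>C \<pi> x (\<pi> y f)))"

definition irreducible_rep :: "('g \<Rightarrow> 'h::complex_hilbert_space \<Rightarrow> 'h) \<Rightarrow> bool" where
  "irreducible_rep \<pi> \<longleftrightarrow>
     (\<forall>S. closed S \<and> complex_vector.subspace S \<and> (\<forall>x. \<pi> x ` S \<subseteq> S) \<longrightarrow> S = {0} \<or> S = UNIV)"

definition coeff ::
    "('g \<Rightarrow> 'h::complex_hilbert_space \<Rightarrow> 'h) \<Rightarrow> 'h \<Rightarrow> 'h \<Rightarrow> 'g \<Rightarrow> complex" where
  "coeff \<pi> g f x = cinner f (\<pi> x g)"

definition integrable_rep ::
    "'g measure \<Rightarrow> ('g \<Rightarrow> 'h::complex_hilbert_space \<Rightarrow> 'h) \<Rightarrow> bool" where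
  "integrable_rep mu \<pi> \<longleftrightarrow> (\<exists>g. g \<noteq> 0 \<and> integrable mu (\<lambda>x. cmod (coeff \<pi> g g x)))"

definition formal_degree ::
    "'g measure \<Rightarrow> ('g \<Rightarrow> 'h::complex_hilbert_space \<Rightarrow> 'h) \<Rightarrow> real \<Rightarrow> bool" where
  "formal_degree mu \<pi> d \<longleftrightarrow> 0 < d \<and>
     (\<forall>f1 f2 g1 g2. has_bochner_integral mu
        (\<lambda>x. cinner f1 (\<pi> x g1) * cinner (\<pi> x g2) f2)
        (complex_of_real (inverse d) * cinner f1 f2 * cnj (cinner g1 g2)))"

subsection \<open>Localized vectors\<close>

definition Linfty_loc :: "'g::topological_group_add measure \<Rightarrow> ('g \<Rightarrow> complex) set" where
  "Linfty_loc mu = {F \<in> borel_measurable mu.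
     \<forall>K. compact K \<longrightarrow> (\<exists>C. AE x in mu. x \<in> K \<longrightarrow> cmod (F x) \<le> C)}"

definition maximal_left ::
    "'g::topological_group_add measure \<Rightarrow> 'g set \<Rightarrow> ('g \<Rightarrow> complex) \<Rightarrow> 'g \<Rightarrow> ennreal" where
  "maximal_left mu Q F x = esssup (restrict_space mu Q) (\<lambda>z. ennreal (cmod (F (x + z))))"

definition wiener_left ::
    "'g::topological_group_add measure \<Rightarrow> 'g set \<Rightarrow> ('g \<Rightarrow> complex) set" where
  "wiener_left mu Q = {F \<in> Linfty_loc mu. maximal_left mu Q F \<in> borel_measurable mu
     \<and> (\<integral>\<^sup>+x. maximal_left mu Q F x \<partial>mu) < \<infinity>}"

definition localized_vectors ::
    "'g::topological_group_add measure \<Rightarrow> 'g set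
      \<Rightarrow> ('g \<Rightarrow> 'h::complex_hilbert_space \<Rightarrow> 'h) \<Rightarrow> 'h set" where
  "localized_vectors mu Q \<pi> = {g. coeff \<pi> g g \<in> wiener_left mu Q}"

subsection \<open>Beurling density\<close>

(* The test set C must be nonempty: for C = {} the first quotient would be constantly 1.
   UNIV - K n is the complement of K n. *)
definition strong_folner_seq ::
    "'g::topological_group_add measure \<Rightarrow> (nat \<Rightarrow> 'g set) \<Rightarrow> bool" where
  "strong_folner_seq mu K \<longleftrightarrow>
     (\<forall>n. compact (K n) \<and> 0 < measure mu (K n))
   \<and> (\<forall>C. compact C \<and> C \<noteq> {} \<longrightarrow>
        (\<lambda>n. measure mu (sym_diff (K n + C) (K n)) / measure mu (K n)) \<longlonglongrightarrow> 0
      \<and> (\<lambda>n. measure mu ((K n + C) \<inter> ((UNIV - K n) + C)) / measure mu (K n)) \<longlonglongrightarrow> 0)"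

(* Points are counted with values in [0,\<infinity>], so that infinite intersections count as \<infinity>.
   For a strong Folner sequence the value is independent of K; K is kept as a parameter. *)
definition lower_density ::
    "'g::topological_group_add measure \<Rightarrow> (nat \<Rightarrow> 'g set) \<Rightarrow> 'g set \<Rightarrow> ennreal" where
  "lower_density mu K \<Lambda> =
     lim (\<lambda>n. INF x. emeasure (count_space UNIV) (\<Lambda> \<inter> (x +o K n)) / emeasure mu (K n))"

end

(* Write S for the frame operator of f_l = pi(l) g and let T be a truncated Neumann series for
   S^-1.  The orthogonality relations express <T f_l, f_l> as an integral of
   <T f_l, pi(y) g> <pi(y) g, f_l> over y, and summing over l in \<Lambda> first gives
   <T S pi(y) g, pi(y) g>, which is close to |g|^2.  Hence the sum of <T f_l, f_l> over l in
   \<Lambda> \<inter> x K_n is at most (d + small) mu(K_n), uniformly in x.  As D^-(\<Lambda>) > d, a subset of \<Lambda> of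
   positive lower density has <T f_l, f_l> \<le> 1 - \<epsilon>.  T is a polynomial in S, so the matrix
   <T f_l, f_m> inherits uniform l^1 decay off the diagonal from g; no Wiener lemma for the
   exact inverse is needed.  On a maximal sufficiently separated subset \<Gamma> the Gram matrix of T
   therefore has norm < 1 by the Schur test, which bounds the frame sum over \<Gamma> by a proper
   fraction of the sum over \<Lambda>. *)
theory Submission
  imports Defs
begin

text \<open>The constants have to be chosen in a fixed order. The density gap \<eta> fixes
  \<epsilon>, and with it the Gram bound \<theta> = 1 - \<epsilon>/2. Only then can the error
  \<delta> of the approximate inverse be made so small that the loss factor 1 + \<delta> B / A does
  not push the bound back up to 1. This fixes the truncation order, and the truncation order fixes
  the separation distance. Positivity of D^-(\<Gamma>) is thus obtained without control of its size.
  Two obstacles shape the rest. The coefficient V x = |<g, pi(x) g>| is known only to be measurable,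
  and its maximal function bounds it only almost everywhere, whereas sums over \<Lambda> see single
  points; convolution by means of the reproducing formula repairs this. Moreover, the density is
  defined as a limit, whose existence has to be established for \<Lambda> and again for \<Gamma>;
  the uniform count \<open>thin\<close>, obtained from the Bessel inequality and inherited by
  subsets, serves both.\<close>

subsection \<open>Positive operators and Neumann series\<close>

lemma cinner_add_right: "cinner x (y + z) = cinner x y + cinner x z"
  by (metis cinner_commute cinner_add_left complex_cnj_add)

lemma cinner_scaleC_right: "cinner x (a *\<^sub>C y) = cnj a * cinner x y"
  by (metis cinner_commute cinner_scaleC_left complex_cnj_mult)

lemma cinner_scaleR_left: "cinner (r *\<^sub>R x) y = of_real r * cinner x y"
  by (metis cinner_scaleC_left scaleC_of_real)

lemma cinner_scaleR_right: "cinner x (r *\<^sub>R y) = of_real r * cinner x y"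
  by (metis cinner_scaleC_right scaleC_of_real complex_cnj_complex_of_real)

lemma cinner_zero_left [simp]: "cinner 0 x = 0"
  using cinner_scaleR_left[of 0 0 x] by simp

lemma cinner_zero_right [simp]: "cinner x 0 = 0"
  using cinner_scaleR_right[of x 0 0] by simp

lemma cinner_minus_left: "cinner (- x) y = - cinner x y"
  using cinner_scaleR_left[of "-1" x y] by simp

lemma cinner_minus_right: "cinner x (- y) = - cinner x y"
  using cinner_scaleR_right[of x "-1" y] by simp

lemma cinner_diff_left: "cinner (x - y) z = cinner x z - cinner y z"
  using cinner_add_left[of x "- y" z] by (simp add: cinner_minus_left)

lemma cinner_diff_right: "cinner x (y - z) = cinner x y - cinner x z"
  using cinner_add_right[of x y "- z"] by (simp add: cinner_minus_right)

lemma cinner_sum_left: "cinner (\<Sum>i\<in>A. f i) y = (\<Sum>i\<in>A. cinner (f i) y)"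
  by (induction A rule: infinite_finite_induct) (auto simp: cinner_add_left)

lemma cinner_sum_right: "cinner y (\<Sum>i\<in>A. f i) = (\<Sum>i\<in>A. cinner y (f i))"
  by (induction A rule: infinite_finite_induct) (auto simp: cinner_add_right)

lemma cmod_cinner_commute: "cmod (cinner x y) = cmod (cinner y x)"
  by (metis cinner_commute complex_mod_cnj)

lemma cinner_eqI:
  assumes "\<And>z. cinner x z = cinner y z"
  shows "x = y"
proof -
  have "cinner (x - y) (x - y) = 0"
    by (simp add: cinner_diff_left assms)
  then show ?thesis
    by (simp add: cinner_self)
qed

text \<open>Symmetry carries linearity with it, since vectors are determined by their inner
  products; the second clause makes \<open>cinner (P x) y\<close> a semidefinite form.\<close>

definition pos_op :: "('h::complex_hilbert_space \<Rightarrow> 'h) \<Rightarrow> bool" where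
  "pos_op P \<longleftrightarrow> (\<forall>x y. cinner (P x) y = cinner x (P y)) \<and> (\<forall>x. 0 \<le> Re (cinner (P x) x))"

lemma pos_op_sym: "pos_op P \<Longrightarrow> cinner (P x) y = cinner x (P y)"
  and pos_op_nonneg: "pos_op P \<Longrightarrow> 0 \<le> Re (cinner (P x) x)"
  by (auto simp: pos_op_def)

lemma pos_op_add: "pos_op P \<Longrightarrow> P (x + y) = P x + P y"
  by (rule cinner_eqI) (simp add: pos_op_sym cinner_add_left)

lemma pos_op_scaleC: "pos_op P \<Longrightarrow> P (a *\<^sub>C x) = a *\<^sub>C P x"
  by (rule cinner_eqI) (simp add: pos_op_sym cinner_scaleC_left)

lemma pos_op_diff: "pos_op P \<Longrightarrow> P (x - y) = P x - P y"
  by (rule cinner_eqI) (simp add: pos_op_sym cinner_diff_left)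

lemma pos_op_scaleR: "pos_op P \<Longrightarrow> P (r *\<^sub>R x) = r *\<^sub>R P x"
  by (rule cinner_eqI) (simp add: pos_op_sym cinner_scaleR_left)

lemma pos_op_id: "pos_op (\<lambda>x. x)"
  by (simp add: pos_op_def cinner_self)

text \<open>The discriminant argument for the form of \<open>P\<close>. The form is only
  semidefinite, so the case \<open>b = 0\<close> is treated separately.\<close>

lemma pos_op_cauchy_schwarz:
  assumes "pos_op P"
  shows "(cmod (cinner (P x) y))\<^sup>2 \<le> Re (cinner (P x) x) * Re (cinner (P y) y)"
proof -
  define z where "z = cinner (P x) y"
  define a where "a = Re (cinner (P x) x)"
  define b where "b = Re (cinner (P y) y)"
  have z': "cinner (P y) x = cnj z"
    unfolding z_def by (metis assms cinner_commute pos_op_sym)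
  have quad: "0 \<le> a - 2 * s * (cmod z)\<^sup>2 + s\<^sup>2 * (cmod z)\<^sup>2 * b" for s :: real
  proof -
    \<comment> \<open>Building \<open>z\<close> into the coefficient makes both cross terms the same
      real number, and the form becomes a real quadratic in \<open>s\<close>.\<close>
    define t where "t = of_real s * z"
    have "cinner (P (x - t *\<^sub>C y)) (x - t *\<^sub>C y)
        = cinner (P x) x - cnj t * z - t * cnj z + t * cnj t * cinner (P y) y"
      by (simp add: pos_op_diff[OF assms] pos_op_scaleC[OF assms] cinner_diff_left
          cinner_diff_right cinner_scaleC_left cinner_scaleC_right z' flip: z_def)
        (simp add: algebra_simps)
    moreover have "t * cnj t = of_real (s\<^sup>2 * (cmod z)\<^sup>2)"
      unfolding t_def by (simp add: power2_eq_square complex_norm_square algebra_simps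
          flip: of_real_mult)
        (simp add: complex_norm_square[symmetric] power2_eq_square)
    moreover have "cnj t * z = of_real (s * (cmod z)\<^sup>2)" "t * cnj z = of_real (s * (cmod z)\<^sup>2)"
      unfolding t_def by (simp_all add: complex_norm_square algebra_simps del: of_real_power)
    ultimately have "Re (cinner (P (x - t *\<^sub>C y)) (x - t *\<^sub>C y))
        = a - 2 * s * (cmod z)\<^sup>2 + s\<^sup>2 * (cmod z)\<^sup>2 * b"
      by (simp add: a_def b_def)
    then show ?thesis
      using pos_op_nonneg[OF assms, of "x - t *\<^sub>C y"] by simp
  qed
  have "0 \<le> b" "0 \<le> a"
    using assms by (simp_all add: a_def b_def pos_op_nonneg)
  have "(cmod z)\<^sup>2 \<le> a * b"
  proof (cases "b = 0")
    case True
    have "cmod z = 0"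
    proof (rule ccontr)
      assume "cmod z \<noteq> 0"
      \<comment> \<open>For \<open>b = 0\<close> the quadratic is affine in \<open>s\<close>; at the
        chosen \<open>s\<close> its value is -a - 2.\<close>
      then show False
        using quad[of "(a + 1) / (cmod z)\<^sup>2"] True \<open>0 \<le> a\<close> by simp
    qed
    then show ?thesis using True by simp
  next
    case False
    \<comment> \<open>The quadratic attains its minimum at s = 1/b.\<close>
    then show ?thesis
      using quad[of "1 / b"] \<open>0 \<le> b\<close> by (simp add: field_simps power2_eq_square)
  qed
  then show ?thesis
    by (simp add: z_def a_def b_def)
qed

lemma Re_cinner_self: "Re (cinner x x) = (norm x)\<^sup>2"
  by (simp add: cinner_self)

lemma cinner_cauchy_schwarz: "cmod (cinner x y) \<le> norm x * norm y"
  using pos_op_cauchy_schwarz[OF pos_op_id, of x y]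
  by (simp add: Re_cinner_self power2_le_iff_abs_le flip: power_mult_distrib)

lemma Re_cinner_le: "Re (cinner x y) \<le> norm x * norm y"
  using cinner_cauchy_schwarz[of x y] complex_Re_le_cmod[of "cinner x y"] by linarith

lemma bounded_linear_cinner_left: "bounded_linear (\<lambda>x. cinner x y)"
  by (rule bounded_linear_intro[where K = "norm y"])
    (auto simp: cinner_add_left cinner_scaleR_left cinner_cauchy_schwarz scaleR_conv_of_real)

lemma bounded_linear_cinner_right: "bounded_linear (\<lambda>y. cinner x y)"
  by (rule bounded_linear_intro[where K = "norm x"])
    (auto simp: cinner_add_right cinner_scaleR_right scaleR_conv_of_real mult.commute,
     metis cinner_cauchy_schwarz mult.commute)

text \<open>Cauchy-Schwarz for the form of \<open>P\<close>, applied to \<open>f\<close> and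
  \<open>P f\<close>; one factor (norm (P f))^2 cancels. For positive maps a bound on the quadratic
  form is therefore a norm bound.\<close>

lemma pos_op_norm_le:
  assumes "pos_op P" "\<And>f. Re (cinner (P f) f) \<le> r * (norm f)\<^sup>2" "0 \<le> r"
  shows "norm (P f) \<le> r * norm f"
proof -
  have "((norm (P f))\<^sup>2)\<^sup>2 = (cmod (cinner (P f) (P f)))\<^sup>2"
    by (simp add: cinner_self norm_power)
  also have "\<dots> \<le> Re (cinner (P f) f) * Re (cinner (P (P f)) (P f))"
    by (rule pos_op_cauchy_schwarz[OF assms(1)])
  also have "\<dots> \<le> (r * (norm f)\<^sup>2) * (r * (norm (P f))\<^sup>2)"
    using assms by (intro mult_mono assms(2)) (auto simp: pos_op_nonneg)
  finally have *: "(norm (P f))\<^sup>2 * (norm (P f))\<^sup>2 \<le> (r * norm f)\<^sup>2 * (norm (P f))\<^sup>2"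
    by (simp add: power2_eq_square algebra_simps)
  show ?thesis
  proof (cases "norm (P f) = 0")
    case False
    then have "(norm (P f))\<^sup>2 \<le> (r * norm f)\<^sup>2"
      using mult_right_le_imp_le[OF *] by simp
    then show ?thesis
      using assms(3) by (simp add: power2_le_iff_abs_le)
  qed (use assms(3) in simp)
qed

section \<open>Truncated Neumann series\<close>

definition resid :: "('h::complex_hilbert_space \<Rightarrow> 'h) \<Rightarrow> real \<Rightarrow> 'h \<Rightarrow> 'h" where
  "resid S B f = f - (1 / B) *\<^sub>R S f"

text \<open>A partial sum of S^-1 = (1/B) sum of (1 - S/B)^k. Scaling by the upper frame bound makes
  1 - S/B positive with norm at most 1 - A/B, so the remainder decays geometrically.\<close>

definition neumann :: "('h::complex_hilbert_space \<Rightarrow> 'h) \<Rightarrow> real \<Rightarrow> nat \<Rightarrow> 'h \<Rightarrow> 'h" where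
  "neumann S B N f = (1 / B) *\<^sub>R (\<Sum>k<N. (resid S B ^^ k) f)"

lemma pos_op_funpow:
  assumes "pos_op P"
  shows "pos_op (P ^^ n)"
proof -
  have sym: "cinner ((P ^^ n) x) y = cinner x ((P ^^ n) y)" for n x y
    by (induction n arbitrary: x y) (simp_all add: pos_op_sym[OF assms] funpow_swap1)
  have "0 \<le> Re (cinner ((P ^^ n) x) x)" for x
  proof -
    \<comment> \<open>An even power is a square, with value the squared norm of
      \<open>(P ^^ k) x\<close>; an odd power is \<open>P\<close> tested on
      \<open>(P ^^ k) x\<close>.\<close>
    define k where "k = n div 2"
    consider "n = k + k" | "n = k + Suc k"
      unfolding k_def by linarith
    then show ?thesis
    proof cases
      case 1
      then show ?thesis
        by (simp only: funpow_add o_apply) (simp add: sym[of k "(P ^^ k) x"] Re_cinner_self)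
    next
      case 2
      have "cinner ((P ^^ n) x) x = cinner (P ((P ^^ k) x)) ((P ^^ k) x)"
        by (simp only: 2 funpow_add o_apply sym funpow.simps)
      then show ?thesis
        by (simp add: pos_op_nonneg[OF assms])
    qed
  qed
  with sym show ?thesis
    by (simp add: pos_op_def)
qed

context
  fixes S :: "'h::complex_hilbert_space \<Rightarrow> 'h" and A B :: real
  assumes S: "pos_op S" and AB: "0 < A" "A \<le> B"
    and lower: "\<And>f. A * (norm f)\<^sup>2 \<le> Re (cinner (S f) f)"
    and upper: "\<And>f. Re (cinner (S f) f) \<le> B * (norm f)\<^sup>2"
begin

lemma Re_cinner_resid: "Re (cinner (resid S B f) f) = (norm f)\<^sup>2 - Re (cinner (S f) f) / B"
  by (simp add: resid_def cinner_diff_left cinner_scaleR_left Re_cinner_self)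

lemma pos_op_resid: "pos_op (resid S B)"
proof -
  have "0 \<le> Re (cinner (resid S B x) x)" for x
    using upper[of x] AB by (simp add: Re_cinner_resid field_simps)
  moreover have "cinner (resid S B x) y = cinner x (resid S B y)" for x y
    by (simp add: resid_def cinner_diff_left cinner_diff_right cinner_scaleR_left
        cinner_scaleR_right pos_op_sym[OF S])
  ultimately show ?thesis
    by (simp add: pos_op_def)
qed

lemma norm_resid_funpow_le: "norm ((resid S B ^^ n) f) \<le> (1 - A / B) ^ n * norm f"
proof (induction n)
  case (Suc n)
  have "norm (resid S B f) \<le> (1 - A / B) * norm f" for f
  proof (rule pos_op_norm_le[OF pos_op_resid])
    show "Re (cinner (resid S B f) f) \<le> (1 - A / B) * (norm f)\<^sup>2" for f
      using lower[of f] AB by (simp add: Re_cinner_resid field_simps)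
    show "0 \<le> 1 - A / B" using AB by simp
  qed
  then have "norm ((resid S B ^^ Suc n) f) \<le> (1 - A / B) * norm ((resid S B ^^ n) f)"
    by simp
  also have "\<dots> \<le> (1 - A / B) * ((1 - A / B) ^ n * norm f)"
    by (intro mult_left_mono Suc) (use AB in simp)
  finally show ?case by (simp add: mult_ac)
qed simp

lemma pos_op_neumann: "pos_op (neumann S B N)"
proof -
  note pow = pos_op_funpow[OF pos_op_resid]
  have "cinner (neumann S B N x) y = cinner x (neumann S B N y)" for x y
    by (simp add: neumann_def cinner_scaleR_left cinner_scaleR_right cinner_sum_left
        cinner_sum_right pos_op_sym[OF pow])
  moreover have "0 \<le> Re (cinner (neumann S B N x) x)" for x
    using AB by (auto simp: neumann_def cinner_scaleR_left cinner_sum_left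
        intro!: sum_nonneg divide_nonneg_pos pos_op_nonneg[OF pow])
  ultimately show ?thesis
    by (simp add: pos_op_def)
qed

text \<open>The bound grows with the number of terms, which is harmless: \<open>N\<close> is fixed
  before any limit along the Folner sequence is taken.\<close>

lemma norm_neumann_le: "norm (neumann S B N f) \<le> N / B * norm f"
proof -
  have "norm ((resid S B ^^ k) f) \<le> norm f" for k
  proof -
    have "(1 - A / B) ^ k * norm f \<le> 1 * norm f"
      using AB by (intro mult_right_mono power_le_one) auto
    then show ?thesis
      using norm_resid_funpow_le[of k f] by linarith
  qed
  then have "norm (\<Sum>k<N. (resid S B ^^ k) f) \<le> (\<Sum>k<N. norm f)"
    by (rule sum_norm_le)
  then show ?thesis
    using AB by (simp add: neumann_def divide_right_mono)
qed

text \<open>With R = 1 - S/B one has R^k S / B = R^k - R^(k+1), so the sum telescopes.\<close>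

lemma neumann_inverse: "f - neumann S B N (S f) = (resid S B ^^ N) f"
proof -
  note pow = pos_op_funpow[OF pos_op_resid]
  have "(1 / B) *\<^sub>R (resid S B ^^ k) (S f) = (resid S B ^^ k) f - (resid S B ^^ Suc k) f" for k
  proof -
    have "(1 / B) *\<^sub>R (resid S B ^^ k) (S f) = (resid S B ^^ k) (f - resid S B f)"
      by (simp add: pos_op_scaleR[OF pow, symmetric] resid_def)
    then show ?thesis
      by (simp add: pos_op_diff[OF pow] funpow_swap1)
  qed
  then have "neumann S B N (S f)
      = (\<Sum>k<N. (resid S B ^^ k) f - (resid S B ^^ Suc k) f)"
    by (simp add: neumann_def scaleR_sum_right)
  then show ?thesis
    using sum_lessThan_telescope'[of "\<lambda>k. (resid S B ^^ k) f" N] by (simp only: funpow_0) simp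
qed

lemma neumann_approx:
  assumes "0 < \<delta>"
  shows "\<exists>N. \<forall>f. norm (f - neumann S B N (S f)) \<le> \<delta> * norm f"
proof -
  have "(\<lambda>n. (1 - A / B) ^ n) \<longlonglongrightarrow> 0"
    by (rule LIMSEQ_power_zero) (use AB in simp)
  then have "eventually (\<lambda>n. (1 - A / B) ^ n < \<delta>) sequentially"
    using assms by (rule order_tendstoD(2))
  then obtain N where N: "(1 - A / B) ^ N < \<delta>"
    unfolding eventually_sequentially by blast
  have "norm (f - neumann S B N (S f)) \<le> \<delta> * norm f" for f
    unfolding neumann_inverse
    by (rule order_trans[OF norm_resid_funpow_le]) (use N in \<open>simp add: mult_right_mono\<close>)
  then show ?thesis by blast
qed

end

section \<open>Bessel sequences\<close>

definition bessel_seq :: "real \<Rightarrow> ('i \<Rightarrow> 'h::complex_hilbert_space) \<Rightarrow> 'i set \<Rightarrow> bool" where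
  "bessel_seq B v I \<longleftrightarrow>
     (\<forall>f F. finite F \<longrightarrow> F \<subseteq> I \<longrightarrow> (\<Sum>i\<in>F. (cmod (cinner f (v i)))\<^sup>2) \<le> B * (norm f)\<^sup>2)"

text \<open>Duality: synthesis is adjoint to analysis and has the same bound. Pairing the sum
  \<open>u\<close> with itself brings in the coefficients of \<open>u\<close>, to which the Bessel
  inequality applies; one factor (norm u)^2 then cancels.\<close>

lemma bessel_seq_norm_sum:
  assumes "bessel_seq B v I" "0 \<le> B" "finite F" "F \<subseteq> I"
  shows "(norm (\<Sum>i\<in>F. c i *\<^sub>C v i))\<^sup>2 \<le> B * (\<Sum>i\<in>F. (cmod (c i))\<^sup>2)"
proof -
  define u where "u = (\<Sum>i\<in>F. c i *\<^sub>C v i)"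
  define s where "s = (\<Sum>i\<in>F. (cmod (c i))\<^sup>2)"
  have "0 \<le> s" by (auto simp: s_def intro: sum_nonneg)
  have "(norm u)\<^sup>2 = cmod (cinner u u)"
    by (simp add: cinner_self norm_power)
  also have "cinner u u = (\<Sum>i\<in>F. c i * cinner (v i) u)"
    by (subst (1) u_def) (simp add: cinner_sum_left cinner_scaleC_left)
  also have "cmod \<dots> \<le> (\<Sum>i\<in>F. \<bar>cmod (c i)\<bar> * \<bar>cmod (cinner u (v i))\<bar>)"
    by (rule sum_norm_le) (simp add: norm_mult cmod_cinner_commute)
  also have "\<dots> \<le> L2_set (\<lambda>i. cmod (c i)) F * L2_set (\<lambda>i. cmod (cinner u (v i))) F"
    by (rule L2_set_mult_ineq)
  finally have "(norm u)\<^sup>2 \<le> sqrt s * L2_set (\<lambda>i. cmod (cinner u (v i))) F"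
    by (simp add: L2_set_def s_def)
  then have "((norm u)\<^sup>2)\<^sup>2 \<le> (sqrt s * L2_set (\<lambda>i. cmod (cinner u (v i))) F)\<^sup>2"
    by (intro power_mono) auto
  also have "\<dots> = s * (\<Sum>i\<in>F. (cmod (cinner u (v i)))\<^sup>2)"
    using \<open>0 \<le> s\<close> by (simp add: power_mult_distrib L2_set_def sum_nonneg)
  also have "\<dots> \<le> s * (B * (norm u)\<^sup>2)"
    using assms \<open>0 \<le> s\<close> by (intro mult_left_mono) (auto simp: bessel_seq_def)
  finally have "(norm u)\<^sup>2 * (norm u)\<^sup>2 \<le> (B * s) * (norm u)\<^sup>2"
    by (simp add: power2_eq_square mult_ac)
  from mult_right_le_imp_le[OF this] show ?thesis
    unfolding u_def[symmetric] s_def[symmetric]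
    using \<open>0 \<le> s\<close> \<open>0 \<le> B\<close> by (cases "(norm u)\<^sup>2 = 0") (auto dest: mult_right_le_imp_le)
qed

subsection \<open>Removing frame elements\<close>

text \<open>Cauchy criterion for unconditional sums: square-summable coefficients have small tails,
  and the synthesis bound turns these into small norms.\<close>

lemma bessel_seq_summable:
  fixes v :: "'i \<Rightarrow> 'h::complex_hilbert_space"
  assumes v: "bessel_seq B v I" "0 < B" and c: "(\<lambda>i. (cmod (c i))\<^sup>2) summable_on I"
  shows "(\<lambda>i. c i *\<^sub>C v i) summable_on I"
proof -
  let ?f = "\<lambda>i. c i *\<^sub>C v i" and ?p = "\<lambda>i. (cmod (c i))\<^sup>2"
  have "\<exists>P. eventually P (finite_subsets_at_top I) \<and>
      (\<forall>F F'. P F \<and> P F' \<longrightarrow> dist (sum ?f F) (sum ?f F') < e)" if "e > 0" for e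
  proof -
    \<comment> \<open>Then B \<epsilon> = (e/3)^2, so each of two finite sums extending the one over
      \<open>F0\<close> lies within e/3 of it.\<close>
    define \<epsilon> where "\<epsilon> = e\<^sup>2 / (9 * B)"
    have "\<epsilon> > 0" using that v by (simp add: \<epsilon>_def)
    then obtain F0 where F0: "finite F0" "F0 \<subseteq> I" "dist (sum ?p F0) (infsum ?p I) \<le> \<epsilon>"
      using infsum_finite_approximation[OF c] by blast
    have small: "norm (sum ?f G) \<le> e / 3" if "finite G" "G \<subseteq> I" "G \<inter> F0 = {}" for G
    proof -
      have "sum ?p (F0 \<union> G) \<le> infsum ?p I"
        using that F0 by (intro finite_sum_le_infsum c) auto
      then have "sum ?p G \<le> \<epsilon>"
        using F0 that by (simp add: sum.union_disjoint Int_commute dist_real_def)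
      then have "B * sum ?p G \<le> B * \<epsilon>"
        using v by simp
      then have "(norm (sum ?f G))\<^sup>2 \<le> (e / 3)\<^sup>2"
        using bessel_seq_norm_sum[OF v(1) _ that(1,2), of c] v
        by (simp add: \<epsilon>_def power_divide)
      then show ?thesis
        using \<open>e > 0\<close> by (simp add: power2_le_iff_abs_le)
    qed
    define P where "P F \<longleftrightarrow> finite F \<and> F0 \<subseteq> F \<and> F \<subseteq> I" for F
    have "eventually P (finite_subsets_at_top I)"
      unfolding eventually_finite_subsets_at_top P_def using F0 by blast
    moreover have "dist (sum ?f F1) (sum ?f F2) < e" if "P F1" "P F2" for F1 F2
    proof -
      have "dist (sum ?f F) (sum ?f F0) \<le> e / 3" if "P F" for F
        using that small[of "F - F0"] F0 by (auto simp: P_def dist_norm sum_diff)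
      from this[OF that(1)] this[OF that(2)] show ?thesis
        using dist_triangle2[of "sum ?f F1" "sum ?f F2" "sum ?f F0"] \<open>e > 0\<close> by linarith
    qed
    ultimately show ?thesis by blast
  qed
  then have "cauchy_filter (filtermap (sum ?f) (finite_subsets_at_top I))"
    by (simp add: cauchy_filter_metric_filtermap)
  moreover have "complete (UNIV::'h set)"
    by (meson Cauchy_convergent UNIV_I complete_def convergent_def)
  ultimately obtain L where "(sum ?f \<longlongrightarrow> L) (finite_subsets_at_top I)"
    using complete_uniform[where S=UNIV] by (force simp add: filterlim_def)
  then show ?thesis
    using summable_on_def has_sum_def by blast
qed

text \<open>The weak form of S f = sum of <f, v_i> v_i, which suits termwise estimates of matrix
  entries.\<close>

definition frame_op_of :: "('h::complex_hilbert_space \<Rightarrow> 'h) \<Rightarrow> ('i \<Rightarrow> 'h) \<Rightarrow> 'i set \<Rightarrow> bool" where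
  "frame_op_of S v I \<longleftrightarrow>
     (\<forall>f h. ((\<lambda>i. cinner f (v i) * cinner (v i) h) has_sum cinner (S f) h) I)"

definition frame_bounds :: "real \<Rightarrow> real \<Rightarrow> ('i \<Rightarrow> 'h::complex_hilbert_space) \<Rightarrow> 'i set \<Rightarrow> bool" where
  "frame_bounds A B v I \<longleftrightarrow> 0 < A \<and> A \<le> B \<and>
     (\<forall>f. (\<lambda>i. (cmod (cinner f (v i)))\<^sup>2) summable_on I
        \<and> A * (norm f)\<^sup>2 \<le> (\<Sum>\<^sub>\<infinity>i\<in>I. (cmod (cinner f (v i)))\<^sup>2)
        \<and> (\<Sum>\<^sub>\<infinity>i\<in>I. (cmod (cinner f (v i)))\<^sup>2) \<le> B * (norm f)\<^sup>2)"

lemma is_frame_iff_bounds: "is_frame v I \<longleftrightarrow> (\<exists>A B. frame_bounds A B v I)"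
  by (simp add: is_frame_def frame_bounds_def)

lemma frame_bounds_bessel: "frame_bounds A B v I \<Longrightarrow> bessel_seq B v I"
  unfolding frame_bounds_def bessel_seq_def
  by (meson finite_sum_le_infsum order_trans zero_le_power2)

lemma frame_op_exists:
  assumes "bessel_seq B v I" "0 < B"
  shows "\<exists>S. frame_op_of S v I"
proof -
  define S where "S f = (\<Sum>\<^sub>\<infinity>i\<in>I. cinner f (v i) *\<^sub>C v i)" for f
  have "((\<lambda>i. cinner f (v i) * cinner (v i) h) has_sum cinner (S f) h) I" for f h
  proof -
    have "(\<lambda>i. (cmod (cinner f (v i)))\<^sup>2) summable_on I"
      using assms(1) unfolding bessel_seq_def
      by (intro nonneg_bdd_above_summable_on bdd_aboveI2[where M = "B * (norm f)\<^sup>2"]) auto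
    then have "((\<lambda>i. cinner f (v i) *\<^sub>C v i) has_sum S f) I"
      using bessel_seq_summable[OF assms] by (simp add: S_def)
    from has_sum_bounded_linear[OF bounded_linear_cinner_left this, of h]
    show ?thesis
      by (simp add: o_def cinner_scaleC_left)
  qed
  then show ?thesis
    unfolding frame_op_of_def by blast
qed

context
  fixes S :: "'h::complex_hilbert_space \<Rightarrow> 'h" and A B :: real and v :: "'i \<Rightarrow> 'h" and I :: "'i set"
  assumes fr: "frame_bounds A B v I" and S: "frame_op_of S v I"
begin

lemma frame_op_Re: "Re (cinner (S f) f) = (\<Sum>\<^sub>\<infinity>i\<in>I. (cmod (cinner f (v i)))\<^sup>2)"
proof -
  have "((\<lambda>i. Re (cinner f (v i) * cinner (v i) f)) has_sum Re (cinner (S f) f)) I"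
    using S by (intro has_sum_Re) (simp add: frame_op_of_def)
  moreover have "cinner f (v i) * cinner (v i) f = of_real ((cmod (cinner f (v i)))\<^sup>2)" for i
    by (metis cinner_commute complex_norm_square)
  ultimately show ?thesis
    using infsumI by fastforce
qed

lemma frame_op_pos: "pos_op S"
proof -
  have "cinner (S x) y = cinner x (S y)" for x y
  proof -
    have "((\<lambda>i. cnj (cinner y (v i) * cinner (v i) x)) has_sum cnj (cinner (S y) x)) I"
      using S unfolding frame_op_of_def has_sum_cnj_iff by blast
    moreover have "cnj (cinner y (v i) * cinner (v i) x) = cinner x (v i) * cinner (v i) y" for i
      by (metis cinner_commute complex_cnj_mult mult.commute)
    ultimately have "((\<lambda>i. cinner x (v i) * cinner (v i) y) has_sum cinner x (S y)) I"
      by (metis (no_types, lifting) cinner_commute has_sum_cong)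
    then show ?thesis
      using S unfolding frame_op_of_def using has_sum_unique by blast
  qed
  moreover have "0 \<le> Re (cinner (S x) x)" for x
    unfolding frame_op_Re by (rule infsum_nonneg) simp
  ultimately show ?thesis
    by (simp add: pos_op_def)
qed

lemma frame_op_lower: "A * (norm f)\<^sup>2 \<le> Re (cinner (S f) f)"
  and frame_op_upper: "Re (cinner (S f) f) \<le> B * (norm f)\<^sup>2"
  using fr by (auto simp: frame_op_Re frame_bounds_def)

text \<open>For finite F in \<Gamma> let u be the part of S f carried by F; the frame sum s over F
  equals <u, f>. Replacing f by T S f costs a term proportional to \<delta>, and |<T u, S f>|^2
  \<le> <T u, u> <T S f, S f>. The Gram bound controls the first factor, and the second is q = <S f,
  f> up to \<delta>. Hence s \<le> r^2 q.\<close>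

lemma frame_remove:
  assumes T: "pos_op T" "\<And>f. norm (f - T (S f)) \<le> \<delta> * norm f" "0 \<le> \<delta>"
    and "\<Gamma> \<subseteq> I"
    and gram: "\<And>F c. finite F \<Longrightarrow> F \<subseteq> \<Gamma> \<Longrightarrow>
      Re (cinner (T (\<Sum>i\<in>F. c i *\<^sub>C v i)) (\<Sum>i\<in>F. c i *\<^sub>C v i)) \<le> \<theta> * (\<Sum>i\<in>F. (cmod (c i))\<^sup>2)"
    and r: "sqrt (\<theta> * (1 + \<delta> * (B / A))) + \<delta> * sqrt (B / A) \<le> r" "r < 1" "0 \<le> \<theta>"
  shows "is_frame v (I - \<Gamma>)"
proof -
  have AB: "0 < A" "A \<le> B" using fr by (auto simp: frame_bounds_def)
  have "0 \<le> r"
    using r AB T(3) by (intro order_trans[OF _ r(1)]) auto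
  have bessel: "bessel_seq B v I" by (rule frame_bounds_bessel[OF fr])
  let ?q = "\<lambda>f. \<Sum>\<^sub>\<infinity>i\<in>I. (cmod (cinner f (v i)))\<^sup>2"
  let ?p = "\<lambda>f i. (cmod (cinner f (v i)))\<^sup>2"
  have summ: "?p f summable_on J" if "J \<subseteq> I" for f J
    using fr that unfolding frame_bounds_def by (meson summable_on_subset_banach)
  have key: "sum (?p f) F \<le> r\<^sup>2 * ?q f" if F: "finite F" "F \<subseteq> \<Gamma>" for f F
  proof -
    define s where "s = sum (?p f) F"
    define q where "q = ?q f"
    define u where "u = (\<Sum>i\<in>F. cinner f (v i) *\<^sub>C v i)"
    have "0 \<le> s" by (auto simp: s_def intro: sum_nonneg)
    have q: "q = Re (cinner (S f) f)" "A * (norm f)\<^sup>2 \<le> q"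
      using frame_op_lower[of f] by (simp_all add: q_def frame_op_Re)
    have "0 \<le> q" using q(2) AB by (meson dual_order.trans mult_nonneg_nonneg less_imp_le zero_le_power2)
    have f_le: "(norm f)\<^sup>2 \<le> q / A" using q AB by (simp add: field_simps)
    then have f_le': "norm f \<le> sqrt q / sqrt A"
      by (metis real_le_rsqrt real_sqrt_divide)
    have "(norm u)\<^sup>2 \<le> B * s"
      unfolding u_def s_def using bessel AB F \<open>\<Gamma> \<subseteq> I\<close>
      by (intro bessel_seq_norm_sum[OF bessel]) auto
    then have u_le: "norm u \<le> sqrt B * sqrt s"
      by (metis real_le_rsqrt real_sqrt_mult)
    have "cinner u f = (\<Sum>i\<in>F. of_real (?p f i))"
      unfolding u_def cinner_sum_left cinner_scaleC_left
      by (intro sum.cong refl) (metis cinner_commute complex_norm_square)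
    then have "s = Re (cinner u f)"
      by (simp add: s_def)
    also have "\<dots> = Re (cinner (T u) (S f)) + Re (cinner u (f - T (S f)))"
      by (simp add: cinner_diff_right pos_op_sym[OF T(1)])
    also have "Re (cinner u (f - T (S f))) \<le> norm u * norm (f - T (S f))"
      by (rule Re_cinner_le)
    also have "\<dots> \<le> (sqrt B * sqrt s) * (\<delta> * (sqrt q / sqrt A))"
      using T(2)[of f] f_le' T(3) AB \<open>0 \<le> s\<close> \<open>0 \<le> q\<close>
      by (intro mult_mono u_le order_trans[OF T(2)] mult_left_mono) auto
    also have "\<dots> = \<delta> * sqrt (B / A) * (sqrt s * sqrt q)"
      by (simp add: real_sqrt_divide)
    also have "Re (cinner (T u) (S f)) \<le> sqrt (\<theta> * (1 + \<delta> * (B / A))) * (sqrt s * sqrt q)"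
    proof -
      have "(cmod (cinner (T u) (S f)))\<^sup>2 \<le> Re (cinner (T u) u) * Re (cinner (T (S f)) (S f))"
        by (rule pos_op_cauchy_schwarz[OF T(1)])
      also have "\<dots> \<le> (\<theta> * s) * (q + \<delta> * (B / A) * q)"
      proof (intro mult_mono)
        show "Re (cinner (T u) u) \<le> \<theta> * s"
          unfolding u_def s_def by (rule gram[OF F])
        have "norm (S f) \<le> B * norm f"
          using AB by (intro pos_op_norm_le frame_op_pos frame_op_upper) auto
        then have "norm (f - T (S f)) * norm (S f) \<le> (\<delta> * norm f) * (B * norm f)"
          using T by (intro mult_mono) auto
        also have "\<dots> = \<delta> * B * (norm f)\<^sup>2" by (simp add: power2_eq_square)
        also have "\<dots> \<le> \<delta> * B * (q / A)"
          using T(3) AB by (intro mult_left_mono f_le) auto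
        finally have "norm (f - T (S f)) * norm (S f) \<le> \<delta> * (B / A) * q" by simp
        \<comment> \<open><f, S f> is real and equal to q, so only the defect of \<open>T\<close> as
          an inverse of \<open>S\<close> remains to be estimated.\<close>
        moreover have "Re (cinner (T (S f)) (S f)) = q - Re (cinner (f - T (S f)) (S f))"
          using cinner_commute[of f "S f"] by (simp add: q cinner_diff_left)
        moreover have "- Re (cinner (f - T (S f)) (S f)) \<le> norm (f - T (S f)) * norm (S f)"
          using Re_cinner_le[of "- (f - T (S f))" "S f"] by (simp only: cinner_minus_left norm_minus_cancel) simp
        ultimately show "Re (cinner (T (S f)) (S f)) \<le> q + \<delta> * (B / A) * q"
          by linarith
      qed (use r(3) \<open>0 \<le> s\<close> pos_op_nonneg[OF T(1)] in auto)
      also have "\<dots> = (\<theta> * (1 + \<delta> * (B / A))) * (s * q)" by (simp add: algebra_simps)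
      finally have "cmod (cinner (T u) (S f)) \<le> sqrt ((\<theta> * (1 + \<delta> * (B / A))) * (s * q))"
        by (rule real_le_rsqrt)
      then show ?thesis
        using complex_Re_le_cmod[of "cinner (T u) (S f)"] by (simp add: real_sqrt_mult)
    qed
    finally have "s \<le> (sqrt (\<theta> * (1 + \<delta> * (B / A))) + \<delta> * sqrt (B / A)) * (sqrt s * sqrt q)"
      by (simp add: algebra_simps)
    also have "\<dots> \<le> r * (sqrt s * sqrt q)"
      using r(1) \<open>0 \<le> s\<close> \<open>0 \<le> q\<close> by (intro mult_right_mono) auto
    finally have *: "sqrt s * sqrt s \<le> (r * sqrt q) * sqrt s"
      using \<open>0 \<le> s\<close> by (simp add: mult_ac)
    \<comment> \<open>Cancelling one factor \<open>sqrt s\<close> leaves a bound proportional to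
      \<open>sqrt q\<close>.\<close>
    have "sqrt s \<le> r * sqrt q"
    proof (cases "s = 0")
      case False
      then show ?thesis using mult_right_le_imp_le[OF *] \<open>0 \<le> s\<close> by simp
    qed (use \<open>0 \<le> r\<close> \<open>0 \<le> q\<close> in auto)
    then have "(sqrt s)\<^sup>2 \<le> (r * sqrt q)\<^sup>2"
      using \<open>0 \<le> s\<close> by (intro power_mono) auto
    then show ?thesis
      using \<open>0 \<le> s\<close> \<open>0 \<le> q\<close> by (simp add: power_mult_distrib s_def q_def)
  qed
  \<comment> \<open>As \<Gamma> carries at most the fraction r^2 of every frame sum, its complement
    keeps at least the fraction 1 - r^2.\<close>
  have "frame_bounds ((1 - r\<^sup>2) * A) B v (I - \<Gamma>)"
    unfolding frame_bounds_def
  proof (intro conjI allI)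
    have r2: "r\<^sup>2 < 1" using r(2) \<open>0 \<le> r\<close> by (simp add: power_less_one_iff abs_square_less_1)
    show "0 < (1 - r\<^sup>2) * A" using r2 AB by simp
    show "(1 - r\<^sup>2) * A \<le> B"
    proof -
      have "(1 - r\<^sup>2) * A \<le> 1 * A" using AB by (intro mult_right_mono) auto
      then show ?thesis using AB by linarith
    qed
    fix f
    show "?p f summable_on I - \<Gamma>" by (rule summ) auto
    have split: "?q f = infsum (?p f) \<Gamma> + infsum (?p f) (I - \<Gamma>)"
      using infsum_Un_disjoint[OF summ[of \<Gamma> f] summ[of "I - \<Gamma>" f]] \<open>\<Gamma> \<subseteq> I\<close>
      by (simp add: Un_absorb1)
    have "infsum (?p f) \<Gamma> \<le> r\<^sup>2 * ?q f"
      by (intro infsum_le_finite_sums summ key \<open>\<Gamma> \<subseteq> I\<close>)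
    then have "(1 - r\<^sup>2) * ?q f \<le> infsum (?p f) (I - \<Gamma>)"
      using split by (simp add: algebra_simps)
    moreover have "(1 - r\<^sup>2) * (A * (norm f)\<^sup>2) \<le> (1 - r\<^sup>2) * ?q f"
      using fr r2 by (intro mult_left_mono) (auto simp: frame_bounds_def)
    ultimately show "(1 - r\<^sup>2) * A * (norm f)\<^sup>2 \<le> infsum (?p f) (I - \<Gamma>)" by simp
    have "0 \<le> infsum (?p f) \<Gamma>" by (rule infsum_nonneg) simp
    then have "infsum (?p f) (I - \<Gamma>) \<le> ?q f"
      using split by linarith
    also have "?q f \<le> B * (norm f)\<^sup>2"
      using fr unfolding frame_bounds_def by blast
    finally show "infsum (?p f) (I - \<Gamma>) \<le> B * (norm f)\<^sup>2" .
  qed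
  then show ?thesis
    unfolding is_frame_iff_bounds by blast
qed

end

text \<open>Schur test for a Hermitian matrix: products |c_i| |c_j| are split by the
  arithmetic-geometric mean, and |G i j| = |G j i| lets the row bound \<open>b\<close> serve for the
  columns too.\<close>

lemma gram_le_of_row_sums:
  fixes v :: "'i \<Rightarrow> 'h::complex_hilbert_space"
  assumes T: "pos_op T" and F: "finite F"
    and diag: "\<And>i. i \<in> F \<Longrightarrow> Re (cinner (T (v i)) (v i)) \<le> a"
    and off: "\<And>i. i \<in> F \<Longrightarrow> (\<Sum>j\<in>F - {i}. cmod (cinner (T (v i)) (v j))) \<le> b"
  shows "Re (cinner (T (\<Sum>i\<in>F. c i *\<^sub>C v i)) (\<Sum>i\<in>F. c i *\<^sub>C v i))
      \<le> (a + b) * (\<Sum>i\<in>F. (cmod (c i))\<^sup>2)"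
proof -
  define G where "G i j = cinner (T (v i)) (v j)" for i j
  define k where "k i = cmod (c i)" for i
  have sym: "cmod (G i j) = cmod (G j i)" for i j
    unfolding G_def by (metis T cmod_cinner_commute pos_op_sym)
  have T_sum: "T (\<Sum>i\<in>J. c i *\<^sub>C v i) = (\<Sum>i\<in>J. c i *\<^sub>C T (v i))" for J
  proof (induction J rule: infinite_finite_induct)
    case (insert x J)
    then show ?case by (simp add: pos_op_add[OF T] pos_op_scaleC[OF T])
  qed (use pos_op_scaleR[OF T, of 0] in auto)
  have "cinner (T (\<Sum>i\<in>F. c i *\<^sub>C v i)) (\<Sum>i\<in>F. c i *\<^sub>C v i)
      = (\<Sum>i\<in>F. \<Sum>j\<in>F. c i * cnj (c j) * G i j)"
    by (simp add: T_sum cinner_sum_left cinner_sum_right cinner_scaleC_left cinner_scaleC_right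
        G_def sum_distrib_left mult_ac) (rule sum.swap)
  also have "\<dots> = (\<Sum>i\<in>F. c i * cnj (c i) * G i i + (\<Sum>j\<in>F - {i}. c i * cnj (c j) * G i j))"
    by (intro sum.cong refl) (simp add: sum.remove[OF F])
  finally have "Re (cinner (T (\<Sum>i\<in>F. c i *\<^sub>C v i)) (\<Sum>i\<in>F. c i *\<^sub>C v i))
      = (\<Sum>i\<in>F. Re (c i * cnj (c i) * G i i) + (\<Sum>j\<in>F - {i}. Re (c i * cnj (c j) * G i j)))"
    by simp
  also have "\<dots> \<le> (\<Sum>i\<in>F. (k i)\<^sup>2 * a + (\<Sum>j\<in>F - {i}. ((k i)\<^sup>2 + (k j)\<^sup>2) / 2 * cmod (G i j)))"
  proof (intro sum_mono add_mono)
    fix i assume i: "i \<in> F"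
    have "Re (c i * cnj (c i) * G i i) = (k i)\<^sup>2 * Re (G i i)"
      unfolding k_def complex_norm_square[symmetric] by (simp only: times_complex.sel Re_complex_of_real Im_complex_of_real mult_zero_left diff_zero)
    then show "Re (c i * cnj (c i) * G i i) \<le> (k i)\<^sup>2 * a"
      using diag[OF i] by (simp only: G_def) (simp add: mult_left_mono)
    fix j
    have "Re (c i * cnj (c j) * G i j) \<le> k i * k j * cmod (G i j)"
      using complex_Re_le_cmod[of "c i * cnj (c j) * G i j"] by (simp add: norm_mult k_def)
    also have "\<dots> \<le> ((k i)\<^sup>2 + (k j)\<^sup>2) / 2 * cmod (G i j)"
      using sum_squares_bound[of "k i" "k j"] by (intro mult_right_mono) auto
    finally show "Re (c i * cnj (c j) * G i j) \<le> ((k i)\<^sup>2 + (k j)\<^sup>2) / 2 * cmod (G i j)" .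
  qed
  also have "\<dots> = a * (\<Sum>i\<in>F. (k i)\<^sup>2)
      + (\<Sum>i\<in>F. (k i)\<^sup>2 / 2 * (\<Sum>j\<in>F - {i}. cmod (G i j)))
      + (\<Sum>i\<in>F. \<Sum>j\<in>F - {i}. (k j)\<^sup>2 / 2 * cmod (G i j))"
    by (simp add: sum.distrib sum_distrib_left algebra_simps add_divide_distrib)
  also have "(\<Sum>i\<in>F. \<Sum>j\<in>F - {i}. (k j)\<^sup>2 / 2 * cmod (G i j))
      = (\<Sum>j\<in>F. \<Sum>i\<in>F - {j}. (k j)\<^sup>2 / 2 * cmod (G i j))"
  proof -
    have "(\<Sum>i\<in>F. \<Sum>j\<in>{j\<in>F. j \<noteq> i}. (k j)\<^sup>2 / 2 * cmod (G i j))
        = (\<Sum>j\<in>F. \<Sum>i\<in>{i\<in>F. j \<noteq> i}. (k j)\<^sup>2 / 2 * cmod (G i j))"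
      by (rule sum.swap_restrict[OF F F])
    moreover have "F - {i} = {j\<in>F. j \<noteq> i}" "F - {i} = {j\<in>F. i \<noteq> j}" for i by auto
    ultimately show ?thesis by simp
  qed
  also have "\<dots> = (\<Sum>j\<in>F. (k j)\<^sup>2 / 2 * (\<Sum>i\<in>F - {j}. cmod (G j i)))"
    by (simp add: sum_distrib_left sym)
  also have "a * (\<Sum>i\<in>F. (k i)\<^sup>2) + (\<Sum>i\<in>F. (k i)\<^sup>2 / 2 * (\<Sum>j\<in>F - {i}. cmod (G i j)))
      + (\<Sum>j\<in>F. (k j)\<^sup>2 / 2 * (\<Sum>i\<in>F - {j}. cmod (G j i)))
    \<le> a * (\<Sum>i\<in>F. (k i)\<^sup>2) + (\<Sum>i\<in>F. (k i)\<^sup>2 / 2 * b) + (\<Sum>i\<in>F. (k i)\<^sup>2 / 2 * b)"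
    using off by (intro add_mono order_refl sum_mono mult_left_mono) (auto simp: G_def)
  also have "\<dots> = (a + b) * (\<Sum>i\<in>F. (k i)\<^sup>2)"
    by (simp add: sum_distrib_left sum.distrib algebra_simps flip: sum_divide_distrib)
  finally show ?thesis
    by (simp add: k_def)
qed

subsection \<open>Unimodular groups and lower density\<close>

lemma borel_measurable_group_minus [measurable]:
  fixes f :: "'x \<Rightarrow> 'g::{topological_group_add, second_countable_topology}"
  assumes "f \<in> borel_measurable M"
  shows "(\<lambda>x. - f x) \<in> borel_measurable M"
  using measurable_compose[OF assms borel_measurable_continuous_onI[of uminus]]
  by (simp add: continuous_on_minus)

lemma elt_set_plus_image: "x +o A = (\<lambda>y. x + y) ` A"
  by (auto simp: elt_set_plus_def)

lemma mem_elt_set_plus_iff: "y \<in> x +o A \<longleftrightarrow> - x + y \<in> A" for x :: "'g::group_add"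
  by (force simp: elt_set_plus_def add.assoc[symmetric] intro!: bexI[of _ "- x + y"])

lemma compact_set_plus:
  fixes A B :: "'g::topological_monoid_add set"
  assumes "compact A" "compact B"
  shows "compact (A + B)"
proof -
  have "compact ((\<lambda>p. fst p + snd p) ` (A \<times> B))"
    by (intro compact_continuous_image compact_Times assms continuous_intros)
  moreover have "(\<lambda>p. fst p + snd p) ` (A \<times> B) = A + B"
    by (force simp: set_plus_def)
  ultimately show ?thesis by simp
qed

lemma compact_uminus_image: "compact A \<Longrightarrow> compact (uminus ` A)" for A :: "'g::topological_group_add set"
  by (intro compact_continuous_image continuous_intros)

lemma open_translate: "open A \<Longrightarrow> open (x +o A)" for A :: "'g::topological_group_add set"
proof -
  assume "open A"
  then have "open ((\<lambda>y. - x + y) -` A)"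
    by (intro open_vimage continuous_intros)
  moreover have "(\<lambda>y. - x + y) -` A = x +o A"
    by (auto simp: mem_elt_set_plus_iff)
  ultimately show ?thesis by simp
qed

text \<open>A union of right translates of \<open>A\<close>, one for each point of \<open>B\<close>.
  It makes the boundary sets of the Folner condition Borel.\<close>

lemma open_set_plus_right: "open A \<Longrightarrow> open (A + B)" for A B :: "'g::topological_group_add set"
proof -
  assume A: "open A"
  have "A + B = (\<Union>b\<in>B. (\<lambda>y. y + - b) -` A)"
    by (force simp: set_plus_def intro: bexI[of _ "_ + - _"])
  also have "open \<dots>"
    using A by (intro open_UN ballI open_vimage continuous_intros)
  finally show ?thesis .
qed

section \<open>Haar integration on unimodular groups\<close>

locale unimodular_lc_group =
  fixes mu :: "'g::{topological_group_add, second_countable_topology, t2_space} measure"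
  assumes lc: "locally compact (UNIV :: 'g set)"
    and haar: "haar_measure mu"
    and uni: "unimodular mu"
begin

lemma sets_mu [simp, measurable_cong]: "sets mu = sets borel"
  using haar by (simp add: haar_measure_def)

lemma space_mu [simp]: "space mu = UNIV"
  using sets_eq_imp_space_eq[OF sets_mu] by simp

lemma emeasure_compact: "compact C \<Longrightarrow> emeasure mu C < \<infinity>"
  using haar by (simp add: haar_measure_def)

lemma emeasure_compact_eq: "compact C \<Longrightarrow> emeasure mu C = ennreal (measure mu C)"
  using emeasure_compact[of C] by (intro emeasure_eq_ennreal_measure) simp

lemma emeasure_le_compact:
  assumes "A \<subseteq> C" "compact C"
  shows "emeasure mu A < \<infinity>"
proof -
  have "emeasure mu A \<le> emeasure mu C"
    using assms by (intro emeasure_mono) (auto intro: borel_compact)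
  then show ?thesis using emeasure_compact[OF assms(2)] by auto
qed

text \<open>Invariance as an identity of push-forward measures, the form in which integrals and
  almost-everywhere statements are transported.\<close>

lemma distr_left: "distr mu borel (\<lambda>y. x + y) = mu"
proof (rule measure_eqI)
  fix A assume "A \<in> sets (distr mu borel (\<lambda>y. x + y))"
  then have A: "A \<in> sets borel" by simp
  have "(\<lambda>y. x + y) -` A = (\<lambda>y. - x + y) ` A"
    by (force simp: image_iff add.assoc[symmetric] intro: bexI[of _ "x + _"])
  then show "emeasure (distr mu borel (\<lambda>y. x + y)) A = emeasure mu A"
    using haar A by (simp add: emeasure_distr haar_measure_def)
qed simp

lemma distr_right: "distr mu borel (\<lambda>y. y + x) = mu"
proof (rule measure_eqI)
  fix A assume "A \<in> sets (distr mu borel (\<lambda>y. y + x))"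
  then have A: "A \<in> sets borel" by simp
  have "(\<lambda>y. y + x) -` A = (\<lambda>y. y + - x) ` A"
    by (force simp: image_iff add.assoc intro: bexI[of _ "_ + x"])
  then show "emeasure (distr mu borel (\<lambda>y. y + x)) A = emeasure mu A"
    using uni[unfolded unimodular_def, rule_format, OF A, of "- x"] A
    by (simp add: emeasure_distr del: add_uminus_conv_diff)
qed simp

lemma nn_integral_left:
  assumes [measurable]: "f \<in> borel_measurable borel"
  shows "(\<integral>\<^sup>+y. f (x + y) \<partial>mu) = (\<integral>\<^sup>+y. f y \<partial>mu)"
  by (subst (2) distr_left[of x, symmetric]) (simp add: nn_integral_distr)

lemma nn_integral_right:
  assumes [measurable]: "f \<in> borel_measurable borel"
  shows "(\<integral>\<^sup>+y. f (y + x) \<partial>mu) = (\<integral>\<^sup>+y. f y \<partial>mu)"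
  by (subst (2) distr_right[of x, symmetric]) (simp add: nn_integral_distr)

lemma emeasure_translate: "A \<in> sets borel \<Longrightarrow> emeasure mu (x +o A) = emeasure mu A"
  using haar by (simp add: haar_measure_def elt_set_plus_image)

lemma sets_translate: "A \<in> sets borel \<Longrightarrow> x +o A \<in> sets (borel :: 'g measure)"
proof -
  assume [measurable]: "A \<in> sets borel"
  have "(\<lambda>y. - x + y) -` A \<inter> space borel \<in> sets (borel :: 'g measure)"
    by measurable
  moreover have "(\<lambda>y. - x + y) -` A = x +o A"
    by (auto simp: mem_elt_set_plus_iff)
  ultimately show ?thesis by simp
qed

lemma measure_translate: "A \<in> sets borel \<Longrightarrow> measure mu (x +o A) = measure mu A"
  by (simp add: measure_def emeasure_translate)

text \<open>Every point has an open neighbourhood inside a compact set; by Lindelof countably many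
  of these cover, and finite unions make the sequence increasing.\<close>

lemma sigma_compact:
  "\<exists>C :: nat \<Rightarrow> 'g set. (\<forall>n. compact (C n)) \<and> incseq C \<and> (\<Union>n. C n) = UNIV"
proof -
  have "\<exists>U V. open U \<and> compact V \<and> x \<in> U \<and> U \<subseteq> V" for x :: 'g
    using lc[unfolded locally_def, rule_format, of UNIV x] by auto
  then obtain U V where UV: "\<And>x::'g. open (U x) \<and> compact (V x) \<and> x \<in> U x \<and> U x \<subseteq> V x"
    by metis
  obtain \<F> where F: "\<F> \<subseteq> range U" "countable \<F>" "\<Union>\<F> = \<Union>(range U)"
    using Lindelof[of "range U"] UV by blast
  have "\<Union>(range U) = UNIV" using UV by blast
  obtain X where X: "countable X" "\<F> = U ` X"
    using F(1,2) by (metis countable_subset_image)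
  then have "X \<noteq> {}" using F \<open>\<Union>(range U) = UNIV\<close> by auto
  define C where "C n = (\<Union>i\<le>n. V (from_nat_into X i))" for n
  have "compact (C n)" for n
    unfolding C_def using UV by (intro compact_UN) auto
  moreover have "incseq C"
    unfolding C_def incseq_def by (intro allI impI UN_mono) auto
  moreover have "y \<in> (\<Union>n. C n)" for y
  proof -
    have "y \<in> \<Union>\<F>" using F \<open>\<Union>(range U) = UNIV\<close> by simp
    then obtain x where "x \<in> X" "y \<in> U x" using X by auto
    then obtain i where "x = from_nat_into X i"
      using from_nat_into_surj X(1) by metis
    then show ?thesis
      using \<open>y \<in> U x\<close> UV unfolding C_def by blast
  qed
  ultimately show ?thesis by blast
qed

sublocale sigma_finite_measure mu
proof
  obtain C :: "nat \<Rightarrow> 'g set" where C: "\<And>n. compact (C n)" "incseq C" "(\<Union>n. C n) = UNIV"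
    using sigma_compact by blast
  show "\<exists>A. countable A \<and> A \<subseteq> sets mu \<and> \<Union>A = space mu \<and> (\<forall>a\<in>A. emeasure mu a \<noteq> \<infinity>)"
    using C emeasure_compact by (intro exI[of _ "range C"]) (auto intro: borel_compact simp: less_top)
qed

text \<open>If \<open>U\<close> were null, countably many of its translates would cover the group
  and the whole measure would vanish.\<close>

lemma emeasure_open_pos:
  assumes "open U" "0 \<in> U"
  shows "0 < emeasure mu U"
proof (rule ccontr)
  assume "\<not> 0 < emeasure mu U"
  then have 0: "emeasure mu U = 0" by simp
  let ?T = "range (\<lambda>x. x +o U)"
  obtain \<F> where F: "\<F> \<subseteq> ?T" "countable \<F>" "\<Union>\<F> = \<Union>?T"
    using Lindelof[of ?T] assms open_translate by blast
  have "x \<in> x +o U" for x :: 'g using assms by (simp add: mem_elt_set_plus_iff)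
  then have "\<Union>?T = UNIV" by blast
  moreover have "\<Union>\<F> \<in> null_sets mu"
  proof -
    have "S \<in> null_sets mu" if "S \<in> \<F>" for S
      using that F(1) assms 0 by (auto simp: null_sets_def emeasure_translate intro!: sets_translate borel_open open_translate)
    then show ?thesis
      using F(2) null_sets_UN'[of \<F> "\<lambda>S. S" mu] by simp
  qed
  ultimately have "emeasure mu UNIV = 0"
    using F(3) by auto
  then show False using haar by (simp add: haar_measure_def)
qed

text \<open>Evaluating the double integral of \<open>1\<^sub>C(x) f(- y + x)\<close> in both orders.\<close>
lemma nn_integral_uminus:
  fixes f :: "'g \<Rightarrow> ennreal"
  assumes [measurable]: "f \<in> borel_measurable borel"
  shows "(\<integral>\<^sup>+y. f (- y) \<partial>mu) = (\<integral>\<^sup>+y. f y \<partial>mu)"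
proof -
  interpret pair_sigma_finite mu mu ..
  obtain C :: "nat \<Rightarrow> 'g set" where C: "\<And>n. compact (C n)" "incseq C" "(\<Union>n. C n) = UNIV"
    using sigma_compact by blast
  \<comment> \<open>A compact set of positive measure is selected because its measure, finite by
    compactness, is cancelled at the end.\<close>
  have "\<exists>n. emeasure mu (C n) \<noteq> 0"
  proof (rule ccontr)
    assume "\<nexists>n. emeasure mu (C n) \<noteq> 0"
    then have "(\<Union>n. C n) \<in> null_sets mu"
      using C(1) by (intro null_sets_UN) (auto simp: null_sets_def intro: borel_compact)
    then show False using haar C by (auto simp: haar_measure_def)
  qed
  then obtain n where n: "emeasure mu (C n) \<noteq> 0" by blast
  define D where "D = C n"
  have [measurable]: "D \<in> sets borel" using C by (simp add: D_def borel_compact)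
  have "(\<integral>\<^sup>+y. (\<integral>\<^sup>+x. indicator D x * f (- y + x) \<partial>mu) \<partial>mu)
      = (\<integral>\<^sup>+y. (\<integral>\<^sup>+x. indicator D (y + x) * f x \<partial>mu) \<partial>mu)"
  proof (rule nn_integral_cong)
    fix y
    show "(\<integral>\<^sup>+x. indicator D x * f (- y + x) \<partial>mu) = (\<integral>\<^sup>+x. indicator D (y + x) * f x \<partial>mu)"
      by (subst nn_integral_left[of _ y, symmetric]) (auto simp: add.assoc[symmetric])
  qed
  also have "\<dots> = (\<integral>\<^sup>+x. (\<integral>\<^sup>+y. indicator D (y + x) * f x \<partial>mu) \<partial>mu)"
    by (rule Fubini') measurable
  \<comment> \<open>Right invariance enters here: integrating \<open>indicator D (y + x)\<close>
    over \<open>y\<close> gives the measure of \<open>D\<close>.\<close>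
  also have "\<dots> = (\<integral>\<^sup>+x. emeasure mu D * f x \<partial>mu)"
    by (intro nn_integral_cong) (simp add: nn_integral_multc nn_integral_right[of "indicator D"])
  also have "\<dots> = emeasure mu D * (\<integral>\<^sup>+x. f x \<partial>mu)"
    by (rule nn_integral_cmult) simp
  finally have 1: "(\<integral>\<^sup>+y. (\<integral>\<^sup>+x. indicator D x * f (- y + x) \<partial>mu) \<partial>mu)
      = emeasure mu D * (\<integral>\<^sup>+x. f x \<partial>mu)" .
  have "(\<integral>\<^sup>+y. (\<integral>\<^sup>+x. indicator D x * f (- y + x) \<partial>mu) \<partial>mu)
      = (\<integral>\<^sup>+x. (\<integral>\<^sup>+y. indicator D x * f (- y + x) \<partial>mu) \<partial>mu)"
    by (rule Fubini') measurable
  also have "\<dots> = (\<integral>\<^sup>+x. indicator D x * (\<integral>\<^sup>+y. f (- y) \<partial>mu) \<partial>mu)"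
  proof (rule nn_integral_cong)
    fix x
    have "(\<integral>\<^sup>+y. indicator D x * f (- y + x) \<partial>mu) = indicator D x * (\<integral>\<^sup>+y. f (- y + x) \<partial>mu)"
      by (rule nn_integral_cmult) measurable
    also have "(\<integral>\<^sup>+y. f (- y + x) \<partial>mu) = (\<integral>\<^sup>+y. f (- (x + y) + x) \<partial>mu)"
      by (rule nn_integral_left[symmetric]) measurable
    also have "\<dots> = (\<integral>\<^sup>+y. f (- y) \<partial>mu)"
      by (simp add: minus_add add.assoc)
    finally show "(\<integral>\<^sup>+y. indicator D x * f (- y + x) \<partial>mu)
      = indicator D x * (\<integral>\<^sup>+y. f (- y) \<partial>mu)" .
  qed
  also have "\<dots> = emeasure mu D * (\<integral>\<^sup>+y. f (- y) \<partial>mu)"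
    by (simp add: nn_integral_multc)
  finally have "emeasure mu D * (\<integral>\<^sup>+y. f (- y) \<partial>mu) = emeasure mu D * (\<integral>\<^sup>+x. f x \<partial>mu)"
    using 1 by simp
  then show ?thesis
    using n emeasure_compact[OF C(1)[of n]] by (auto simp: ennreal_mult_cancel_left D_def)
qed

lemma nn_integral_reflect:
  fixes f :: "'g \<Rightarrow> ennreal"
  assumes [measurable]: "f \<in> borel_measurable borel"
  shows "(\<integral>\<^sup>+y. f (- y + x) \<partial>mu) = (\<integral>\<^sup>+y. f y \<partial>mu)"
proof -
  have "(\<integral>\<^sup>+y. f (- y + x) \<partial>mu) = (\<integral>\<^sup>+y. f (- (x + y) + x) \<partial>mu)"
    by (rule nn_integral_left[symmetric]) measurable
  also have "\<dots> = (\<integral>\<^sup>+y. f (- y) \<partial>mu)"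
    by (simp add: minus_add add.assoc)
  finally show ?thesis by (simp add: nn_integral_uminus)
qed

text \<open>Continuity from above for the finite measure with density \<open>f\<close>, along the
  complements of a compact exhaustion.\<close>

lemma compact_tail:
  fixes f :: "'g \<Rightarrow> ennreal"
  assumes [measurable]: "f \<in> borel_measurable borel" and fin: "(\<integral>\<^sup>+y. f y \<partial>mu) < \<infinity>" and "0 < \<delta>"
  obtains C :: "'g set" where "compact C" "(\<integral>\<^sup>+y. f y * indicator (- C) y \<partial>mu) < \<delta>"
proof -
  obtain C :: "nat \<Rightarrow> 'g set" where C: "\<And>n. compact (C n)" "incseq C" "(\<Union>n. C n) = UNIV"
    using sigma_compact by blast
  have [measurable]: "C n \<in> sets borel" for n using C by (simp add: borel_compact)
  let ?D = "density mu f"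
  have "(\<lambda>n. emeasure ?D (- C n)) \<longlonglongrightarrow> emeasure ?D (\<Inter>n. - C n)"
  proof (rule Lim_emeasure_decseq)
    show "range (\<lambda>n. - C n) \<subseteq> sets ?D" by auto
    show "decseq (\<lambda>n. - C n)" using C(2) by (auto simp: decseq_def incseq_def)
    fix n
    have "emeasure ?D (- C n) \<le> (\<integral>\<^sup>+y. f y \<partial>mu)"
      by (simp add: emeasure_density) (intro nn_integral_mono, auto split: split_indicator)
    then show "emeasure ?D (- C n) \<noteq> \<infinity>" using fin by auto
  qed
  moreover have "(\<Inter>n. - C n) = {}" using C(3) by auto
  ultimately have "(\<lambda>n. emeasure ?D (- C n)) \<longlonglongrightarrow> 0" by simp
  from order_tendstoD(2)[OF this \<open>0 < \<delta>\<close>] obtain n where "emeasure ?D (- C n) < \<delta>"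
    unfolding eventually_sequentially by blast
  then show ?thesis
    using that[of "C n"] C(1) by (simp add: emeasure_density)
qed

text \<open>A uniform count that passes to subsets; \<open>Y\<close> ranges over measurable supersets because
  \<open>E + C\<close> itself need not be measurable.\<close>
definition thin :: "'g set \<Rightarrow> real \<Rightarrow> 'g set \<Rightarrow> bool" where
  "thin C N \<Lambda> \<longleftrightarrow> compact C \<and> 0 \<in> C \<and> 0 \<le> N \<and> (\<forall>E Y. Y \<in> sets borel \<longrightarrow> E + C \<subseteq> Y \<longrightarrow>
     emeasure mu Y < \<infinity> \<longrightarrow> finite (\<Lambda> \<inter> E) \<and> card (\<Lambda> \<inter> E) \<le> N * measure mu Y)"

lemma thinD:
  assumes "thin C N \<Lambda>" "Y \<in> sets borel" "E + C \<subseteq> Y" "emeasure mu Y < \<infinity>"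
  shows "finite (\<Lambda> \<inter> E)" "card (\<Lambda> \<inter> E) \<le> N * measure mu Y"
  using assms unfolding thin_def by blast+

lemma thin_subset:
  assumes "thin C N \<Lambda>" "\<Gamma> \<subseteq> \<Lambda>"
  shows "thin C N \<Gamma>"
  unfolding thin_def
proof (intro conjI allI impI)
  fix E Y assume Y: "Y \<in> sets borel" "E + C \<subseteq> Y" "emeasure mu Y < \<infinity>"
  note fin = thinD[OF assms(1) Y]
  show "finite (\<Gamma> \<inter> E)" by (rule finite_subset[OF _ fin(1)]) (use assms(2) in auto)
  have "card (\<Gamma> \<inter> E) \<le> card (\<Lambda> \<inter> E)" using fin(1) assms(2) by (intro card_mono) auto
  then show "card (\<Gamma> \<inter> E) \<le> N * measure mu Y" using fin(2) by linarith
qed (use assms(1) in \<open>auto simp: thin_def\<close>)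

text \<open>Left invariance makes the bound independent of the translate: \<Lambda> is relatively
  separated, uniformly over the group.\<close>

lemma thin_compact:
  assumes "thin C N \<Lambda>" "compact U"
  shows "finite (\<Lambda> \<inter> (x +o U))" "card (\<Lambda> \<inter> (x +o U)) \<le> N * measure mu (U + C)"
proof -
  have comp: "compact (U + C)"
    using assms by (intro compact_set_plus) (auto simp: thin_def)
  have "U + C \<in> sets borel" using comp by (rule borel_compact)
  then show "finite (\<Lambda> \<inter> (x +o U))" "card (\<Lambda> \<inter> (x +o U)) \<le> N * measure mu (U + C)"
    using thinD[OF assms(1), of "x +o (U + C)" "x +o U"] emeasure_compact[OF comp]
    by (auto simp: set_plus_rearrange3 measure_translate emeasure_translate sets_translate)
qed

end

section \<open>Lower density along strong Folner sequences\<close>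

locale folner_group = unimodular_lc_group mu
  for mu :: "'g::{topological_group_add, second_countable_topology, t2_space} measure" +
  fixes K :: "nat \<Rightarrow> 'g set"
  assumes folner: "strong_folner_seq mu K"
begin

lemma compact_K: "compact (K n)" and measure_K_pos: "0 < measure mu (K n)"
  using folner by (auto simp: strong_folner_seq_def)

lemma sets_K [measurable]: "K n \<in> sets borel"
  by (rule borel_compact[OF compact_K])

text \<open>The boundary set of the second Folner condition: points reached by \<open>C\<close> both
  from inside and from outside \<open>K n\<close>.\<close>

definition bdry :: "'g set \<Rightarrow> nat \<Rightarrow> 'g set" where
  "bdry C n = (K n + C) \<inter> ((UNIV - K n) + C)"

lemma bdry_tendsto: "compact C \<Longrightarrow> C \<noteq> {} \<Longrightarrow> (\<lambda>n. measure mu (bdry C n) / measure mu (K n)) \<longlonglongrightarrow> 0"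
  using folner by (auto simp: strong_folner_seq_def bdry_def)

lemma sets_bdry: "compact C \<Longrightarrow> bdry C n \<in> sets borel"
proof -
  assume C: "compact C"
  have "open (UNIV - K n)"
    by (intro open_Diff open_UNIV compact_imp_closed compact_K)
  then have "open ((UNIV - K n) + C)" by (rule open_set_plus_right)
  moreover have "compact (K n + C)" using compact_K C by (rule compact_set_plus)
  ultimately show ?thesis
    unfolding bdry_def by (intro sets.Int) (auto intro: borel_compact)
qed

lemma emeasure_bdry: "compact C \<Longrightarrow> emeasure mu (bdry C n) < \<infinity>"
  by (rule emeasure_le_compact[OF _ compact_set_plus[OF compact_K[of n]]]) (auto simp: bdry_def)

text \<open>The points gained by enlarging \<open>K n\<close> lie in K n + C but outside
  \<open>K n\<close>. Adding \<open>C0\<close> to them stays in the boundary set for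
  \<open>C'\<close>, where C + C0 accounts for the side of \<open>K n\<close> and \<open>C0\<close>
  for the side of the complement. The thin count then bounds their number.\<close>

lemma card_bdry_le:
  assumes "thin C0 N \<Lambda>" "compact C"
  defines "C' \<equiv> C + C0 \<union> C0"
  shows "card (\<Lambda> \<inter> (x +o (K n + C))) \<le> card (\<Lambda> \<inter> (x +o K n)) + N * measure mu (bdry C' n)"
    and "compact C'" "C' \<noteq> {}"
proof -
  have C0: "compact C0" "0 \<in> C0" using assms by (auto simp: thin_def)
  show C': "compact C'" unfolding C'_def using C0 assms by (intro compact_Un compact_set_plus)
  show "C' \<noteq> {}" using C0 by (auto simp: C'_def)
  define E where "E = x +o (K n + C - K n)"
  have "E + C0 \<subseteq> x +o bdry C' n"
    unfolding E_def set_plus_rearrange3 bdry_def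
  proof (intro set_plus_mono Int_greatest)
    have "(K n + C - K n) + C0 \<subseteq> (K n + C) + C0"
      by (rule set_plus_mono2) auto
    also have "\<dots> \<subseteq> K n + C'"
      unfolding C'_def add.assoc by (rule set_plus_mono2) auto
    finally show "(K n + C - K n) + C0 \<subseteq> K n + C'" .
    show "(K n + C - K n) + C0 \<subseteq> (UNIV - K n) + C'"
      unfolding C'_def by (rule set_plus_mono2) auto
  qed
  then have "card (\<Lambda> \<inter> E) \<le> N * measure mu (x +o bdry C' n)"
    using C' by (intro thinD[OF assms(1)]) (auto simp: emeasure_translate sets_bdry sets_translate emeasure_bdry[unfolded infinity_ennreal_def])
  moreover have "card (\<Lambda> \<inter> (x +o (K n + C))) \<le> card (\<Lambda> \<inter> (x +o K n) \<union> \<Lambda> \<inter> E)"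
  proof (intro card_mono)
    have "finite (\<Lambda> \<inter> (x +o (K n + C)))"
      by (intro thin_compact[OF assms(1)] compact_set_plus compact_K assms)
    then show "finite (\<Lambda> \<inter> (x +o K n) \<union> \<Lambda> \<inter> E)"
      using thin_compact[OF assms(1) compact_K, of x n]
      by (auto elim!: rev_finite_subset simp: E_def mem_elt_set_plus_iff)
    show "\<Lambda> \<inter> (x +o (K n + C)) \<subseteq> \<Lambda> \<inter> (x +o K n) \<union> \<Lambda> \<inter> E"
      by (auto simp: E_def mem_elt_set_plus_iff)
  qed
  moreover have "\<dots> \<le> card (\<Lambda> \<inter> (x +o K n)) + card (\<Lambda> \<inter> E)"
    by (rule card_Un_le)
  ultimately show "card (\<Lambda> \<inter> (x +o (K n + C))) \<le> card (\<Lambda> \<inter> (x +o K n)) + N * measure mu (bdry C' n)"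
    using C' by (simp add: measure_translate sets_bdry)
qed

definition min_density :: "'g set \<Rightarrow> nat \<Rightarrow> ennreal" where
  "min_density \<Lambda> n = (INF x. emeasure (count_space UNIV) (\<Lambda> \<inter> (x +o K n)) / emeasure mu (K n))"

lemma lower_density_eq: "lower_density mu K \<Lambda> = lim (min_density \<Lambda>)"
  by (simp add: lower_density_def min_density_def[abs_def])

lemma count_div_eq:
  assumes "thin C0 N \<Lambda>"
  shows "emeasure (count_space UNIV) (\<Lambda> \<inter> (x +o K n)) / emeasure mu (K n)
    = ennreal (card (\<Lambda> \<inter> (x +o K n)) / measure mu (K n))"
  using thin_compact(1)[OF assms compact_K, of x n] measure_K_pos[of n]
  by (simp add: emeasure_compact_eq[OF compact_K] divide_ennreal flip: ennreal_of_nat_eq_real_of_nat)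
    (simp add: ennreal_of_nat_eq_real_of_nat divide_ennreal)

text \<open>Averages the count of \<open>\<Lambda> \<inter> (y +o K n)\<close> over \<open>y \<in> x +o K m\<close>. With the boundary estimate this
  gives convergence of the density, without which \<^const>\<open>lim\<close> would be a junk value.\<close>
lemma min_density_le_card:
  assumes "thin C0 N \<Lambda>"
  shows "min_density \<Lambda> n * emeasure mu (K m) \<le> ennreal (card (\<Lambda> \<inter> (x +o (K m + K n))))"
proof -
  define F where "F = \<Lambda> \<inter> (x +o (K m + K n))"
  have F: "finite F"
    unfolding F_def by (intro thin_compact[OF assms] compact_set_plus compact_K)
  have pt: "min_density \<Lambda> n * emeasure mu (K n) * indicator (x +o K m) y
      \<le> (\<Sum>l\<in>F. indicator (K n) (- y + l))" for y
  proof (cases "y \<in> x +o K m")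
    case True
    have "min_density \<Lambda> n \<le> ennreal (card (\<Lambda> \<inter> (y +o K n)) / measure mu (K n))"
      unfolding min_density_def count_div_eq[OF assms, symmetric] by (rule INF_lower) simp
    then have "min_density \<Lambda> n * emeasure mu (K n)
        \<le> ennreal (card (\<Lambda> \<inter> (y +o K n)) / measure mu (K n)) * ennreal (measure mu (K n))"
      unfolding emeasure_compact_eq[OF compact_K] by (rule mult_right_mono) simp
    also have "\<dots> = ennreal (card (\<Lambda> \<inter> (y +o K n)))"
      using measure_K_pos[of n] by (simp flip: ennreal_mult)
    also have "\<Lambda> \<inter> (y +o K n) = {l\<in>F. - y + l \<in> K n}"
    proof -
      have "l \<in> x +o (K m + K n)" if "- y + l \<in> K n" for l
      proof -
        have "- x + l = (- x + y) + (- y + l)" by (simp add: add.assoc)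
        then show ?thesis
          using True that unfolding mem_elt_set_plus_iff by (metis set_plus_intro)
      qed
      then show ?thesis by (auto simp: F_def mem_elt_set_plus_iff)
    qed
    also have "ennreal (card {l\<in>F. - y + l \<in> K n}) = (\<Sum>l\<in>F. indicator (K n) (- y + l))"
      using F by (simp add: indicator_def sum.If_cases Int_def ennreal_of_nat_eq_real_of_nat)
    finally show ?thesis using True by simp
  qed simp
  have "min_density \<Lambda> n * emeasure mu (K n) * emeasure mu (K m)
      = (\<integral>\<^sup>+y. min_density \<Lambda> n * emeasure mu (K n) * indicator (x +o K m) y \<partial>mu)"
    by (subst nn_integral_cmult_indicator) (auto simp: sets_translate emeasure_translate)
  also have "\<dots> \<le> (\<integral>\<^sup>+y. (\<Sum>l\<in>F. indicator (K n) (- y + l)) \<partial>mu)"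
    by (intro nn_integral_mono pt)
  also have "\<dots> = (\<Sum>l\<in>F. (\<integral>\<^sup>+y. indicator (K n) (- y + l) \<partial>mu))"
    by (rule nn_integral_sum) measurable
  \<comment> \<open>Invariance under y -> - y + l: every point of \<open>F\<close> contributes the
    measure of \<open>K n\<close>.\<close>
  also have "\<dots> = card F * emeasure mu (K n)"
    by (simp add: nn_integral_reflect)
  finally have "emeasure mu (K n) * (min_density \<Lambda> n * emeasure mu (K m))
      \<le> emeasure mu (K n) * ennreal (card F)"
    by (simp add: mult_ac ennreal_of_nat_eq_real_of_nat)
  then show ?thesis
    using measure_K_pos[of n] by (simp add: ennreal_mult_le_mult_iff emeasure_compact_eq[OF compact_K] F_def)
qed

text \<open>The averaging bound counts points in K m + K n instead of \<open>K m\<close>. The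
  surplus lies near the boundary of \<open>K m\<close> and is negligible for fixed \<open>n\<close>
  as \<open>m\<close> grows.\<close>

lemma min_density_le:
  assumes "thin C0 N \<Lambda>"
  defines "e \<equiv> \<lambda>n m. N * (measure mu (bdry (K n + C0 \<union> C0) m) / measure mu (K m))"
  shows "min_density \<Lambda> n \<le> min_density \<Lambda> m + ennreal (e n m)"
    and "(\<lambda>m. ennreal (e n m)) \<longlonglongrightarrow> 0"
proof -
  have "0 \<le> N" using assms by (simp add: thin_def)
  then have "0 \<le> e n m" for m by (simp add: e_def)
  note C' = card_bdry_le(2,3)[OF assms(1) compact_K[of n]]
  have "(\<lambda>m. N * (measure mu (bdry (K n + C0 \<union> C0) m) / measure mu (K m))) \<longlonglongrightarrow> N * 0"
    by (intro tendsto_mult tendsto_const bdry_tendsto C')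
  then show "(\<lambda>m. ennreal (e n m)) \<longlonglongrightarrow> 0"
    unfolding e_def by (simp add: tendsto_ennrealI flip: ennreal_0)
  have "min_density \<Lambda> n - ennreal (e n m) \<le> min_density \<Lambda> m"
    unfolding min_density_def[of \<Lambda> m] count_div_eq[OF assms(1)]
  proof (rule INF_greatest)
    fix x
    let ?k = "real (card (\<Lambda> \<inter> (x +o K m)))"
    have "min_density \<Lambda> n * ennreal (measure mu (K m)) \<le> ennreal (card (\<Lambda> \<inter> (x +o (K m + K n))))"
      using min_density_le_card[OF assms(1)] by (simp add: emeasure_compact_eq[OF compact_K])
    also have "\<dots> \<le> ennreal (?k + N * measure mu (bdry (K n + C0 \<union> C0) m))"
      by (intro ennreal_leI card_bdry_le(1)[OF assms(1) compact_K])
    also have "?k + N * measure mu (bdry (K n + C0 \<union> C0) m) = (?k / measure mu (K m) + e n m) * measure mu (K m)"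
      using measure_K_pos[of m] by (simp add: e_def field_simps)
    also have "ennreal \<dots> = ennreal (?k / measure mu (K m) + e n m) * ennreal (measure mu (K m))"
      by (rule ennreal_mult) (use \<open>0 \<le> e n m\<close> in auto)
    finally have "min_density \<Lambda> n \<le> ennreal (?k / measure mu (K m) + e n m)"
      using measure_K_pos[of m] by (simp add: mult.commute[of _ "ennreal (measure mu (K m))"] ennreal_mult_le_mult_iff)
    also have "\<dots> = ennreal (?k / measure mu (K m)) + ennreal (e n m)"
      using \<open>0 \<le> e n m\<close> by simp
    finally show "min_density \<Lambda> n - ennreal (e n m) \<le> ennreal (?k / measure mu (K m))"
      by (simp add: ennreal_minus_le_iff add.commute)
  qed
  then show "min_density \<Lambda> n \<le> min_density \<Lambda> m + ennreal (e n m)"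
    by (simp add: ennreal_minus_le_iff add.commute)
qed

text \<open>Letting \<open>m\<close> grow with \<open>n\<close> fixed puts every
  \<open>min_density \<Lambda> n\<close> below the limit inferior; so the limit exists and is the
  supremum.\<close>

lemma min_density_tendsto:
  assumes "thin C0 N \<Lambda>"
  shows "min_density \<Lambda> \<longlonglongrightarrow> lower_density mu K \<Lambda>"
proof -
  have "min_density \<Lambda> \<longlonglongrightarrow> (SUP n. min_density \<Lambda> n)"
  proof (rule order_tendstoI)
    fix c assume "c < (SUP n. min_density \<Lambda> n)"
    then obtain n where n: "c < min_density \<Lambda> n" by (auto simp: less_SUP_iff)
    define e where "e m = N * (measure mu (bdry (K n + C0 \<union> C0) m) / measure mu (K m))" for m
    have "min_density \<Lambda> n \<le> ennreal (card (\<Lambda> \<inter> (0 +o K n)) / measure mu (K n))"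
      unfolding min_density_def count_div_eq[OF assms] by (rule INF_lower) simp
    then have "min_density \<Lambda> n < top"
      using ennreal_less_top order.strict_trans1 by blast
    then have "(\<lambda>m. min_density \<Lambda> n - ennreal (e m)) \<longlonglongrightarrow> min_density \<Lambda> n - 0"
      unfolding e_def by (intro tendsto_diff_ennreal tendsto_const min_density_le(2)[OF assms]) auto
    then have "eventually (\<lambda>m. c < min_density \<Lambda> n - ennreal (e m)) sequentially"
      using n by (intro order_tendstoD(1)) auto
    then show "eventually (\<lambda>m. c < min_density \<Lambda> m) sequentially"
    proof eventually_elim
      case (elim m)
      have "min_density \<Lambda> n - ennreal (e m) \<le> min_density \<Lambda> m"
        using min_density_le(1)[OF assms, of n m] by (simp add: ennreal_minus_le_iff add.commute e_def)
      then show ?case using elim by simp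
    qed
  next
    fix c assume "(SUP n. min_density \<Lambda> n) < c"
    then show "eventually (\<lambda>m. min_density \<Lambda> m < c) sequentially"
      by (intro always_eventually allI) (meson SUP_upper UNIV_I order.strict_trans1)
  qed
  then show ?thesis
    unfolding lower_density_eq by (metis limI)
qed

lemma lower_density_geI:
  assumes "thin C0 N \<Lambda>" "eventually (\<lambda>n. \<forall>x. c * measure mu (K n) \<le> card (\<Lambda> \<inter> (x +o K n))) sequentially"
  shows "ennreal c \<le> lower_density mu K \<Lambda>"
proof (rule tendsto_lowerbound[OF min_density_tendsto[OF assms(1)]])
  show "eventually (\<lambda>n. ennreal c \<le> min_density \<Lambda> n) sequentially"
    using assms(2)
  proof eventually_elim
    case (elim n)
    then show ?case
      unfolding min_density_def count_div_eq[OF assms(1)] using measure_K_pos[of n]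
      by (intro INF_greatest ennreal_leI) (simp add: field_simps)
  qed
qed simp

text \<open>Converts a strict inequality of extended numbers into a real surplus of points, uniform
  in the translate; \<eta> comes from a number strictly between the two sides.\<close>

lemma lower_density_gtD:
  assumes "thin C0 N \<Lambda>" "ennreal c < lower_density mu K \<Lambda>" "0 \<le> c"
  obtains \<eta> where "0 < \<eta>"
    "eventually (\<lambda>n. \<forall>x. (c + \<eta>) * measure mu (K n) \<le> card (\<Lambda> \<inter> (x +o K n))) sequentially"
proof -
  obtain b where b: "ennreal c < b" "b < lower_density mu K \<Lambda>"
    using dense[OF assms(2)] by blast
  then have "b < top" by (intro order.strict_trans2[OF b(2)] top_greatest)
  then obtain r where r: "b = ennreal r" "0 \<le> r" by (cases b) auto
  have "c < r" using b(1) r assms(3) by (simp add: ennreal_less_iff)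
  have "eventually (\<lambda>n. b < min_density \<Lambda> n) sequentially"
    by (rule order_tendstoD(1)[OF min_density_tendsto[OF assms(1)] b(2)])
  then have "eventually (\<lambda>n. \<forall>x. (c + (r - c)) * measure mu (K n) \<le> card (\<Lambda> \<inter> (x +o K n))) sequentially"
  proof eventually_elim
    case (elim n)
    show ?case
    proof
      fix x
      have "min_density \<Lambda> n \<le> ennreal (card (\<Lambda> \<inter> (x +o K n)) / measure mu (K n))"
        unfolding min_density_def count_div_eq[OF assms(1)] by (rule INF_lower) simp
      then have "ennreal r \<le> ennreal (card (\<Lambda> \<inter> (x +o K n)) / measure mu (K n))"
        using elim unfolding r(1) by (meson less_imp_le less_le_trans)
      then have "r \<le> card (\<Lambda> \<inter> (x +o K n)) / measure mu (K n)"
        using r(2) by (subst (asm) ennreal_le_iff) auto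
      then show "(c + (r - c)) * measure mu (K n) \<le> card (\<Lambda> \<inter> (x +o K n))"
        using measure_K_pos[of n] by (simp add: field_simps)
    qed
  qed
  then show ?thesis using that[of "r - c"] \<open>c < r\<close> by simp
qed

end

subsection \<open>Localized families\<close>

text \<open>\<open>w y\<close> is thought of as concentrated at \<open>y\<close>: its coefficients
  are absolutely summable uniformly in \<open>y\<close>, with uniformly small tails outside y + C.
  No rate of decay is prescribed, which keeps stability under \<open>S\<close> elementary. The base
  point \<open>y\<close> ranges over the whole group, as the trace integral requires.\<close>

definition localized_family ::
    "('g::topological_group_add \<Rightarrow> 'h::complex_hilbert_space) \<Rightarrow> 'g set \<Rightarrow> ('g \<Rightarrow> 'h) \<Rightarrow> bool" where
  "localized_family v \<Lambda> w \<longleftrightarrow>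
     (\<exists>M\<ge>0. \<forall>y F. finite F \<longrightarrow> F \<subseteq> \<Lambda> \<longrightarrow> (\<Sum>l\<in>F. cmod (cinner (w y) (v l))) \<le> M)
   \<and> (\<forall>\<delta>>0. \<exists>C. compact C \<and> (\<forall>y F. finite F \<longrightarrow> F \<subseteq> \<Lambda> \<longrightarrow> (\<forall>l\<in>F. - y + l \<notin> C) \<longrightarrow>
        (\<Sum>l\<in>F. cmod (cinner (w y) (v l))) \<le> \<delta>))"

lemma localized_familyD:
  assumes "localized_family v \<Lambda> w"
  obtains M where "M \<ge> 0"
    "\<And>y F. finite F \<Longrightarrow> F \<subseteq> \<Lambda> \<Longrightarrow> (\<Sum>l\<in>F. cmod (cinner (w y) (v l))) \<le> M"
  using assms unfolding localized_family_def by blast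

lemma localized_family_tail:
  assumes "localized_family v \<Lambda> w" "0 < \<delta>"
  obtains C where "compact C"
    "\<And>y F. finite F \<Longrightarrow> F \<subseteq> \<Lambda> \<Longrightarrow> (\<And>l. l \<in> F \<Longrightarrow> - y + l \<notin> C) \<Longrightarrow>
        (\<Sum>l\<in>F. cmod (cinner (w y) (v l))) \<le> \<delta>"
proof -
  obtain C where "compact C \<and> (\<forall>y F. finite F \<longrightarrow> F \<subseteq> \<Lambda> \<longrightarrow> (\<forall>l\<in>F. - y + l \<notin> C) \<longrightarrow>
        (\<Sum>l\<in>F. cmod (cinner (w y) (v l))) \<le> \<delta>)"
    using assms(1)[unfolded localized_family_def, THEN conjunct2, rule_format, OF assms(2)] ..
  then show ?thesis by (intro that[of C]) simp_all
qed

lemma localized_family_zero: "localized_family v \<Lambda> (\<lambda>y. 0)"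
  unfolding localized_family_def by (auto intro: exI[of _ 0] exI[of _ "{}"])

lemma localized_family_scaleR:
  assumes w: "localized_family v \<Lambda> w"
  shows "localized_family v \<Lambda> (\<lambda>y. r *\<^sub>R w y)"
proof -
  have eq: "(\<Sum>l\<in>F. cmod (cinner (r *\<^sub>R w y) (v l))) = \<bar>r\<bar> * (\<Sum>l\<in>F. cmod (cinner (w y) (v l)))" for y F
    by (simp add: cinner_scaleR_left norm_mult sum_distrib_left)
  obtain M where M: "M \<ge> 0"
    "\<And>y F. finite F \<Longrightarrow> F \<subseteq> \<Lambda> \<Longrightarrow> (\<Sum>l\<in>F. cmod (cinner (w y) (v l))) \<le> M"
    using localized_familyD[OF w] by blast
  show ?thesis
    unfolding localized_family_def eq
  proof (intro conjI allI impI)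
    show "\<exists>M\<ge>0. \<forall>y F. finite F \<longrightarrow> F \<subseteq> \<Lambda> \<longrightarrow> \<bar>r\<bar> * (\<Sum>l\<in>F. cmod (cinner (w y) (v l))) \<le> M"
      using M by (intro exI[of _ "\<bar>r\<bar> * M"]) (auto intro: mult_left_mono)
    fix \<delta> :: real assume "0 < \<delta>"
    \<comment> \<open>The summand 1 keeps the denominator positive for r = 0.\<close>
    then have "0 < \<delta> / (\<bar>r\<bar> + 1)" by simp
    then obtain C where C: "compact C"
      "\<And>y F. finite F \<Longrightarrow> F \<subseteq> \<Lambda> \<Longrightarrow> (\<And>l. l \<in> F \<Longrightarrow> - y + l \<notin> C) \<Longrightarrow>
        (\<Sum>l\<in>F. cmod (cinner (w y) (v l))) \<le> \<delta> / (\<bar>r\<bar> + 1)"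
      using localized_family_tail[OF w] by blast
    have "\<bar>r\<bar> * (\<Sum>l\<in>F. cmod (cinner (w y) (v l))) \<le> \<delta>"
      if "finite F" "F \<subseteq> \<Lambda>" "\<forall>l\<in>F. - y + l \<notin> C" for y F
    proof -
      have "\<bar>r\<bar> * (\<Sum>l\<in>F. cmod (cinner (w y) (v l))) \<le> (\<bar>r\<bar> + 1) * (\<delta> / (\<bar>r\<bar> + 1))"
        using that by (intro mult_mono C(2)) (auto intro: sum_nonneg)
      then show ?thesis by simp
    qed
    then show "\<exists>C. compact C \<and> (\<forall>y F. finite F \<longrightarrow> F \<subseteq> \<Lambda> \<longrightarrow> (\<forall>l\<in>F. - y + l \<notin> C) \<longrightarrow>
        \<bar>r\<bar> * (\<Sum>l\<in>F. cmod (cinner (w y) (v l))) \<le> \<delta>)"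
      using C(1) by (intro exI[of _ C]) simp
  qed
qed

lemma localized_family_add:
  assumes w: "localized_family v \<Lambda> w" and w': "localized_family v \<Lambda> w'"
  shows "localized_family v \<Lambda> (\<lambda>y. w y + w' y)"
proof -
  have le: "(\<Sum>l\<in>F. cmod (cinner (w y + w' y) (v l)))
      \<le> (\<Sum>l\<in>F. cmod (cinner (w y) (v l))) + (\<Sum>l\<in>F. cmod (cinner (w' y) (v l)))" for y F
    unfolding sum.distrib[symmetric] by (intro sum_mono) (simp add: cinner_add_left norm_triangle_ineq)
  obtain M where M: "M \<ge> 0"
    "\<And>y F. finite F \<Longrightarrow> F \<subseteq> \<Lambda> \<Longrightarrow> (\<Sum>l\<in>F. cmod (cinner (w y) (v l))) \<le> M"
    using localized_familyD[OF w] by blast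
  obtain M' where M': "M' \<ge> 0"
    "\<And>y F. finite F \<Longrightarrow> F \<subseteq> \<Lambda> \<Longrightarrow> (\<Sum>l\<in>F. cmod (cinner (w' y) (v l))) \<le> M'"
    using localized_familyD[OF w'] by blast
  show ?thesis
    unfolding localized_family_def
  proof (intro conjI allI impI)
    show "\<exists>M\<ge>0. \<forall>y F. finite F \<longrightarrow> F \<subseteq> \<Lambda> \<longrightarrow> (\<Sum>l\<in>F. cmod (cinner (w y + w' y) (v l))) \<le> M"
      using M M' by (intro exI[of _ "M + M'"]) (auto intro!: order_trans[OF le] add_mono)
    fix \<delta> :: real assume "0 < \<delta>"
    then have \<delta>2: "0 < \<delta> / 2" by simp
    obtain C where C: "compact C"
      "\<And>y F. finite F \<Longrightarrow> F \<subseteq> \<Lambda> \<Longrightarrow> (\<And>l. l \<in> F \<Longrightarrow> - y + l \<notin> C) \<Longrightarrow>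
        (\<Sum>l\<in>F. cmod (cinner (w y) (v l))) \<le> \<delta> / 2"
      using localized_family_tail[OF w \<delta>2] by blast
    obtain C' where C': "compact C'"
      "\<And>y F. finite F \<Longrightarrow> F \<subseteq> \<Lambda> \<Longrightarrow> (\<And>l. l \<in> F \<Longrightarrow> - y + l \<notin> C') \<Longrightarrow>
        (\<Sum>l\<in>F. cmod (cinner (w' y) (v l))) \<le> \<delta> / 2"
      using localized_family_tail[OF w' \<delta>2] by blast
    have "(\<Sum>l\<in>F. cmod (cinner (w y + w' y) (v l))) \<le> \<delta>"
      if "finite F" "F \<subseteq> \<Lambda>" "\<forall>l\<in>F. - y + l \<notin> C \<union> C'" for y F
    proof -
      have "(\<Sum>l\<in>F. cmod (cinner (w y) (v l))) \<le> \<delta> / 2"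
        using that by (intro C(2)) auto
      moreover have "(\<Sum>l\<in>F. cmod (cinner (w' y) (v l))) \<le> \<delta> / 2"
        using that by (intro C'(2)) auto
      ultimately show ?thesis
        using le[where y = y and F = F] by linarith
    qed
    then show "\<exists>C. compact C \<and> (\<forall>y F. finite F \<longrightarrow> F \<subseteq> \<Lambda> \<longrightarrow> (\<forall>l\<in>F. - y + l \<notin> C) \<longrightarrow>
        (\<Sum>l\<in>F. cmod (cinner (w y + w' y) (v l))) \<le> \<delta>)"
      using compact_Un[OF C(1) C'(1)] by (intro exI[of _ "C \<union> C'"]) simp
  qed
qed

lemma localized_family_sum:
  assumes "\<And>k. k \<in> I \<Longrightarrow> localized_family v \<Lambda> (w k)"
  shows "localized_family v \<Lambda> (\<lambda>y. \<Sum>k\<in>I. w k y)"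
  using assms
  by (induction I rule: infinite_finite_induct) (auto intro: localized_family_zero localized_family_add)

text \<open>The coefficients of S (w y) are the matrix product of <w y, v i> and <v i, v l>.
  Absolute row sums multiply. For l outside y + C + C', either i lies outside y + C or l lies
  outside i + C', so one of the two factors is a tail.\<close>

lemma localized_family_frame_op:
  assumes v: "localized_family v \<Lambda> v" and w: "localized_family v \<Lambda> w" and S: "frame_op_of S v \<Lambda>"
  shows "localized_family v \<Lambda> (\<lambda>y. S (w y))"
proof -
  obtain M0 where M0: "M0 \<ge> 0"
    "\<And>y F. finite F \<Longrightarrow> F \<subseteq> \<Lambda> \<Longrightarrow> (\<Sum>l\<in>F. cmod (cinner (v y) (v l))) \<le> M0"
    using localized_familyD[OF v] by blast
  obtain M where M: "M \<ge> 0"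
    "\<And>y F. finite F \<Longrightarrow> F \<subseteq> \<Lambda> \<Longrightarrow> (\<Sum>l\<in>F. cmod (cinner (w y) (v l))) \<le> M"
    using localized_familyD[OF w] by blast
  \<comment> \<open>Reduction to finite index sets: the absolute values of the partial sums over
    \<open>J\<close> converge, so a bound uniform in \<open>J\<close> survives in the limit.\<close>
  have le: "(\<Sum>l\<in>F. cmod (cinner (S (w y)) (v l))) \<le> b"
    if b: "\<And>J. finite J \<Longrightarrow> J \<subseteq> \<Lambda> \<Longrightarrow>
        (\<Sum>i\<in>J. cmod (cinner (w y) (v i)) * (\<Sum>l\<in>F. cmod (cinner (v i) (v l)))) \<le> b" for y F b
  proof (rule tendsto_upperbound)
    show "((\<lambda>J. \<Sum>l\<in>F. cmod (\<Sum>i\<in>J. cinner (w y) (v i) * cinner (v i) (v l)))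
        \<longlongrightarrow> (\<Sum>l\<in>F. cmod (cinner (S (w y)) (v l)))) (finite_subsets_at_top \<Lambda>)"
      using S unfolding frame_op_of_def has_sum_def by (intro tendsto_sum tendsto_norm) blast
    show "eventually (\<lambda>J. (\<Sum>l\<in>F. cmod (\<Sum>i\<in>J. cinner (w y) (v i) * cinner (v i) (v l))) \<le> b)
        (finite_subsets_at_top \<Lambda>)"
    proof (rule eventually_finite_subsets_at_top_weakI)
      fix J assume J: "finite J" "J \<subseteq> \<Lambda>"
      have "(\<Sum>l\<in>F. cmod (\<Sum>i\<in>J. cinner (w y) (v i) * cinner (v i) (v l)))
          \<le> (\<Sum>l\<in>F. \<Sum>i\<in>J. cmod (cinner (w y) (v i)) * cmod (cinner (v i) (v l)))"
        by (intro sum_mono sum_norm_le) (simp add: norm_mult)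
      also have "\<dots> = (\<Sum>i\<in>J. cmod (cinner (w y) (v i)) * (\<Sum>l\<in>F. cmod (cinner (v i) (v l))))"
        by (subst sum.swap) (simp add: sum_distrib_left)
      also have "\<dots> \<le> b" by (rule b[OF J])
      finally show "(\<Sum>l\<in>F. cmod (\<Sum>i\<in>J. cinner (w y) (v i) * cinner (v i) (v l))) \<le> b" .
    qed
  qed simp
  show ?thesis
    unfolding localized_family_def
  proof (intro conjI allI impI)
    have "(\<Sum>l\<in>F. cmod (cinner (S (w y)) (v l))) \<le> M * M0" if "finite F" "F \<subseteq> \<Lambda>" for y F
    proof (rule le)
      fix J assume "finite J" "J \<subseteq> \<Lambda>"
      have "(\<Sum>i\<in>J. cmod (cinner (w y) (v i)) * (\<Sum>l\<in>F. cmod (cinner (v i) (v l))))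
          \<le> (\<Sum>i\<in>J. cmod (cinner (w y) (v i)) * M0)"
        by (intro sum_mono mult_left_mono M0(2) that) auto
      also have "\<dots> = (\<Sum>i\<in>J. cmod (cinner (w y) (v i))) * M0"
        by (simp add: sum_distrib_right)
      also have "\<dots> \<le> M * M0"
        by (intro mult_right_mono M(2) M0(1)) fact+
      finally show "(\<Sum>i\<in>J. cmod (cinner (w y) (v i)) * (\<Sum>l\<in>F. cmod (cinner (v i) (v l)))) \<le> M * M0" .
    qed
    then show "\<exists>M\<ge>0. \<forall>y F. finite F \<longrightarrow> F \<subseteq> \<Lambda> \<longrightarrow> (\<Sum>l\<in>F. cmod (cinner (S (w y)) (v l))) \<le> M"
      using M(1) M0(1) by (intro exI[of _ "M * M0"]) auto
    fix \<delta> :: real assume "0 < \<delta>"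
    then have \<delta>: "0 < \<delta> / (2 * (M0 + 1))" "0 < \<delta> / (2 * (M + 1))" using M M0 by simp_all
    obtain C where C: "compact C"
      "\<And>y F. finite F \<Longrightarrow> F \<subseteq> \<Lambda> \<Longrightarrow> (\<And>l. l \<in> F \<Longrightarrow> - y + l \<notin> C) \<Longrightarrow>
        (\<Sum>l\<in>F. cmod (cinner (w y) (v l))) \<le> \<delta> / (2 * (M0 + 1))"
      using localized_family_tail[OF w \<delta>(1)] by blast
    obtain C' where C': "compact C'"
      "\<And>y F. finite F \<Longrightarrow> F \<subseteq> \<Lambda> \<Longrightarrow> (\<And>l. l \<in> F \<Longrightarrow> - y + l \<notin> C') \<Longrightarrow>
        (\<Sum>l\<in>F. cmod (cinner (v y) (v l))) \<le> \<delta> / (2 * (M + 1))"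
      using localized_family_tail[OF v \<delta>(2)] by blast
    have "(\<Sum>l\<in>F. cmod (cinner (S (w y)) (v l))) \<le> \<delta>"
      if F: "finite F" "F \<subseteq> \<Lambda>" "\<forall>l\<in>F. - y + l \<notin> C + C'" for y F
    proof (rule le)
      fix J assume J: "finite J" "J \<subseteq> \<Lambda>"
      \<comment> \<open>Indices near \<open>y\<close> use the tail of the second factor, the
        remaining ones the tail of the first; each part receives half of \<delta>.\<close>
      define J1 where "J1 = {i\<in>J. - y + i \<in> C}"
      define J2 where "J2 = {i\<in>J. - y + i \<notin> C}"
      let ?t = "\<lambda>i. cmod (cinner (w y) (v i)) * (\<Sum>l\<in>F. cmod (cinner (v i) (v l)))"
      have split: "(\<Sum>i\<in>J. ?t i) = (\<Sum>i\<in>J1. ?t i) + (\<Sum>i\<in>J2. ?t i)"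
        using J by (subst sum.union_disjoint[symmetric]) (auto simp: J1_def J2_def intro!: sum.cong)
      have "(\<Sum>i\<in>J1. ?t i) \<le> (\<Sum>i\<in>J1. cmod (cinner (w y) (v i)) * (\<delta> / (2 * (M + 1))))"
      proof (intro sum_mono mult_left_mono C'(2) F)
        fix i l assume "i \<in> J1" "l \<in> F"
        show "- i + l \<notin> C'"
        proof
          assume "- i + l \<in> C'"
          then have "(- y + i) + (- i + l) \<in> C + C'"
            using \<open>i \<in> J1\<close> by (intro set_plus_intro) (auto simp: J1_def)
          then show False using F(3) \<open>l \<in> F\<close> by (simp add: add.assoc)
        qed
      qed auto
      also have "\<dots> = (\<Sum>i\<in>J1. cmod (cinner (w y) (v i))) * (\<delta> / (2 * (M + 1)))"
        by (simp add: sum_distrib_right sum_divide_distrib)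
      also have "\<dots> \<le> (M + 1) * (\<delta> / (2 * (M + 1)))"
        using J \<delta>(2) by (intro mult_right_mono order_trans[OF M(2)]) (auto simp: J1_def)
      also have "\<dots> = \<delta> / 2" using M(1) by (simp add: field_simps)
      finally have t1: "(\<Sum>i\<in>J1. ?t i) \<le> \<delta> / 2" .
      have "(\<Sum>i\<in>J2. ?t i) \<le> (\<Sum>i\<in>J2. cmod (cinner (w y) (v i)) * (M0 + 1))"
        by (intro sum_mono mult_left_mono order_trans[OF M0(2)[OF F(1,2)]]) auto
      also have "\<dots> = (\<Sum>i\<in>J2. cmod (cinner (w y) (v i))) * (M0 + 1)"
        by (simp add: sum_distrib_right)
      also have "\<dots> \<le> \<delta> / (2 * (M0 + 1)) * (M0 + 1)"
        using J M0(1) by (intro mult_right_mono C(2)) (auto simp: J2_def)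
      also have "\<dots> = \<delta> / 2" using M0(1) by (simp add: field_simps)
      finally have t2: "(\<Sum>i\<in>J2. ?t i) \<le> \<delta> / 2" .
      show "(\<Sum>i\<in>J. ?t i) \<le> \<delta>" unfolding split using t1 t2 by linarith
    qed
    then show "\<exists>C. compact C \<and> (\<forall>y F. finite F \<longrightarrow> F \<subseteq> \<Lambda> \<longrightarrow> (\<forall>l\<in>F. - y + l \<notin> C) \<longrightarrow>
        (\<Sum>l\<in>F. cmod (cinner (S (w y)) (v l))) \<le> \<delta>)"
      using compact_set_plus[OF C(1) C'(1)] by (intro exI[of _ "C + C'"]) simp
  qed
qed

lemma localized_family_neumann:
  assumes v: "localized_family v \<Lambda> v" and S: "frame_op_of S v \<Lambda>"
  shows "localized_family v \<Lambda> (\<lambda>y. neumann S B N (v y))"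
proof -
  have "localized_family v \<Lambda> (\<lambda>y. (resid S B ^^ k) (v y))" for k
  proof (induction k)
    case (Suc k)
    have eq: "(resid S B ^^ Suc k) u = (resid S B ^^ k) u + (- 1 / B) *\<^sub>R S ((resid S B ^^ k) u)" for u
      by (simp add: resid_def[of S B "(resid S B ^^ k) u"])
    show ?case
      unfolding eq by (rule localized_family_add[OF Suc localized_family_scaleR[OF
            localized_family_frame_op[OF v Suc S]]])
  qed (simp add: v)
  then show ?thesis
    unfolding neumann_def by (intro localized_family_scaleR localized_family_sum)
qed

subsection \<open>Coherent frames\<close>

locale coherent_frame = unimodular_lc_group mu
  for mu :: "'g::{topological_group_add, second_countable_topology, t2_space} measure" +
  fixes \<pi> :: "'g \<Rightarrow> 'h::complex_hilbert_space \<Rightarrow> 'h" and d :: real and g :: 'h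
    and Q \<Lambda> :: "'g set" and A B :: real
  assumes rep: "projective_unitary_rep \<pi>"
    and formal_degree: "formal_degree mu \<pi> d"
    and g_nz: "g \<noteq> 0"
    and Q: "compact Q" "0 \<in> interior Q" "uminus ` Q = Q"
    and g_loc: "g \<in> localized_vectors mu Q \<pi>"
    and frame: "frame_bounds A B (\<lambda>l. \<pi> l g) \<Lambda>"
begin

lemma d_pos: "0 < d"
  using formal_degree by (simp add: formal_degree_def)

lemma A_pos: "0 < A" and A_le_B: "A \<le> B" and B_pos: "0 < B"
  using frame by (auto simp: frame_bounds_def)

lemma cinner_rep: "cinner (\<pi> x f) (\<pi> x h) = cinner f h"
  using rep by (simp add: projective_unitary_rep_def unitary_def)

lemma norm_rep [simp]: "norm (\<pi> x f) = norm f"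
  using cinner_rep[of x f f] by (simp add: cinner_self power2_eq_iff_nonneg flip: of_real_power)

lemma measurable_rep [measurable]: "(\<lambda>x. \<pi> x f) \<in> borel_measurable borel"
  using rep by (simp add: projective_unitary_rep_def)

lemma measurable_cinner_rep_right [measurable]: "(\<lambda>x. cinner f (\<pi> x h)) \<in> borel_measurable borel"
  by (rule measurable_compose[OF measurable_rep borel_measurable_continuous_onI])
    (rule linear_continuous_on[OF bounded_linear_cinner_right])

lemma measurable_cinner_rep_left [measurable]: "(\<lambda>x. cinner (\<pi> x h) f) \<in> borel_measurable borel"
  by (rule measurable_compose[OF measurable_rep borel_measurable_continuous_onI])
    (rule linear_continuous_on[OF bounded_linear_cinner_left])

definition V :: "'g \<Rightarrow> real" where
  "V x = cmod (cinner g (\<pi> x g))"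

lemma V_nonneg [simp]: "0 \<le> V x"
  by (simp add: V_def)

lemma measurable_V [measurable]: "V \<in> borel_measurable borel"
  unfolding V_def[abs_def] by measurable

text \<open>The cocycle has modulus one and drops out of absolute values, so sizes depend only on
  \<open>- y + x\<close>, as for an ordinary representation.\<close>

lemma cmod_cinner_orbit: "cmod (cinner (\<pi> y g) (\<pi> x g)) = V (- y + x)"
proof -
  obtain \<sigma> where \<sigma>: "\<And>x y. cmod (\<sigma> x y) = 1" "\<And>x y f. \<pi> (x + y) f = \<sigma> x y *\<^sub>C \<pi> x (\<pi> y f)"
    using rep unfolding projective_unitary_rep_def by blast
  have "\<pi> x g = \<sigma> y (- y + x) *\<^sub>C \<pi> y (\<pi> (- y + x) g)"
    using \<sigma>(2)[of y "- y + x" g] by (simp add: add.assoc[symmetric])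
  then show ?thesis
    by (simp add: cinner_scaleC_right norm_mult \<sigma>(1) cinner_rep V_def)
qed

lemma V_commute: "V (- y + x) = V (- x + y)"
  by (metis cmod_cinner_orbit cmod_cinner_commute)

lemma reproducing:
  "has_bochner_integral mu (\<lambda>y. cinner f1 (\<pi> y g) * cinner (\<pi> y g) f2)
    (of_real ((norm g)\<^sup>2 / d) * cinner f1 f2)"
  using formal_degree[unfolded formal_degree_def, THEN conjunct2, THEN spec[of _ f1],
      THEN spec[of _ f2], THEN spec[of _ g], THEN spec[of _ g]]
  by (simp add: cinner_self divide_inverse mult_ac)

lemma nn_integral_V_square: "(\<integral>\<^sup>+y. ennreal ((V y)\<^sup>2) \<partial>mu) = ennreal ((norm g) ^ 4 / d)"
proof -
  have "has_bochner_integral mu (\<lambda>y. of_real ((V y)\<^sup>2) :: complex) (of_real ((norm g) ^ 4 / d))"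
  proof -
    have "cinner g (\<pi> y g) * cinner (\<pi> y g) g = of_real ((V y)\<^sup>2)" for y
      unfolding V_def by (metis cinner_commute complex_norm_square)
    moreover have "of_real ((norm g)\<^sup>2 / d) * cinner g g = of_real ((norm g) ^ 4 / d)"
      by (simp add: cinner_self power_numeral_reduce power2_eq_square)
    ultimately show ?thesis using reproducing[of g g] by (simp only:)
  qed
  then have "has_bochner_integral mu (\<lambda>y. (V y)\<^sup>2) ((norm g) ^ 4 / d)"
    using has_bochner_integral_Re by fastforce
  then show ?thesis
    by (subst nn_integral_eq_integral) (auto simp: has_bochner_integral_iff)
qed

lemma bessel: "bessel_seq B (\<lambda>l. \<pi> l g) \<Lambda>"
  by (rule frame_bounds_bessel[OF frame])

text \<open>Integrating the Bessel inequality for \<open>\<pi> y g\<close> over \<open>y\<close> bounds the number of frame elements.\<close>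
lemma thin_index: "\<exists>C N. thin C N \<Lambda>"
proof -
  define I where "I = (norm g) ^ 4 / d"
  have I: "0 < I" using g_nz d_pos by (simp add: I_def)
  \<comment> \<open>The tail is smaller than the full integral, so \<open>C0\<close> carries
    positive mass.\<close>
  obtain C0 where C0: "compact C0" "(\<integral>\<^sup>+y. ennreal ((V y)\<^sup>2) * indicator (- C0) y \<partial>mu) < ennreal I"
    by (rule compact_tail[of "\<lambda>y. ennreal ((V y)\<^sup>2)" "ennreal I"])
      (use I in \<open>auto simp: nn_integral_V_square I_def\<close>)
  define C where "C = insert 0 C0"
  have C: "compact C" "0 \<in> C" using C0 by (simp_all add: C_def)
  then have [measurable]: "C \<in> sets borel" "C0 \<in> sets borel" using C0 by (auto intro: borel_compact)
  define c where "c = (\<integral>\<^sup>+y. ennreal ((V y)\<^sup>2) * indicator C y \<partial>mu)"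
  have "ennreal I = (\<integral>\<^sup>+y. ennreal ((V y)\<^sup>2) * indicator C0 y + ennreal ((V y)\<^sup>2) * indicator (- C0) y \<partial>mu)"
    unfolding I_def nn_integral_V_square[symmetric]
    by (intro nn_integral_cong) (auto split: split_indicator)
  also have "\<dots> = (\<integral>\<^sup>+y. ennreal ((V y)\<^sup>2) * indicator C0 y \<partial>mu) + (\<integral>\<^sup>+y. ennreal ((V y)\<^sup>2) * indicator (- C0) y \<partial>mu)"
    by (rule nn_integral_add) auto
  finally have "(\<integral>\<^sup>+y. ennreal ((V y)\<^sup>2) * indicator C0 y \<partial>mu) \<noteq> 0"
    using C0(2) by auto
  moreover have "(\<integral>\<^sup>+y. ennreal ((V y)\<^sup>2) * indicator C0 y \<partial>mu) \<le> c"
    unfolding c_def C_def by (intro nn_integral_mono) (auto split: split_indicator)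
  ultimately have "0 < c" by (simp add: zero_less_iff_neq_zero) (metis le_zero_eq)
  moreover have "c \<le> ennreal I"
    unfolding c_def I_def nn_integral_V_square[symmetric]
    by (intro nn_integral_mono) (auto split: split_indicator)
  ultimately obtain c' where c': "c = ennreal c'" "0 < c'"
    by (cases c) (auto simp: top_unique)
  \<comment> \<open>The Bessel bound at an orbit vector, divided by the mass that every index
    deposits in \<open>Y\<close>.\<close>
  define N where "N = B * (norm g)\<^sup>2 / c'"
  have bound: "card F \<le> N * measure mu Y"
    if Y: "Y \<in> sets borel" "E + C \<subseteq> Y" "emeasure mu Y < \<infinity>" and F: "finite F" "F \<subseteq> \<Lambda> \<inter> E" for E Y F
  proof -
    have [measurable]: "Y \<in> sets borel" by fact
    have Ym: "emeasure mu Y = ennreal (measure mu Y)"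
      using Y(3) by (intro emeasure_eq_ennreal_measure) simp
    have "of_nat (card F) * c = (\<Sum>l\<in>F. c)" by simp
    also have "\<dots> \<le> (\<Sum>l\<in>F. \<integral>\<^sup>+y. ennreal ((V (- l + y))\<^sup>2) * indicator Y y \<partial>mu)"
    proof (intro sum_mono)
      fix l assume "l \<in> F"
      then have "l \<in> E" using F by auto
      \<comment> \<open>As \<open>l\<close> lies in \<open>E\<close>, the translate of
        \<open>C\<close> by \<open>l\<close> stays in \<open>Y\<close> and its full mass is
        collected.\<close>
      have "c \<le> (\<integral>\<^sup>+y. ennreal ((V y)\<^sup>2) * indicator Y (l + y) \<partial>mu)"
        unfolding c_def
      proof (intro nn_integral_mono)
        fix y
        show "ennreal ((V y)\<^sup>2) * indicator C y \<le> ennreal ((V y)\<^sup>2) * indicator Y (l + y)"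
          using Y(2) set_plus_intro[OF \<open>l \<in> E\<close>, of y C] by (auto split: split_indicator)
      qed
      also have "\<dots> = (\<integral>\<^sup>+y. ennreal ((V (- l + (l + y)))\<^sup>2) * indicator Y (l + y) \<partial>mu)"
        by (simp add: add.assoc[symmetric])
      also have "\<dots> = (\<integral>\<^sup>+y. ennreal ((V (- l + y))\<^sup>2) * indicator Y y \<partial>mu)"
        by (rule nn_integral_left) measurable
      finally show "c \<le> (\<integral>\<^sup>+y. ennreal ((V (- l + y))\<^sup>2) * indicator Y y \<partial>mu)" .
    qed
    also have "\<dots> = (\<integral>\<^sup>+y. (\<Sum>l\<in>F. ennreal ((V (- l + y))\<^sup>2) * indicator Y y) \<partial>mu)"
      by (rule nn_integral_sum[symmetric]) measurable
    also have "\<dots> \<le> (\<integral>\<^sup>+y. ennreal (B * (norm g)\<^sup>2) * indicator Y y \<partial>mu)"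
    proof (intro nn_integral_mono)
      fix y
      have "(\<Sum>l\<in>F. ennreal ((V (- l + y))\<^sup>2)) = ennreal (\<Sum>l\<in>F. (V (- l + y))\<^sup>2)"
        by (rule sum_ennreal) simp
      also have "\<dots> \<le> ennreal (B * (norm g)\<^sup>2)"
        using bessel[unfolded bessel_seq_def, rule_format, of F "\<pi> y g"] F
        by (intro ennreal_leI) (simp add: cmod_cinner_orbit V_commute[of y])
      finally show "(\<Sum>l\<in>F. ennreal ((V (- l + y))\<^sup>2) * indicator Y y) \<le> ennreal (B * (norm g)\<^sup>2) * indicator Y y"
        by (auto split: split_indicator)
    qed
    also have "\<dots> = ennreal (B * (norm g)\<^sup>2 * measure mu Y)"
      using B_pos by (simp add: nn_integral_cmult_indicator Ym ennreal_mult)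
    finally have "ennreal (card F * c') \<le> ennreal (B * (norm g)\<^sup>2 * measure mu Y)"
      using c' by (simp add: ennreal_mult ennreal_of_nat_eq_real_of_nat)
    then have "card F * c' \<le> B * (norm g)\<^sup>2 * measure mu Y"
      using B_pos by (subst (asm) ennreal_le_iff) auto
    then show ?thesis using c'(2) by (simp add: N_def field_simps)
  qed
  have "thin C N \<Lambda>"
    unfolding thin_def
  proof (intro conjI allI impI)
    show "0 \<le> N" using B_pos c' by (simp add: N_def)
    fix E Y assume Y: "Y \<in> sets borel" "E + C \<subseteq> Y" "emeasure mu Y < \<infinity>"
    have "\<forall>F. F \<subseteq> \<Lambda> \<inter> E \<longrightarrow> finite F \<longrightarrow> card F \<le> nat \<lfloor>N * measure mu Y\<rfloor>"
      using bound[OF Y] by (auto simp: le_nat_floor)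
    then show fin: "finite (\<Lambda> \<inter> E)"
      by (meson finite_if_finite_subsets_card_bdd)
    show "card (\<Lambda> \<inter> E) \<le> N * measure mu Y"
      by (rule bound[OF Y fin]) simp
  qed (use C in auto)
  then show ?thesis by blast
qed

section \<open>Pointwise control of the matrix coefficient\<close>

abbreviation MF :: "'g \<Rightarrow> ennreal" where
  "MF \<equiv> maximal_left mu Q (coeff \<pi> g g)"

lemma measurable_MF [measurable]: "MF \<in> borel_measurable borel"
  and nn_integral_MF: "(\<integral>\<^sup>+x. MF x \<partial>mu) < \<infinity>"
proof -
  have "MF \<in> borel_measurable mu" using g_loc by (simp add: localized_vectors_def wiener_left_def)
  then show "MF \<in> borel_measurable borel" by (simp cong: measurable_cong_sets)
  show "(\<integral>\<^sup>+x. MF x \<partial>mu) < \<infinity>" using g_loc by (simp add: localized_vectors_def wiener_left_def)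
qed

lemma sets_Q [measurable]: "Q \<in> sets borel"
  using Q by (simp add: borel_compact)

lemma emeasure_Q: "emeasure mu Q = ennreal (measure mu Q)" "0 < measure mu Q"
proof -
  show eq: "emeasure mu Q = ennreal (measure mu Q)"
    using Q emeasure_compact_eq by blast
  have "emeasure mu (interior Q) \<le> emeasure mu Q"
    by (intro emeasure_mono interior_subset) auto
  then have "0 < emeasure mu Q"
    using emeasure_open_pos[of "interior Q"] Q by auto
  then show "0 < measure mu Q" using eq by (simp add: ennreal_less_zero_iff)
qed

lemma uminus_mem_Q: "- q \<in> Q \<longleftrightarrow> q \<in> Q"
  using Q(3) by (metis image_eqI minus_minus imageE)

lemma indicator_Q_uminus [simp]: "indicator Q (- q) = indicator Q q"
  by (simp add: indicator_def uminus_mem_Q)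

text \<open>For each s the essential supremum \<open>MF s\<close> bounds V w for almost every w in s
  + Q. By Fubini, for almost every w the bound holds for almost every s with w in s + Q; these s
  form w + Q as Q is symmetric, and the bound is integrated over them.\<close>

lemma V_le_average: "AE w in mu. ennreal (V w) * emeasure mu Q \<le> (\<integral>\<^sup>+q. indicator Q q * MF (w + q) \<partial>mu)"
proof -
  interpret pair_sigma_finite mu mu ..
  have "AE w in mu. - s + w \<in> Q \<longrightarrow> ennreal (V w) \<le> MF s" for s
  proof -
    have "AE z in restrict_space mu Q. ennreal (V (s + z)) \<le> MF s"
      unfolding V_def maximal_left_def coeff_def by (rule esssup_AE)
    then have "AE z in mu. z \<in> Q \<longrightarrow> ennreal (V (s + z)) \<le> MF s"
      by (subst (asm) AE_restrict_space_iff) auto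
    then have "AE z in mu. - s + (s + z) \<in> Q \<longrightarrow> ennreal (V (s + z)) \<le> MF s"
      by (simp add: add.assoc[symmetric])
    then have "AE w in distr mu borel (\<lambda>z. s + z). - s + w \<in> Q \<longrightarrow> ennreal (V w) \<le> MF s"
      by (subst AE_distr_iff) auto
    then show ?thesis unfolding distr_left .
  qed
  then have "AE s in mu. AE w in mu. - s + w \<in> Q \<longrightarrow> ennreal (V w) \<le> MF s" by simp
  then have "AE w in mu. AE s in mu. - s + w \<in> Q \<longrightarrow> ennreal (V w) \<le> MF s"
    by (subst (asm) AE_commute) measurable
  then show ?thesis
  proof eventually_elim
    case (elim w)
    have "ennreal (V w) * emeasure mu Q = ennreal (V w) * (\<integral>\<^sup>+s. indicator Q (- s + w) \<partial>mu)"
      by (simp add: nn_integral_reflect)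
    also have "\<dots> = (\<integral>\<^sup>+s. ennreal (V w) * indicator Q (- s + w) \<partial>mu)"
      by (rule nn_integral_cmult[symmetric]) measurable
    also have "\<dots> \<le> (\<integral>\<^sup>+s. indicator Q (- s + w) * MF s \<partial>mu)"
      by (rule nn_integral_mono_AE) (use elim in \<open>auto split: split_indicator\<close>)
    also have "\<dots> = (\<integral>\<^sup>+q. indicator Q (- (w + q) + w) * MF (w + q) \<partial>mu)"
      by (rule nn_integral_left[symmetric]) measurable
    also have "\<dots> = (\<integral>\<^sup>+q. indicator Q q * MF (w + q) \<partial>mu)"
      by (simp add: minus_add add.assoc)
    finally show ?case .
  qed
qed

text \<open>Integrating the averaged bound and using right invariance gives the measure of
  \<open>Q\<close> times the integral of \<open>MF\<close>; the positive measure of \<open>Q\<close>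
  on the left makes the conclusion possible.\<close>

lemma nn_integral_V: "(\<integral>\<^sup>+x. ennreal (V x) \<partial>mu) < \<infinity>"
proof -
  interpret pair_sigma_finite mu mu ..
  have "(\<integral>\<^sup>+w. ennreal (V w) \<partial>mu) * emeasure mu Q = (\<integral>\<^sup>+w. ennreal (V w) * emeasure mu Q \<partial>mu)"
    by (rule nn_integral_multc[symmetric]) measurable
  also have "\<dots> \<le> (\<integral>\<^sup>+w. \<integral>\<^sup>+q. indicator Q q * MF (w + q) \<partial>mu \<partial>mu)"
    by (rule nn_integral_mono_AE[OF V_le_average])
  also have "\<dots> = (\<integral>\<^sup>+q. \<integral>\<^sup>+w. indicator Q q * MF (w + q) \<partial>mu \<partial>mu)"
    by (rule Fubini') measurable
  also have "\<dots> = (\<integral>\<^sup>+q. indicator Q q * (\<integral>\<^sup>+w. MF w \<partial>mu) \<partial>mu)"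
    by (intro nn_integral_cong) (simp add: nn_integral_cmult nn_integral_right)
  also have "\<dots> = emeasure mu Q * (\<integral>\<^sup>+w. MF w \<partial>mu)"
    by (simp add: nn_integral_multc)
  also have "\<dots> < \<infinity>"
    using nn_integral_MF by (simp add: emeasure_Q ennreal_mult_less_top)
  finally show ?thesis
    using emeasure_Q by (auto simp: ennreal_mult_less_top)
qed

text \<open>The reproducing formula \<open>V \<le> (d / \<parallel>g\<parallel>\<^sup>2) V * V\<close> turns the almost-everywhere bound by the
  maximal function into a pointwise one, so that continuity of \<open>V\<close> is not needed.\<close>
lemma local_bound:
  obtains H :: "'g \<Rightarrow> ennreal" where "H \<in> borel_measurable borel" "(\<integral>\<^sup>+x. H x \<partial>mu) < \<infinity>"
    "\<And>x. ennreal (V x) \<le> (\<integral>\<^sup>+q. indicator Q q * H (x + q) \<partial>mu)"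
proof -
  interpret pair_sigma_finite mu mu ..
  define k where "k = (norm g)\<^sup>2 / d * measure mu Q"
  have k: "0 < k" using g_nz d_pos emeasure_Q by (simp add: k_def)
  \<comment> \<open>The convolution of \<open>V\<close> with \<open>MF\<close>, normalised by the
    constant of the reproducing formula and the measure of \<open>Q\<close>. Convolution is
    insensitive to null sets, so it has a bound at every point.\<close>
  define H where "H x = ennreal (1 / k) * (\<integral>\<^sup>+y. ennreal (V y) * MF (- y + x) \<partial>mu)" for x
  have H [measurable]: "H \<in> borel_measurable borel"
    unfolding H_def[abs_def] by measurable
  have "(\<integral>\<^sup>+x. H x \<partial>mu) = ennreal (1 / k) * (\<integral>\<^sup>+x. \<integral>\<^sup>+y. ennreal (V y) * MF (- y + x) \<partial>mu \<partial>mu)"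
    unfolding H_def by (rule nn_integral_cmult) measurable
  also have "(\<integral>\<^sup>+x. \<integral>\<^sup>+y. ennreal (V y) * MF (- y + x) \<partial>mu \<partial>mu)
      = (\<integral>\<^sup>+y. \<integral>\<^sup>+x. ennreal (V y) * MF (- y + x) \<partial>mu \<partial>mu)"
    by (rule Fubini') measurable
  also have "\<dots> = (\<integral>\<^sup>+y. ennreal (V y) * (\<integral>\<^sup>+x. MF x \<partial>mu) \<partial>mu)"
    by (intro nn_integral_cong) (simp add: nn_integral_cmult nn_integral_left)
  also have "\<dots> = (\<integral>\<^sup>+y. ennreal (V y) \<partial>mu) * (\<integral>\<^sup>+x. MF x \<partial>mu)"
    by (rule nn_integral_multc) measurable
  finally have fin: "(\<integral>\<^sup>+x. H x \<partial>mu) < \<infinity>"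
    using nn_integral_V nn_integral_MF by (simp add: ennreal_mult_less_top)
  have "ennreal (V x) \<le> (\<integral>\<^sup>+q. indicator Q q * H (x + q) \<partial>mu)" for x
  proof -
    have "(norm g)\<^sup>2 / d * V x = norm (of_real ((norm g)\<^sup>2 / d) * cinner g (\<pi> x g))"
      using d_pos by (simp add: norm_mult V_def norm_divide norm_power)
    also have "ennreal \<dots> \<le> (\<integral>\<^sup>+y. norm (cinner g (\<pi> y g) * cinner (\<pi> y g) (\<pi> x g)) \<partial>mu)"
      by (rule has_bochner_integral_norm_bound[OF reproducing])
    also have "\<dots> = (\<integral>\<^sup>+y. ennreal (V y) * ennreal (V (- y + x)) \<partial>mu)"
      by (simp add: norm_mult cmod_cinner_orbit ennreal_mult flip: V_def)
    finally have 1: "ennreal ((norm g)\<^sup>2 / d * V x) \<le> (\<integral>\<^sup>+y. ennreal (V y) * ennreal (V (- y + x)) \<partial>mu)" .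
    \<comment> \<open>The map y -> - y + x preserves the measure, so for every fixed x the
      almost-everywhere bound may be used at - y + x for almost every y.\<close>
    have distr: "distr mu borel (\<lambda>y. - y + x) = mu"
    proof (rule measure_eqI)
      fix D assume "D \<in> sets (distr mu borel (\<lambda>y. - y + x))"
      then have [measurable]: "D \<in> sets borel" by simp
      have "emeasure (distr mu borel (\<lambda>y. - y + x)) D = (\<integral>\<^sup>+y. indicator D y \<partial>distr mu borel (\<lambda>y. - y + x))"
        by simp
      also have "\<dots> = (\<integral>\<^sup>+y. indicator D (- y + x) \<partial>mu)"
        by (rule nn_integral_distr) measurable
      also have "\<dots> = emeasure mu D"
        by (simp add: nn_integral_reflect)
      finally show "emeasure (distr mu borel (\<lambda>y. - y + x)) D = emeasure mu D" .
    qed simp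
    have "AE w in distr mu borel (\<lambda>y. - y + x).
        ennreal (V w) * emeasure mu Q \<le> (\<integral>\<^sup>+q. indicator Q q * MF (w + q) \<partial>mu)"
      unfolding distr by (rule V_le_average)
    then have AE: "AE y in mu. ennreal (V (- y + x)) * emeasure mu Q
        \<le> (\<integral>\<^sup>+q. indicator Q q * MF (- y + x + q) \<partial>mu)"
      by (subst (asm) AE_distr_iff) measurable
    have "ennreal (k * V x) = ennreal ((norm g)\<^sup>2 / d * V x) * emeasure mu Q"
      using d_pos by (simp add: k_def emeasure_Q ennreal_mult[symmetric] mult_ac)
    also have "\<dots> \<le> (\<integral>\<^sup>+y. ennreal (V y) * ennreal (V (- y + x)) \<partial>mu) * emeasure mu Q"
      by (intro mult_right_mono 1) simp
    also have "\<dots> = (\<integral>\<^sup>+y. ennreal (V y) * (ennreal (V (- y + x)) * emeasure mu Q) \<partial>mu)"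
      by (subst nn_integral_multc[symmetric]) (auto simp: mult.assoc)
    also have "\<dots> \<le> (\<integral>\<^sup>+y. ennreal (V y) * (\<integral>\<^sup>+q. indicator Q q * MF (- y + x + q) \<partial>mu) \<partial>mu)"
      using AE by (intro nn_integral_mono_AE) (auto elim!: eventually_mono intro: mult_left_mono)
    also have "\<dots> = (\<integral>\<^sup>+y. \<integral>\<^sup>+q. indicator Q q * (ennreal (V y) * MF (- y + (x + q))) \<partial>mu \<partial>mu)"
      by (intro nn_integral_cong) (subst nn_integral_cmult[symmetric], auto simp: mult_ac add.assoc)
    also have "\<dots> = (\<integral>\<^sup>+q. \<integral>\<^sup>+y. indicator Q q * (ennreal (V y) * MF (- y + (x + q))) \<partial>mu \<partial>mu)"
      by (rule Fubini') measurable
    also have "\<dots> = (\<integral>\<^sup>+q. ennreal k * (indicator Q q * H (x + q)) \<partial>mu)"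
    proof (rule nn_integral_cong)
      fix q
      have "(\<integral>\<^sup>+y. indicator Q q * (ennreal (V y) * MF (- y + (x + q))) \<partial>mu)
          = indicator Q q * (\<integral>\<^sup>+y. ennreal (V y) * MF (- y + (x + q)) \<partial>mu)"
        by (rule nn_integral_cmult) measurable
      also have "\<dots> = indicator Q q * (ennreal (k * (1 / k)) * (\<integral>\<^sup>+y. ennreal (V y) * MF (- y + (x + q)) \<partial>mu))"
        using k by simp
      also have "ennreal (k * (1 / k)) = ennreal k * ennreal (1 / k)"
        using k by (intro ennreal_mult) auto
      finally show "(\<integral>\<^sup>+y. indicator Q q * (ennreal (V y) * MF (- y + (x + q))) \<partial>mu)
          = ennreal k * (indicator Q q * H (x + q))"
        by (simp add: H_def mult_ac)
    qed
    also have "\<dots> = ennreal k * (\<integral>\<^sup>+q. indicator Q q * H (x + q) \<partial>mu)"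
      by (rule nn_integral_cmult) measurable
    finally show ?thesis
      using k by (simp add: ennreal_mult ennreal_mult_le_mult_iff)
  qed
  with H fin that show ?thesis by blast
qed

text \<open>Each \<open>V (- y + l)\<close> is at most the integral of \<open>H\<close> over a
  translate of \<open>Q\<close> at \<open>- y + l\<close>. Since \<Lambda> is thin these translates
  overlap boundedly often, so sums over \<Lambda> are controlled by the integral of
  \<open>H\<close>, and tails of sums by its tails.\<close>

lemma localized_orbit: "localized_family (\<lambda>x. \<pi> x g) \<Lambda> (\<lambda>x. \<pi> x g)"
proof -
  obtain H :: "'g \<Rightarrow> ennreal" where H [measurable]: "H \<in> borel_measurable borel"
    and fin: "(\<integral>\<^sup>+x. H x \<partial>mu) < \<infinity>"
    and V_le: "\<And>x. ennreal (V x) \<le> (\<integral>\<^sup>+q. indicator Q q * H (x + q) \<partial>mu)"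
    using local_bound by blast
  obtain C N where thin: "thin C N \<Lambda>" using thin_index by blast
  \<comment> \<open>Bounds the number of points of \<Lambda> in a translate of \<open>Q\<close>,
    hence the overlap.\<close>
  define n where "n = N * measure mu (Q + C)"
  have "0 \<le> n" using thin by (simp add: thin_def n_def)
  have le: "ennreal (\<Sum>l\<in>F. V (- y + l)) \<le> ennreal n * (\<integral>\<^sup>+t. H t * indicator D t \<partial>mu)"
    if F: "finite F" "F \<subseteq> \<Lambda>" and [measurable]: "D \<in> sets borel"
      and D: "\<And>l q. l \<in> F \<Longrightarrow> q \<in> Q \<Longrightarrow> - y + l + q \<in> D" for y F D
  proof -
    have "ennreal (\<Sum>l\<in>F. V (- y + l)) = (\<Sum>l\<in>F. ennreal (V (- y + l)))"
      by (rule sum_ennreal[symmetric]) simp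
    also have "\<dots> \<le> (\<Sum>l\<in>F. \<integral>\<^sup>+t. indicator Q (- (- y + l) + t) * (H t * indicator D t) \<partial>mu)"
    proof (intro sum_mono)
      fix l assume l: "l \<in> F"
      have "ennreal (V (- y + l)) \<le> (\<integral>\<^sup>+q. indicator Q q * H (- y + l + q) \<partial>mu)"
        by (rule V_le)
      also have "\<dots> = (\<integral>\<^sup>+q. indicator Q (- (- y + l) + ((- y + l) + q))
          * (H ((- y + l) + q) * indicator D ((- y + l) + q)) \<partial>mu)"
      proof (rule nn_integral_cong)
        fix q
        have "- (- y + l) + ((- y + l) + q) = q" by (rule minus_add_cancel)
        then show "indicator Q q * H (- y + l + q) = indicator Q (- (- y + l) + ((- y + l) + q))
          * (H ((- y + l) + q) * indicator D ((- y + l) + q))"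
          using D[OF l] by (auto split: split_indicator)
      qed
      also have "\<dots> = (\<integral>\<^sup>+t. indicator Q (- (- y + l) + t) * (H t * indicator D t) \<partial>mu)"
        by (rule nn_integral_left) measurable
      finally show "ennreal (V (- y + l)) \<le> (\<integral>\<^sup>+t. indicator Q (- (- y + l) + t) * (H t * indicator D t) \<partial>mu)" .
    qed
    also have "\<dots> = (\<integral>\<^sup>+t. (\<Sum>l\<in>F. indicator Q (- (- y + l) + t) * (H t * indicator D t)) \<partial>mu)"
      by (rule nn_integral_sum[symmetric]) measurable
    also have "\<dots> \<le> (\<integral>\<^sup>+t. ennreal n * (H t * indicator D t) \<partial>mu)"
    proof (rule nn_integral_mono)
      fix t
      have "(\<Sum>l\<in>F. indicator Q (- (- y + l) + t) :: ennreal) = of_nat (card {l\<in>F. - (- y + l) + t \<in> Q})"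
        using F by (simp add: indicator_def sum.If_cases Int_def)
      also have "{l\<in>F. - (- y + l) + t \<in> Q} \<subseteq> \<Lambda> \<inter> ((y + t) +o Q)"
      proof
        fix l assume "l \<in> {l\<in>F. - (- y + l) + t \<in> Q}"
        then have "l \<in> F" "- (- (- y + l) + t) \<in> Q" by (simp_all only: uminus_mem_Q) auto
        then show "l \<in> \<Lambda> \<inter> ((y + t) +o Q)"
          using F by (auto simp: mem_elt_set_plus_iff minus_add add.assoc)
      qed
      then have "card {l\<in>F. - (- y + l) + t \<in> Q} \<le> card (\<Lambda> \<inter> ((y + t) +o Q))"
        by (intro card_mono thin_compact(1)[OF thin Q(1)])
      then have "real (card {l\<in>F. - (- y + l) + t \<in> Q}) \<le> n"
        using thin_compact(2)[OF thin Q(1), of "y + t"] by (simp add: n_def)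
      then have "of_nat (card {l\<in>F. - (- y + l) + t \<in> Q}) \<le> ennreal n"
        by (simp add: ennreal_of_nat_eq_real_of_nat ennreal_leI)
      finally have "(\<Sum>l\<in>F. indicator Q (- (- y + l) + t)) \<le> ennreal n" .
      then show "(\<Sum>l\<in>F. indicator Q (- (- y + l) + t) * (H t * indicator D t)) \<le> ennreal n * (H t * indicator D t)"
        unfolding sum_distrib_right[symmetric] by (rule mult_right_mono) simp
    qed
    also have "\<dots> = ennreal n * (\<integral>\<^sup>+t. H t * indicator D t \<partial>mu)"
      by (rule nn_integral_cmult) measurable
    finally show ?thesis .
  qed
  show ?thesis
    unfolding localized_family_def cmod_cinner_orbit
  proof (intro conjI allI impI)
    define M where "M = n * enn2real (\<integral>\<^sup>+t. H t \<partial>mu)"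
    have "(\<Sum>l\<in>F. V (- y + l)) \<le> M" if "finite F" "F \<subseteq> \<Lambda>" for y F
    proof -
      have "ennreal (\<Sum>l\<in>F. V (- y + l)) \<le> ennreal n * (\<integral>\<^sup>+t. H t * indicator UNIV t \<partial>mu)"
        using that by (intro le) auto
      also have "\<dots> = ennreal M"
        using fin \<open>0 \<le> n\<close> by (simp add: M_def ennreal_mult)
      finally show ?thesis
        using \<open>0 \<le> n\<close> by (subst (asm) ennreal_le_iff) (auto simp: M_def)
    qed
    then show "\<exists>M\<ge>0. \<forall>y F. finite F \<longrightarrow> F \<subseteq> \<Lambda> \<longrightarrow> (\<Sum>l\<in>F. V (- y + l)) \<le> M"
      using \<open>0 \<le> n\<close> by (intro exI[of _ M]) (auto simp: M_def)
    fix \<delta> :: real assume "0 < \<delta>"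
    then have "0 < ennreal (\<delta> / (n + 1))" using \<open>0 \<le> n\<close> by simp
    then obtain C1 where C1: "compact C1" "(\<integral>\<^sup>+t. H t * indicator (- C1) t \<partial>mu) < ennreal (\<delta> / (n + 1))"
      by (rule compact_tail[OF H fin])
    have [measurable]: "C1 \<in> sets borel" using C1 by (simp add: borel_compact)
    \<comment> \<open>If \<open>- y + l\<close> avoids C1 + Q, then by symmetry of \<open>Q\<close>
      its translate of \<open>Q\<close> misses \<open>C1\<close>.\<close>
    have "(\<Sum>l\<in>F. V (- y + l)) \<le> \<delta>" if F: "finite F" "F \<subseteq> \<Lambda>" "\<forall>l\<in>F. - y + l \<notin> C1 + Q" for y F
    proof -
      have "ennreal (\<Sum>l\<in>F. V (- y + l)) \<le> ennreal n * (\<integral>\<^sup>+t. H t * indicator (- C1) t \<partial>mu)"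
      proof (intro le F)
        fix l q assume "l \<in> F" "q \<in> Q"
        show "- y + l + q \<in> - C1"
        proof
          assume "- y + l + q \<in> C1"
          then have "(- y + l + q) + - q \<in> C1 + Q"
            using \<open>q \<in> Q\<close> by (intro set_plus_intro) (auto simp: uminus_mem_Q)
          then show False using F(3) \<open>l \<in> F\<close> by simp
        qed
      qed auto
      also have "\<dots> \<le> ennreal (n + 1) * ennreal (\<delta> / (n + 1))"
        using C1(2) by (intro mult_mono ennreal_leI) auto
      also have "\<dots> = ennreal \<delta>"
        using \<open>0 \<le> n\<close> \<open>0 < \<delta>\<close> by (subst ennreal_mult[symmetric]) auto
      finally show ?thesis
        using \<open>0 < \<delta>\<close> by (subst (asm) ennreal_le_iff) auto
    qed
    then show "\<exists>C. compact C \<and> (\<forall>y F. finite F \<longrightarrow> F \<subseteq> \<Lambda> \<longrightarrow> (\<forall>l\<in>F. - y + l \<notin> C) \<longrightarrow>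
        (\<Sum>l\<in>F. V (- y + l)) \<le> \<delta>)"
      using compact_set_plus[OF C1(1) Q(1)] by (intro exI[of _ "C1 + Q"]) simp
  qed
qed

end

text \<open>Zorn's lemma; a point not covered by \<Gamma> could be added to it, since symmetry of
  \<open>C\<close> makes being separated a symmetric relation. Separation serves the Schur test,
  covering keeps the density positive.\<close>

lemma maximal_separated:
  fixes D C :: "'g::group_add set"
  assumes "0 \<in> C" "uminus ` C = C"
  obtains \<Gamma> where "\<Gamma> \<subseteq> D" "\<And>a b. a \<in> \<Gamma> \<Longrightarrow> b \<in> \<Gamma> \<Longrightarrow> a \<noteq> b \<Longrightarrow> - a + b \<notin> C"
    "\<And>l. l \<in> D \<Longrightarrow> \<exists>a\<in>\<Gamma>. - a + l \<in> C"
proof -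
  define \<A> where "\<A> = {\<Gamma>. \<Gamma> \<subseteq> D \<and> (\<forall>a\<in>\<Gamma>. \<forall>b\<in>\<Gamma>. a \<noteq> b \<longrightarrow> - a + b \<notin> C)}"
  have "\<exists>M\<in>\<A>. \<forall>X\<in>\<A>. M \<subseteq> X \<longrightarrow> X = M"
  proof (rule subset_Zorn')
    fix \<C> assume c: "subset.chain \<A> \<C>"
    have "- a + b \<notin> C" if ab: "a \<in> \<Union>\<C>" "b \<in> \<Union>\<C>" "a \<noteq> b" for a b
    proof -
      obtain X Y where XY: "a \<in> X" "X \<in> \<C>" "b \<in> Y" "Y \<in> \<C>" using ab by blast
      then have "X \<subseteq> Y \<or> Y \<subseteq> X" using c by (meson subset_chain_def)
      then obtain Z where "Z \<in> \<C>" "a \<in> Z" "b \<in> Z" using XY by blast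
      moreover have "Z \<in> \<A>" using c \<open>Z \<in> \<C>\<close> by (auto simp: subset_chain_def)
      ultimately show ?thesis using ab(3) by (auto simp: \<A>_def)
    qed
    moreover have "\<Union>\<C> \<subseteq> D" using c by (auto simp: subset_chain_def \<A>_def)
    ultimately show "\<Union>\<C> \<in> \<A>" by (auto simp: \<A>_def)
  qed
  then obtain \<Gamma> where \<Gamma>: "\<Gamma> \<in> \<A>" "\<And>X. X \<in> \<A> \<Longrightarrow> \<Gamma> \<subseteq> X \<Longrightarrow> X = \<Gamma>" by blast
  have "\<exists>a\<in>\<Gamma>. - a + l \<in> C" if "l \<in> D" for l
  proof (rule ccontr)
    assume *: "\<not> (\<exists>a\<in>\<Gamma>. - a + l \<in> C)"
    then have "l \<notin> \<Gamma>" using assms(1) by force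
    have "- l + a \<notin> C" if "a \<in> \<Gamma>" for a
    proof
      assume "- l + a \<in> C"
      then have "- (- l + a) \<in> C" using assms(2) by (metis image_eqI)
      then show False using * that by (simp add: minus_add)
    qed
    then have "insert l \<Gamma> \<in> \<A>"
      using \<Gamma>(1) \<open>l \<in> D\<close> * by (auto simp: \<A>_def)
    then show False using \<Gamma>(2)[of "insert l \<Gamma>"] \<open>l \<notin> \<Gamma>\<close> by blast
  qed
  then show ?thesis
    using \<Gamma>(1) that[of \<Gamma>] by (auto simp: \<A>_def)
qed

section \<open>Trace estimates over Folner sets\<close>

locale coherent_folner = coherent_frame mu \<pi> d g Q \<Lambda> A B + folner_group mu K
  for mu :: "'g::{topological_group_add, second_countable_topology, t2_space} measure"
    and \<pi> :: "'g \<Rightarrow> 'h::complex_hilbert_space \<Rightarrow> 'h" and d g Q \<Lambda> A B K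
begin

lemma set_plus_K_subset: "0 \<in> C \<Longrightarrow> K n + C \<subseteq> K n \<union> bdry C n"
proof
  fix x assume "0 \<in> C" "x \<in> K n + C"
  then show "x \<in> K n \<union> bdry C n"
    using set_plus_intro[of x "UNIV - K n" 0 C] by (auto simp: bdry_def)
qed

lemma measure_K_plus_le:
  assumes "compact C" "0 \<in> C"
  shows "measure mu (K n + C) \<le> measure mu (K n) + measure mu (bdry C n)"
proof -
  have f: "emeasure mu (K n) \<noteq> \<infinity>" "emeasure mu (bdry C n) \<noteq> \<infinity>"
    using emeasure_compact[OF compact_K, of n] emeasure_bdry[OF assms(1), of n] by auto
  have fm: "K n \<in> fmeasurable mu" "bdry C n \<in> fmeasurable mu"
    using f assms by (auto intro!: fmeasurableI simp: sets_bdry less_top)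
  then have "measure mu (K n + C) \<le> measure mu (K n \<union> bdry C n)"
    using set_plus_K_subset[OF assms(2)] assms compact_set_plus[OF compact_K assms(1)]
    by (intro measure_mono_fmeasurable fmeasurable.Un) (auto intro: borel_compact)
  also have "\<dots> \<le> measure mu (K n) + measure mu (bdry C n)"
    using assms by (intro measure_Un_le) (auto simp: sets_bdry)
  finally show ?thesis .
qed

context
  fixes S T :: "'h \<Rightarrow> 'h" and \<delta> \<tau> :: real
  assumes S: "frame_op_of S (\<lambda>l. \<pi> l g) \<Lambda>" and T: "pos_op T"
    and T_bound: "\<And>f. norm (T f) \<le> \<tau> * norm f" "0 \<le> \<tau>"
    and T_approx: "\<And>f. norm (f - T (S f)) \<le> \<delta> * norm f" "0 \<le> \<delta>"
begin

lemma cmod_cinner_T_orbit: "cmod (cinner (T (\<pi> l g)) (\<pi> y g)) \<le> \<tau> * (norm g)\<^sup>2"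
proof -
  have "cmod (cinner (T (\<pi> l g)) (\<pi> y g)) \<le> norm (T (\<pi> l g)) * norm (\<pi> y g)"
    by (rule cinner_cauchy_schwarz)
  also have "\<dots> \<le> (\<tau> * norm g) * norm g"
    using T_bound(1)[of "\<pi> l g"] by (intro mult_mono) (auto intro: order_trans[OF norm_ge_zero])
  finally show ?thesis by (simp add: power2_eq_square mult.assoc)
qed

text \<open>The integrand that reproduces the sum of <T f_l, f_l> over \<open>F\<close>, up to the
  factor (norm g)^2 / d. Summed over all of \<Lambda> it becomes <T S u, u> with u =
  \<open>\<pi> y g\<close>.\<close>

definition partial_trace :: "'g set \<Rightarrow> 'g \<Rightarrow> complex" where
  "partial_trace F y = (\<Sum>l\<in>F. cinner (T (\<pi> l g)) (\<pi> y g) * cinner (\<pi> y g) (\<pi> l g))"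

lemma cmod_partial_trace_le: "cmod (partial_trace F y) \<le> (\<Sum>l\<in>F. \<tau> * (norm g)\<^sup>2 * V (- y + l))"
  unfolding partial_trace_def
  by (intro sum_norm_le) (simp add: norm_mult cmod_cinner_orbit mult_right_mono cmod_cinner_T_orbit)

text \<open>The full sum <T S u, u> has modulus at most (1 + \<delta>) (norm g)^2, and the indices
  missing from \<open>F\<close> contribute only a tail of \<open>V\<close>.\<close>

lemma cmod_partial_trace_interior:
  assumes F: "finite F" "F \<subseteq> \<Lambda>"
    and tail: "\<And>J. finite J \<Longrightarrow> J \<subseteq> \<Lambda> - F \<Longrightarrow> (\<Sum>l\<in>J. V (- y + l)) \<le> \<delta>'"
  shows "cmod (partial_trace F y) \<le> (norm g)\<^sup>2 * (1 + \<delta>) + \<tau> * (norm g)\<^sup>2 * \<delta>'"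
proof -
  let ?u = "\<pi> y g"
  have eq: "cinner ?u (\<pi> l g) * cinner (\<pi> l g) (T ?u) = cinner (T (\<pi> l g)) ?u * cinner ?u (\<pi> l g)" for l
    by (simp add: pos_op_sym[OF T])
  have "((\<lambda>l. cinner (T (\<pi> l g)) ?u * cinner ?u (\<pi> l g)) has_sum cinner (S ?u) (T ?u)) \<Lambda>"
    using S[unfolded frame_op_of_def, rule_format, of ?u "T ?u"] unfolding eq .
  then have lim: "((\<lambda>J. cmod (partial_trace J y)) \<longlongrightarrow> cmod (cinner (S ?u) (T ?u))) (finite_subsets_at_top \<Lambda>)"
    unfolding has_sum_def partial_trace_def by (rule tendsto_norm)
  have "cmod (partial_trace F y) - \<tau> * (norm g)\<^sup>2 * \<delta>' \<le> cmod (cinner (S ?u) (T ?u))"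
  proof (rule tendsto_lowerbound[OF lim])
    have "cmod (partial_trace F y) - \<tau> * (norm g)\<^sup>2 * \<delta>' \<le> cmod (partial_trace J y)"
      if J: "finite J" "F \<subseteq> J" "J \<subseteq> \<Lambda>" for J
    proof -
      have "partial_trace J y = partial_trace F y + partial_trace (J - F) y"
        unfolding partial_trace_def using J by (simp add: sum.subset_diff)
      then have "cmod (partial_trace F y) \<le> cmod (partial_trace J y) + cmod (partial_trace (J - F) y)"
        by (metis add_diff_cancel_right' norm_triangle_ineq4)
      moreover have "cmod (partial_trace (J - F) y) \<le> \<tau> * (norm g)\<^sup>2 * (\<Sum>l\<in>J - F. V (- y + l))"
        using cmod_partial_trace_le[of "J - F" y] by (simp add: sum_distrib_left)
      moreover have "\<dots> \<le> \<tau> * (norm g)\<^sup>2 * \<delta>'"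
        using J T_bound(2) by (intro mult_left_mono tail) auto
      ultimately show ?thesis by linarith
    qed
    then show "eventually (\<lambda>J. cmod (partial_trace F y) - \<tau> * (norm g)\<^sup>2 * \<delta>' \<le> cmod (partial_trace J y))
        (finite_subsets_at_top \<Lambda>)"
      unfolding eventually_finite_subsets_at_top using F by blast
  qed simp
  also have "cmod (cinner (S ?u) (T ?u)) = cmod (cinner (T (S ?u)) ?u)"
    by (simp add: pos_op_sym[OF T])
  also have "\<dots> \<le> norm (T (S ?u)) * norm ?u"
    by (rule cinner_cauchy_schwarz)
  also have "\<dots> \<le> (norm g + \<delta> * norm g) * norm g"
  proof (intro mult_mono)
    have "norm (T (S ?u)) \<le> norm ?u + norm (?u - T (S ?u))"
      using norm_triangle_ineq4[of ?u "?u - T (S ?u)"] by simp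
    then show "norm (T (S ?u)) \<le> norm g + \<delta> * norm g"
      using T_approx(1)[of ?u] by simp
  qed (use T_approx(2) in auto)
  finally show ?thesis
    by (simp add: power2_eq_square algebra_simps)
qed

lemma measurable_partial_trace [measurable]: "partial_trace F \<in> borel_measurable borel"
  unfolding partial_trace_def[abs_def] by measurable

lemma sum_Re_le_nn_integral:
  "ennreal ((norm g)\<^sup>2 / d * (\<Sum>l\<in>F. Re (cinner (T (\<pi> l g)) (\<pi> l g))))
    \<le> (\<integral>\<^sup>+y. ennreal (cmod (partial_trace F y)) \<partial>mu)"
proof -
  let ?I = "\<Sum>l\<in>F. of_real ((norm g)\<^sup>2 / d) * cinner (T (\<pi> l g)) (\<pi> l g)"
  have "has_bochner_integral mu (partial_trace F) ?I"
    unfolding partial_trace_def[abs_def] by (intro has_bochner_integral_sum reproducing)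
  then have "ennreal (norm ?I) \<le> (\<integral>\<^sup>+y. ennreal (cmod (partial_trace F y)) \<partial>mu)"
    by (rule has_bochner_integral_norm_bound)
  moreover have "(norm g)\<^sup>2 / d * (\<Sum>l\<in>F. Re (cinner (T (\<pi> l g)) (\<pi> l g))) = Re ?I"
    by (simp add: sum_distrib_left)
  ultimately show ?thesis
    using order_trans[OF ennreal_leI[OF complex_Re_le_cmod]] by presburger
qed

text \<open>The integral of \<open>partial_trace\<close> is split by the position of y. Inside x + K
  n, away from the boundary, only a small tail of indices is missing and the frame identity applies.
  Near the boundary a crude bound suffices, since the boundary has small relative measure. Outside,
  every index of \<open>F\<close> is far from y, and the integrated tail of \<open>V\<close> is paid
  once for each index.\<close>

lemma trace_le:
  assumes "0 < \<zeta>"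
  shows "eventually (\<lambda>n. \<forall>x. (\<Sum>l\<in>\<Lambda> \<inter> (x +o K n). Re (cinner (T (\<pi> l g)) (\<pi> l g)))
      \<le> (d * (1 + \<delta>) + \<zeta>) * measure mu (K n)) sequentially"
proof -
  obtain C0 N where thin: "thin C0 N \<Lambda>" using thin_index by blast
  then have C0: "compact C0" "0 \<in> C0" "0 \<le> N" by (auto simp: thin_def)
  define \<tau>' where "\<tau>' = \<tau> * (norm g)\<^sup>2"
  have "0 \<le> \<tau>'" using T_bound by (simp add: \<tau>'_def)
  \<comment> \<open>Inverts the constant (norm g)^2 / d of the reproducing formula.\<close>
  define \<kappa> where "\<kappa> = d / (norm g)\<^sup>2"
  have "0 < \<kappa>" using d_pos g_nz by (simp add: \<kappa>_def)
  \<comment> \<open>\<open>D\<close> dominates the coefficient of \<delta>' in the limiting bound,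
    so \<delta>' costs at most \<zeta> / 2 and strict room remains for the convergence.\<close>
  define D where "D = \<kappa> * \<tau>' * (1 + N) + 1"
  define \<delta>' where "\<delta>' = \<zeta> / 2 / D"
  have D: "0 < D" unfolding D_def using \<open>0 \<le> \<tau>'\<close> \<open>0 < \<kappa>\<close> C0 by (simp add: add_nonneg_pos)
  have "0 < \<delta>'" using assms D by (simp add: \<delta>'_def)
  obtain M where M: "0 \<le> M" "\<And>y F. finite F \<Longrightarrow> F \<subseteq> \<Lambda> \<Longrightarrow> (\<Sum>l\<in>F. V (- y + l)) \<le> M"
    using localized_familyD[OF localized_orbit] unfolding cmod_cinner_orbit by blast
  obtain C1 where C1: "compact C1"
      "\<And>y F. finite F \<Longrightarrow> F \<subseteq> \<Lambda> \<Longrightarrow> (\<And>l. l \<in> F \<Longrightarrow> - y + l \<notin> C1) \<Longrightarrow> (\<Sum>l\<in>F. V (- y + l)) \<le> \<delta>'"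
    using localized_family_tail[OF localized_orbit \<open>0 < \<delta>'\<close>] unfolding cmod_cinner_orbit by blast
  obtain C2 where C2: "compact C2" "(\<integral>\<^sup>+y. ennreal (V y) * indicator (- C2) y \<partial>mu) < ennreal \<delta>'"
    by (rule compact_tail[of "\<lambda>y. ennreal (V y)" "ennreal \<delta>'"])
      (use nn_integral_V \<open>0 < \<delta>'\<close> in auto)
  \<comment> \<open>\<open>C0\<close> serves the point count, the reflection of \<open>C1\<close>
    the interior case, and \<open>C2\<close> the integral tail.\<close>
  define C where "C = C0 \<union> C1 \<union> C2 \<union> uminus ` C1"
  have C: "compact C" "0 \<in> C"
    using C0 C1 C2 by (auto simp: C_def intro!: compact_Un compact_uminus_image)
  have [measurable]: "C \<in> sets borel" "C2 \<in> sets borel" using C C2 by (auto intro: borel_compact)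
  have C2': "(\<integral>\<^sup>+y. ennreal (V y) * indicator (- C) y \<partial>mu) \<le> ennreal \<delta>'"
    using C2(2) by (intro order_trans[OF nn_integral_mono less_imp_le]) (auto simp: C_def split: split_indicator)
  define a where "a = (norm g)\<^sup>2 * (1 + \<delta>) + \<tau>' * \<delta>'"
  have "0 \<le> a" using T_approx(2) \<open>0 \<le> \<tau>'\<close> \<open>0 < \<delta>'\<close> by (simp add: a_def)
  define b where "b n = measure mu (bdry C n) / measure mu (K n)" for n
  \<comment> \<open>Per unit of measure: the region x + (K n + C), the boundary, and \<tau>'
    \<delta>' for each of at most N (1 + b n) indices.\<close>
  define E where "E n = a * (1 + b n) + \<tau>' * M * b n + N * (1 + b n) * (\<tau>' * \<delta>')" for n
  have bound: "(norm g)\<^sup>2 / d * (\<Sum>l\<in>\<Lambda> \<inter> (x +o K n). Re (cinner (T (\<pi> l g)) (\<pi> l g))) \<le> E n * measure mu (K n)"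
    for x n
  proof -
    define F where "F = \<Lambda> \<inter> (x +o K n)"
    have F: "finite F" "F \<subseteq> \<Lambda>"
      unfolding F_def by (auto intro: thin_compact(1)[OF thin compact_K])
    note [measurable] = sets_translate[OF sets_bdry[OF C(1)]]
    have KC: "compact (K n + C)" by (intro compact_set_plus compact_K C)
    note [measurable] = sets_translate[OF borel_compact[OF KC]]
    have pt: "cmod (partial_trace F y) \<le> a * indicator (x +o (K n + C)) y
        + \<tau>' * M * indicator (x +o bdry C n) y + (\<Sum>l\<in>F. \<tau>' * (V (- l + y) * indicator (- C) (- l + y)))" for y
    proof -
      have nn: "0 \<le> a * indicator (x +o (K n + C)) y" "0 \<le> \<tau>' * M * indicator (x +o bdry C n) y"
        "0 \<le> (\<Sum>l\<in>F. \<tau>' * (V (- l + y) * indicator (- C) (- l + y)))"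
        using \<open>0 \<le> a\<close> \<open>0 \<le> \<tau>'\<close> M(1) by (auto intro!: sum_nonneg)
      consider "y \<notin> x +o (K n + C)" | "y \<in> x +o bdry C n"
        | "y \<in> x +o (K n + C)" "y \<notin> x +o bdry C n" by blast
      then show ?thesis
      proof cases
        case 1
        have "cmod (partial_trace F y) \<le> (\<Sum>l\<in>F. \<tau>' * V (- y + l))"
          using cmod_partial_trace_le[of F y] by (simp add: \<tau>'_def)
        also have "\<dots> = (\<Sum>l\<in>F. \<tau>' * (V (- l + y) * indicator (- C) (- l + y)))"
        proof (intro sum.cong refl)
          fix l assume "l \<in> F"
          then have "- x + l \<in> K n" by (simp add: F_def mem_elt_set_plus_iff)
          moreover have "- x + y = (- x + l) + (- l + y)" by (simp add: add.assoc)
          ultimately have "- l + y \<notin> C"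
            using 1 unfolding mem_elt_set_plus_iff by (metis set_plus_intro)
          then show "\<tau>' * V (- y + l) = \<tau>' * (V (- l + y) * indicator (- C) (- l + y))"
            by (simp add: V_commute[of y])
        qed
        finally show ?thesis using nn by linarith
      next
        case 2
        have "cmod (partial_trace F y) \<le> \<tau>' * (\<Sum>l\<in>F. V (- y + l))"
          using cmod_partial_trace_le[of F y] by (simp add: \<tau>'_def sum_distrib_left)
        also have "\<dots> \<le> \<tau>' * M"
          using \<open>0 \<le> \<tau>'\<close> by (intro mult_left_mono M(2) F)
        finally show ?thesis using nn 2 by simp
      next
        case 3
        have "cmod (partial_trace F y) \<le> a"
          unfolding a_def \<tau>'_def
        proof (rule cmod_partial_trace_interior[OF F])
          \<comment> \<open>An index outside \<open>F\<close> lies outside x + K n; if it also lay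
            in y + C1, then y would belong to the boundary.\<close>
          fix J assume J: "finite J" "J \<subseteq> \<Lambda> - F"
          show "(\<Sum>l\<in>J. V (- y + l)) \<le> \<delta>'"
          proof (rule C1(2))
            fix l assume "l \<in> J"
            then have l: "- x + l \<in> UNIV - K n"
              using J by (auto simp: F_def mem_elt_set_plus_iff)
            show "- y + l \<notin> C1"
            proof
              assume "- y + l \<in> C1"
              then have "- (- y + l) \<in> C" by (simp add: C_def)
              then have "(- x + l) + - (- y + l) \<in> (UNIV - K n) + C"
                using l by (intro set_plus_intro)
              moreover have "(- x + l) + - (- y + l) = - x + y"
                by (simp only: minus_add add.assoc minus_minus add_minus_cancel)
              ultimately show False
                using 3 by (simp add: mem_elt_set_plus_iff bdry_def)
            qed
          qed (use J in auto)
        qed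
        then show ?thesis using nn 3 by simp
      qed
    qed
    have "ennreal ((norm g)\<^sup>2 / d * (\<Sum>l\<in>F. Re (cinner (T (\<pi> l g)) (\<pi> l g))))
      \<le> (\<integral>\<^sup>+y. ennreal (cmod (partial_trace F y)) \<partial>mu)"
      by (rule sum_Re_le_nn_integral)
    also have "\<dots> \<le> (\<integral>\<^sup>+y. ennreal a * indicator (x +o (K n + C)) y
        + ennreal (\<tau>' * M) * indicator (x +o bdry C n) y
        + (\<Sum>l\<in>F. ennreal \<tau>' * (ennreal (V (- l + y)) * indicator (- C) (- l + y))) \<partial>mu)"
    proof (rule nn_integral_mono)
      fix y
      have "ennreal (cmod (partial_trace F y)) \<le> ennreal (a * indicator (x +o (K n + C)) y
        + \<tau>' * M * indicator (x +o bdry C n) y + (\<Sum>l\<in>F. \<tau>' * (V (- l + y) * indicator (- C) (- l + y))))"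
        by (rule ennreal_leI[OF pt])
      also have "\<dots> = ennreal a * indicator (x +o (K n + C)) y
        + ennreal (\<tau>' * M) * indicator (x +o bdry C n) y
        + (\<Sum>l\<in>F. ennreal \<tau>' * (ennreal (V (- l + y)) * indicator (- C) (- l + y)))"
        using \<open>0 \<le> a\<close> \<open>0 \<le> \<tau>'\<close> M(1)
        by (simp add: sum_nonneg ennreal_mult ennreal_indicator flip: sum_ennreal)
      finally show "ennreal (cmod (partial_trace F y)) \<le> ennreal a * indicator (x +o (K n + C)) y
        + ennreal (\<tau>' * M) * indicator (x +o bdry C n) y
        + (\<Sum>l\<in>F. ennreal \<tau>' * (ennreal (V (- l + y)) * indicator (- C) (- l + y)))" .
    qed
    also have "\<dots> = (\<integral>\<^sup>+y. ennreal a * indicator (x +o (K n + C)) y \<partial>mu)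
        + (\<integral>\<^sup>+y. ennreal (\<tau>' * M) * indicator (x +o bdry C n) y \<partial>mu)
        + (\<Sum>l\<in>F. \<integral>\<^sup>+y. ennreal \<tau>' * (ennreal (V (- l + y)) * indicator (- C) (- l + y)) \<partial>mu)"
      by (simp add: nn_integral_add nn_integral_sum)
    also have "(\<integral>\<^sup>+y. ennreal a * indicator (x +o (K n + C)) y \<partial>mu) = ennreal (a * measure mu (K n + C))"
      using \<open>0 \<le> a\<close> KC
      by (simp add: nn_integral_cmult_indicator emeasure_translate borel_compact emeasure_compact_eq ennreal_mult)
    also have "(\<integral>\<^sup>+y. ennreal (\<tau>' * M) * indicator (x +o bdry C n) y \<partial>mu) = ennreal (\<tau>' * M * measure mu (bdry C n))"
    proof -
      have "emeasure mu (bdry C n) = ennreal (measure mu (bdry C n))"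
        using emeasure_bdry[OF C(1), of n] by (intro emeasure_eq_ennreal_measure) simp
      then show ?thesis
        using \<open>0 \<le> \<tau>'\<close> M(1) by (simp add: nn_integral_cmult_indicator emeasure_translate sets_bdry C ennreal_mult)
    qed
    also have "(\<Sum>l\<in>F. \<integral>\<^sup>+y. ennreal \<tau>' * (ennreal (V (- l + y)) * indicator (- C) (- l + y)) \<partial>mu)
        \<le> (\<Sum>l\<in>F. ennreal (\<tau>' * \<delta>'))"
    proof (rule sum_mono)
      fix l
      have "(\<integral>\<^sup>+y. ennreal \<tau>' * (ennreal (V (- l + y)) * indicator (- C) (- l + y)) \<partial>mu)
          = ennreal \<tau>' * (\<integral>\<^sup>+y. ennreal (V (- l + y)) * indicator (- C) (- l + y) \<partial>mu)"
        by (rule nn_integral_cmult) measurable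
      also have "(\<integral>\<^sup>+y. ennreal (V (- l + y)) * indicator (- C) (- l + y) \<partial>mu)
          = (\<integral>\<^sup>+y. ennreal (V y) * indicator (- C) y \<partial>mu)"
        by (rule nn_integral_left) measurable
      also have "ennreal \<tau>' * \<dots> \<le> ennreal \<tau>' * ennreal \<delta>'"
        by (intro mult_left_mono C2') simp
      finally show "(\<integral>\<^sup>+y. ennreal \<tau>' * (ennreal (V (- l + y)) * indicator (- C) (- l + y)) \<partial>mu) \<le> ennreal (\<tau>' * \<delta>')"
        using \<open>0 \<le> \<tau>'\<close> \<open>0 < \<delta>'\<close> by (simp add: ennreal_mult)
    qed
    also have "(\<Sum>l\<in>F. ennreal (\<tau>' * \<delta>')) = ennreal (card F * (\<tau>' * \<delta>'))"
      using \<open>0 \<le> \<tau>'\<close> \<open>0 < \<delta>'\<close> by (simp add: ennreal_mult ennreal_of_nat_eq_real_of_nat)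
    finally have "ennreal ((norm g)\<^sup>2 / d * (\<Sum>l\<in>F. Re (cinner (T (\<pi> l g)) (\<pi> l g))))
        \<le> ennreal (a * measure mu (K n + C)) + ennreal (\<tau>' * M * measure mu (bdry C n))
          + ennreal (card F * (\<tau>' * \<delta>'))"
      by (simp add: add_left_mono)
    also have "\<dots> = ennreal (a * measure mu (K n + C) + \<tau>' * M * measure mu (bdry C n) + card F * (\<tau>' * \<delta>'))"
      using \<open>0 \<le> a\<close> \<open>0 \<le> \<tau>'\<close> M(1) \<open>0 < \<delta>'\<close> by simp
    finally have 1: "(norm g)\<^sup>2 / d * (\<Sum>l\<in>F. Re (cinner (T (\<pi> l g)) (\<pi> l g)))
        \<le> a * measure mu (K n + C) + \<tau>' * M * measure mu (bdry C n) + card F * (\<tau>' * \<delta>')"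
      using \<open>0 \<le> a\<close> \<open>0 \<le> \<tau>'\<close> M(1) \<open>0 < \<delta>'\<close> by (subst (asm) ennreal_le_iff) auto
    have KC_le: "measure mu (K n + C) \<le> (1 + b n) * measure mu (K n)"
    proof -
      have "(1 + b n) * measure mu (K n) = measure mu (K n) + measure mu (bdry C n)"
        using measure_K_pos[of n] by (simp add: b_def field_simps)
      then show ?thesis using measure_K_plus_le[OF C, of n] by simp
    qed
    have "card F \<le> N * measure mu (K n + C0)"
      unfolding F_def by (rule thin_compact(2)[OF thin compact_K])
    also have "\<dots> \<le> N * measure mu (K n + C)"
    proof (intro mult_left_mono measure_mono_fmeasurable)
      show "K n + C0 \<subseteq> K n + C" by (intro set_plus_mono2) (auto simp: C_def)
      show "K n + C \<in> fmeasurable mu"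
        using KC emeasure_compact[OF KC] by (intro fmeasurableI) (auto intro: borel_compact)
      show "K n + C0 \<in> sets mu"
        using compact_set_plus[OF compact_K C0(1)] by (auto intro: borel_compact)
    qed (use C0 in auto)
    also have "\<dots> \<le> N * ((1 + b n) * measure mu (K n))"
      using C0 by (intro mult_left_mono KC_le) auto
    finally have "card F * (\<tau>' * \<delta>') \<le> N * ((1 + b n) * measure mu (K n)) * (\<tau>' * \<delta>')"
      using \<open>0 \<le> \<tau>'\<close> \<open>0 < \<delta>'\<close> by (intro mult_right_mono) auto
    moreover have "a * measure mu (K n + C) \<le> a * ((1 + b n) * measure mu (K n))"
      by (intro mult_left_mono KC_le \<open>0 \<le> a\<close>)
    moreover have "measure mu (bdry C n) = b n * measure mu (K n)"
      using measure_K_pos[of n] by (simp add: b_def)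
    ultimately show ?thesis
      using 1 unfolding F_def[symmetric] E_def by (simp add: algebra_simps)
  qed
  have "b \<longlonglongrightarrow> 0"
    unfolding b_def using C by (intro bdry_tendsto) auto
  then have "(\<lambda>n. \<kappa> * E n) \<longlonglongrightarrow> \<kappa> * (a * (1 + 0) + \<tau>' * M * 0 + N * (1 + 0) * (\<tau>' * \<delta>'))"
    unfolding E_def by (intro tendsto_intros)
  moreover have "\<kappa> * (a * (1 + 0) + \<tau>' * M * 0 + N * (1 + 0) * (\<tau>' * \<delta>')) < d * (1 + \<delta>) + \<zeta>"
  proof -
    have "\<kappa> * (a * (1 + 0) + \<tau>' * M * 0 + N * (1 + 0) * (\<tau>' * \<delta>'))
        = (\<kappa> * (norm g)\<^sup>2) * (1 + \<delta>) + (\<kappa> * \<tau>' * (1 + N)) * \<delta>'"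
      by (simp add: a_def algebra_simps)
    also have "\<kappa> * (norm g)\<^sup>2 = d" using g_nz by (simp add: \<kappa>_def)
    finally have "\<kappa> * (a * (1 + 0) + \<tau>' * M * 0 + N * (1 + 0) * (\<tau>' * \<delta>'))
        = d * (1 + \<delta>) + (\<kappa> * \<tau>' * (1 + N)) * \<delta>'" .
    moreover have "(\<kappa> * \<tau>' * (1 + N)) * \<delta>' \<le> D * \<delta>'"
      using \<open>0 < \<delta>'\<close> by (intro mult_right_mono) (auto simp: D_def)
    moreover have "D * \<delta>' = \<zeta> / 2" using D by (simp add: \<delta>'_def)
    ultimately show ?thesis using assms by linarith
  qed
  ultimately have "eventually (\<lambda>n. \<kappa> * E n < d * (1 + \<delta>) + \<zeta>) sequentially"
    by (rule order_tendstoD(2))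
  then show ?thesis
  proof eventually_elim
    case (elim n)
    show ?case
    proof
      fix x
      let ?s = "\<Sum>l\<in>\<Lambda> \<inter> (x +o K n). Re (cinner (T (\<pi> l g)) (\<pi> l g))"
      have "?s = \<kappa> * ((norm g)\<^sup>2 / d * ?s)"
        using d_pos g_nz by (simp add: \<kappa>_def)
      also have "\<dots> \<le> \<kappa> * (E n * measure mu (K n))"
        using \<open>0 < \<kappa>\<close> by (intro mult_left_mono bound) auto
      also have "\<dots> \<le> (d * (1 + \<delta>) + \<zeta>) * measure mu (K n)"
        using elim measure_K_pos[of n] by (simp add: mult.assoc[symmetric] mult_right_mono)
      finally show "?s \<le> (d * (1 + \<delta>) + \<zeta>) * measure mu (K n)" .
    qed
  qed
qed

end

section \<open>Selection of the removable set\<close>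

lemma removable_subset:
  assumes dens: "ennreal d < lower_density mu K \<Lambda>"
  shows "\<exists>\<Gamma>\<subseteq>\<Lambda>. 0 < lower_density mu K \<Gamma> \<and> is_frame (\<lambda>l. \<pi> l g) (\<Lambda> - \<Gamma>)"
proof -
  obtain C0 N where thin: "thin C0 N \<Lambda>" using thin_index by blast
  then have C0: "compact C0" "0 \<in> C0" "0 \<le> N" by (auto simp: thin_def)
  obtain S where S: "frame_op_of S (\<lambda>l. \<pi> l g) \<Lambda>"
    using frame_op_exists[OF bessel B_pos] by blast
  note frame_S = frame_op_pos[OF frame S] A_pos A_le_B frame_op_lower[OF frame S] frame_op_upper[OF frame S]
  obtain \<eta> where \<eta>: "0 < \<eta>"
    and many: "eventually (\<lambda>n. \<forall>x. (d + \<eta>) * measure mu (K n) \<le> card (\<Lambda> \<inter> (x +o K n))) sequentially"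
    using lower_density_gtD[OF thin dens] d_pos by auto
  \<comment> \<open>Then (1 - \<epsilon>) (d + \<eta>) = d + 3 \<eta> / 4, which exceeds the trace
    constant d + \<eta> / 2 by \<eta> / 4, the surplus that becomes a density.\<close>
  define \<epsilon> where "\<epsilon> = \<eta> / (4 * (d + \<eta>))"
  have \<epsilon>: "0 < \<epsilon>" "\<epsilon> < 1" "\<epsilon> * (d + \<eta>) = \<eta> / 4"
    using \<eta> d_pos by (simp_all add: \<epsilon>_def field_simps)
  \<comment> \<open>Diagonal entries at most 1 - \<epsilon>, plus off-diagonal row sums at most
    \<epsilon> / 2.\<close>
  define \<theta> where "\<theta> = 1 - \<epsilon> + \<epsilon> / 2"
  have \<theta>: "0 \<le> \<theta>" "\<theta> < 1" using \<epsilon> by (simp_all add: \<theta>_def)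
  define r where "r \<delta> = sqrt (\<theta> * (1 + \<delta> * (B / A))) + \<delta> * sqrt (B / A)" for \<delta>
  \<comment> \<open>\<open>r\<close> is continuous at 0 with value sqrt \<theta> < 1; the second
    condition keeps the trace constant below d + \<eta> / 2.\<close>
  have "\<exists>\<delta>>0. r \<delta> < 1 \<and> d * \<delta> < \<eta> / 4"
  proof -
    have "(r \<longlongrightarrow> sqrt (\<theta> * (1 + 0 * (B / A))) + 0 * sqrt (B / A)) (at_right 0)"
      unfolding r_def by (intro tendsto_intros)
    then have "eventually (\<lambda>\<delta>. r \<delta> < 1) (at_right 0)"
      by (rule order_tendstoD(2)) (use \<theta> in simp)
    moreover have "((\<lambda>\<delta>. d * \<delta>) \<longlongrightarrow> d * 0) (at_right 0)"
      by (intro tendsto_intros)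
    then have "eventually (\<lambda>\<delta>. d * \<delta> < \<eta> / 4) (at_right 0)"
      by (rule order_tendstoD(2)) (use \<eta> in simp)
    moreover have "eventually (\<lambda>\<delta>::real. 0 < \<delta>) (at_right 0)"
      by (rule eventually_at_right_less)
    ultimately have "eventually (\<lambda>\<delta>. 0 < \<delta> \<and> r \<delta> < 1 \<and> d * \<delta> < \<eta> / 4) (at_right 0)"
      by eventually_elim simp
    then show ?thesis
      using eventually_happens'[OF trivial_limit_at_right_real] by blast
  qed
  then obtain \<delta> where \<delta>: "0 < \<delta>" "r \<delta> < 1" "d * \<delta> < \<eta> / 4" by blast
  obtain m where m: "\<And>f. norm (f - neumann S B m (S f)) \<le> \<delta> * norm f"
    using neumann_approx[OF frame_S \<delta>(1)] by blast
  define T where "T = neumann S B m"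
  have T: "pos_op T" unfolding T_def by (rule pos_op_neumann[OF frame_S])
  have T_bound: "norm (T f) \<le> m / B * norm f" for f
    unfolding T_def by (rule norm_neumann_le[OF frame_S])
  have T_approx: "norm (f - T (S f)) \<le> \<delta> * norm f" for f
    unfolding T_def by (rule m)
  have T_loc: "localized_family (\<lambda>l. \<pi> l g) \<Lambda> (\<lambda>y. T (\<pi> y g))"
    unfolding T_def by (rule localized_family_neumann[OF localized_orbit S])
  define t where "t l = Re (cinner (T (\<pi> l g)) (\<pi> l g))" for l
  have t_nonneg: "0 \<le> t l" for l unfolding t_def by (rule pos_op_nonneg[OF T])
  have trace: "eventually (\<lambda>n. \<forall>x. (\<Sum>l\<in>\<Lambda> \<inter> (x +o K n). t l) \<le> (d * (1 + \<delta>) + \<eta> / 4) * measure mu (K n)) sequentially"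
    unfolding t_def
    using trace_le[OF S T T_bound _ T_approx, of "\<eta> / 4"] \<delta>(1) \<eta> B_pos by simp
  define \<Gamma>0 where "\<Gamma>0 = {l\<in>\<Lambda>. t l \<le> 1 - \<epsilon>}"
  have many0: "eventually (\<lambda>n. \<forall>x. \<eta> / 4 * measure mu (K n) \<le> card (\<Gamma>0 \<inter> (x +o K n))) sequentially"
    using many trace
  proof eventually_elim
    case (elim n)
    show ?case
    proof
      fix x
      define F where "F = \<Lambda> \<inter> (x +o K n)"
      define G where "G = \<Gamma>0 \<inter> (x +o K n)"
      have F: "finite F" "G \<subseteq> F"
        unfolding F_def G_def \<Gamma>0_def by (auto intro: thin_compact(1)[OF thin compact_K])
      \<comment> \<open>Indices outside \<open>\<Gamma>0\<close> have diagonal entry above 1 -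
        \<epsilon>, so the trace bound limits their number.\<close>
      have "(1 - \<epsilon>) * (real (card F) - card G) = (\<Sum>l\<in>F - G. 1 - \<epsilon>)"
        using F by (simp add: card_Diff_subset finite_subset card_mono of_nat_diff)
      also have "\<dots> \<le> (\<Sum>l\<in>F - G. t l)"
        by (intro sum_mono) (auto simp: F_def G_def \<Gamma>0_def)
      also have "\<dots> \<le> (\<Sum>l\<in>F. t l)"
        using F t_nonneg by (intro sum_mono2) auto
      also have "\<dots> \<le> (d * (1 + \<delta>) + \<eta> / 4) * measure mu (K n)"
        using elim(2) by (simp add: F_def)
      also have "\<dots> \<le> (d + \<eta> / 2) * measure mu (K n)"
        using \<delta>(3) measure_K_pos[of n] by (intro mult_right_mono) (auto simp: algebra_simps)
      finally have "(1 - \<epsilon>) * card F - card G \<le> (d + \<eta> / 2) * measure mu (K n)"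
        using \<epsilon> by (simp add: algebra_simps)
          (smt (verit) mult_nonneg_nonneg of_nat_0_le_iff)
      moreover have "(1 - \<epsilon>) * ((d + \<eta>) * measure mu (K n)) \<le> (1 - \<epsilon>) * card F"
        using elim(1) \<epsilon> by (intro mult_left_mono) (auto simp: F_def)
      moreover have "(1 - \<epsilon>) * ((d + \<eta>) * measure mu (K n)) = (d + \<eta> - \<epsilon> * (d + \<eta>)) * measure mu (K n)"
        by (simp add: algebra_simps)
      ultimately show "\<eta> / 4 * measure mu (K n) \<le> card (\<Gamma>0 \<inter> (x +o K n))"
        unfolding \<epsilon>(3) G_def by (simp add: algebra_simps)
    qed
  qed
  have "0 < \<epsilon> / 2" using \<epsilon> by simp
  then obtain C1 where C1: "compact C1"
      "\<And>y F. finite F \<Longrightarrow> F \<subseteq> \<Lambda> \<Longrightarrow> (\<And>l. l \<in> F \<Longrightarrow> - y + l \<notin> C1) \<Longrightarrow>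
        (\<Sum>l\<in>F. cmod (cinner (T (\<pi> y g)) (\<pi> l g))) \<le> \<epsilon> / 2"
    using localized_family_tail[OF T_loc] by blast
  \<comment> \<open>Symmetrised for the covering argument; separation by \<open>C\<close> entails
    separation by \<open>C1\<close>, where the row sums are small.\<close>
  define C where "C = insert 0 (C1 \<union> uminus ` C1)"
  have C: "compact C" "0 \<in> C" "uminus ` C = C"
    using C1(1) compact_uminus_image[OF C1(1)]
    by (auto simp: C_def image_Un image_image intro!: compact_insert compact_Un)
  obtain \<Gamma> where \<Gamma>: "\<Gamma> \<subseteq> \<Gamma>0" "\<And>a b. a \<in> \<Gamma> \<Longrightarrow> b \<in> \<Gamma> \<Longrightarrow> a \<noteq> b \<Longrightarrow> - a + b \<notin> C"
    "\<And>l. l \<in> \<Gamma>0 \<Longrightarrow> \<exists>a\<in>\<Gamma>. - a + l \<in> C"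
    using maximal_separated[OF C(2,3)] by blast
  have \<Gamma>_sub: "\<Gamma> \<subseteq> \<Lambda>" using \<Gamma>(1) by (auto simp: \<Gamma>0_def)
  have "is_frame (\<lambda>l. \<pi> l g) (\<Lambda> - \<Gamma>)"
  proof (rule frame_remove[OF frame S T T_approx _ \<Gamma>_sub])
    fix F c assume F: "finite F" "F \<subseteq> \<Gamma>"
    show "Re (cinner (T (\<Sum>i\<in>F. c i *\<^sub>C \<pi> i g)) (\<Sum>i\<in>F. c i *\<^sub>C \<pi> i g)) \<le> \<theta> * (\<Sum>i\<in>F. (cmod (c i))\<^sup>2)"
      unfolding \<theta>_def
    proof (rule gram_le_of_row_sums[OF T F(1)])
      fix i assume i: "i \<in> F"
      show "Re (cinner (T (\<pi> i g)) (\<pi> i g)) \<le> 1 - \<epsilon>"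
        using i F \<Gamma>(1) by (auto simp: \<Gamma>0_def t_def)
      show "(\<Sum>j\<in>F - {i}. cmod (cinner (T (\<pi> i g)) (\<pi> j g))) \<le> \<epsilon> / 2"
      proof (rule C1(2))
        fix j assume "j \<in> F - {i}"
        then have "- i + j \<notin> C" using \<Gamma>(2) i F by blast
        then show "- i + j \<notin> C1" by (simp add: C_def)
      qed (use F \<Gamma>_sub in auto)
    qed
  qed (use \<delta> \<theta> in \<open>auto simp: r_def\<close>)
  moreover have "0 < lower_density mu K \<Gamma>"
  proof -
    have thin': "thin C0 N \<Gamma>" by (rule thin_subset[OF thin \<Gamma>_sub])
    \<comment> \<open>Bounds how many points of \<open>\<Gamma>0\<close> a single point of \<Gamma>
      can cover; the summand 1 makes it positive.\<close>
    define n1 where "n1 = N * measure mu (C + C0) + 1"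
    have "0 < n1" using C0 by (simp add: n1_def add_nonneg_pos)
    define C' where "C' = C + C0 \<union> C0"
    note C' = card_bdry_le[OF thin' C(1), folded C'_def]
    have "(\<lambda>n. N * (measure mu (bdry C' n) / measure mu (K n))) \<longlonglongrightarrow> N * 0"
      by (intro tendsto_intros bdry_tendsto C')
    \<comment> \<open>Covering yields relative density \<eta> / (4 n1) for \<Gamma> in the enlarged
      sets; half of it is given up to the points outside x + K n.\<close>
    then have "eventually (\<lambda>n. N * (measure mu (bdry C' n) / measure mu (K n)) < \<eta> / (8 * n1)) sequentially"
      by (rule order_tendstoD(2)) (use \<eta> \<open>0 < n1\<close> in simp)
    with many0 have "eventually (\<lambda>n. \<forall>x. \<eta> / (8 * n1) * measure mu (K n) \<le> card (\<Gamma> \<inter> (x +o K n))) sequentially"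
    proof eventually_elim
      case (elim n)
      show ?case
      proof
        fix x
        let ?G = "\<Gamma> \<inter> (x +o (K n + C))"
        have fin: "finite ?G"
          by (intro thin_compact[OF thin'] compact_set_plus compact_K C)
        have fin': "finite (\<Gamma>0 \<inter> (a +o C))" for a
          by (rule finite_subset[OF _ thin_compact(1)[OF thin C(1)]]) (auto simp: \<Gamma>0_def)
        have card_le: "card (\<Gamma>0 \<inter> (a +o C)) \<le> n1" for a
        proof -
          have "card (\<Gamma>0 \<inter> (a +o C)) \<le> card (\<Lambda> \<inter> (a +o C))"
            by (intro card_mono thin_compact(1)[OF thin C(1)]) (auto simp: \<Gamma>0_def)
          then show ?thesis
            using thin_compact(2)[OF thin C(1), of a] by (simp add: n1_def)
        qed
        \<comment> \<open>A point in x + K n may be covered from slightly outside, hence the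
          enlargement of \<open>K n\<close> by \<open>C\<close>.\<close>
        have "\<Gamma>0 \<inter> (x +o K n) \<subseteq> (\<Union>a\<in>?G. \<Gamma>0 \<inter> (a +o C))"
        proof
          fix l assume l: "l \<in> \<Gamma>0 \<inter> (x +o K n)"
          then obtain a where a: "a \<in> \<Gamma>" "- a + l \<in> C" using \<Gamma>(3) by blast
          then have "- (- a + l) \<in> C" using C(3) by (metis image_eqI)
          then have "(- x + l) + - (- a + l) \<in> K n + C"
            using l by (intro set_plus_intro) (auto simp: mem_elt_set_plus_iff)
          moreover have "(- x + l) + - (- a + l) = - x + a"
            by (simp only: minus_add add.assoc minus_minus add_minus_cancel)
          ultimately show "l \<in> (\<Union>a\<in>?G. \<Gamma>0 \<inter> (a +o C))"
            using a l by (auto simp: mem_elt_set_plus_iff intro!: bexI[of _ a])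
        qed
        then have "card (\<Gamma>0 \<inter> (x +o K n)) \<le> card (\<Union>a\<in>?G. \<Gamma>0 \<inter> (a +o C))"
          by (intro card_mono finite_UN_I fin fin')
        also have "\<dots> \<le> (\<Sum>a\<in>?G. card (\<Gamma>0 \<inter> (a +o C)))"
          by (rule card_UN_le[OF fin])
        finally have "real (card (\<Gamma>0 \<inter> (x +o K n))) \<le> (\<Sum>a\<in>?G. real (card (\<Gamma>0 \<inter> (a +o C))))"
          by (simp flip: of_nat_sum)
        also have "\<dots> \<le> (\<Sum>a\<in>?G. n1)"
          by (intro sum_mono card_le)
        finally have "\<eta> / 4 * measure mu (K n) \<le> card ?G * n1"
          using elim(1) by (auto intro: order_trans)
        moreover have "card ?G \<le> card (\<Gamma> \<inter> (x +o K n)) + N * measure mu (bdry C' n)"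
          by (rule C'(1))
        moreover have "N * measure mu (bdry C' n) \<le> \<eta> / (8 * n1) * measure mu (K n)"
          using elim(2) measure_K_pos[of n] by (simp add: field_simps)
        ultimately have "\<eta> / 4 * measure mu (K n)
            \<le> (card (\<Gamma> \<inter> (x +o K n)) + \<eta> / (8 * n1) * measure mu (K n)) * n1"
          using \<open>0 < n1\<close> by (smt (verit) mult_right_mono)
        then show "\<eta> / (8 * n1) * measure mu (K n) \<le> card (\<Gamma> \<inter> (x +o K n))"
          using \<open>0 < n1\<close> by (simp add: field_simps)
      qed
    qed
    then have "ennreal (\<eta> / (8 * n1)) \<le> lower_density mu K \<Gamma>"
      by (rule lower_density_geI[OF thin'])
    moreover have "0 < ennreal (\<eta> / (8 * n1))" using \<eta> \<open>0 < n1\<close> by simp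
    ultimately show ?thesis by (rule order.strict_trans2[rotated])
  qed
  ultimately show ?thesis using \<Gamma>_sub by blast
qed

end

theorem theorem1p1:
  fixes mu :: "'g::{topological_group_add, second_countable_topology, t2_space} measure"
    and Q :: "'g set"
    and K :: "nat \<Rightarrow> 'g set"
    and \<pi> :: "'g \<Rightarrow> 'h::complex_hilbert_space \<Rightarrow> 'h"
    and d :: real
    and \<Lambda> :: "'g set"
    and g :: 'h
  assumes "locally compact (UNIV :: 'g set)"
    and "haar_measure mu"
    and "unimodular mu"
    and "amenable mu"
    and "compact Q" and "0 \<in> interior Q" and "uminus ` Q = Q"
    and "strong_folner_seq mu K"
    and "projective_unitary_rep \<pi>"
    and "irreducible_rep \<pi>"
    and "integrable_rep mu \<pi>"
    and "formal_degree mu \<pi> d"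
    and "discrete \<Lambda>"
    and "is_frame (\<lambda>l. \<pi> l g) \<Lambda>"
    and "g \<in> localized_vectors mu Q \<pi>"
    and "lower_density mu K \<Lambda> > ennreal d"
  shows "\<exists>\<Gamma>. \<Gamma> \<subseteq> \<Lambda> \<and> lower_density mu K \<Gamma> > 0 \<and> is_frame (\<lambda>l. \<pi> l g) (\<Lambda> - \<Gamma>)"
proof -
  obtain A B where fr: "frame_bounds A B (\<lambda>l. \<pi> l g) \<Lambda>"
    using assms(14) by (auto simp: is_frame_iff_bounds)
  \<comment> \<open>If g vanished, so would every frame vector, and the lower frame bound would
    contradict the nonzero vector supplied by integrability.\<close>
  have "g \<noteq> 0"
  proof
    assume "g = 0"
    have pi0: "\<pi> x 0 = 0" for x
    proof -
      have "Vector_Spaces.linear scaleC scaleC (\<pi> x)"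
        using assms(9) by (simp add: projective_unitary_rep_def unitary_def)
      then interpret Vector_Spaces.linear "scaleC :: complex \<Rightarrow> 'h \<Rightarrow> 'h" scaleC "\<pi> x" .
      show ?thesis by (rule zero)
    qed
    obtain h :: 'h where "h \<noteq> 0" using assms(11) by (auto simp: integrable_rep_def)
    moreover have "A * (norm h)\<^sup>2 \<le> 0" "0 < A"
      using fr pi0 \<open>g = 0\<close> by (auto simp: frame_bounds_def dest!: spec[of _ h])
    ultimately show False by (simp add: mult_le_0_iff)
  qed
  then interpret coherent_folner mu \<pi> d g Q \<Lambda> A B K
    using assms fr by unfold_locales
  show ?thesis
    using removable_subset[OF assms(16)] by blast
qed

end
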